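(* Fix one of the types $\mathrm{B},\mathrm{C},\mathrm{D}$ and let $\{\mathfrak{S}_w(z,t;x)\}_{w\in W}$ be the double Schubert polynomials. Then: (1) (Basis) $\{\mathfrak{S}_w\}_{w\in W}$ is a $\mathbb{Z}[t]$-basis of $R$. (2) (Relation to Billey–Haiman polynomials) For all $w\in W$, $\mathfrak{S}_w(z,0;x)=\mathfrak{S}_w(z;x)$, where $\mathfrak{S}_w(z,0;x)$ is obtained by setting all $t_i=0$ and $\mathfrak{S}_w(z;x)$ is the Billey–Haiman polynomial. (3) (Symmetry) For all $w\in W$, $\mathfrak{S}_w(-t,-z;x)=\mathfrak{S}_{w^{-1}}(z,t;x)$.
   Context: $t,z,x$ infinite sequences of indeterminates; $Q_k(x)$ defined by $\prod_i\frac{1+x_iu}{1-x_iu}=\sum_kQ_k(x)u^k$, $P_k=\tfrac12Q_k$, $\Gamma=\mathbb{Z}[Q_1,\dots]$, $\Gamma'=\mathbb{Z}[P_1,\dots]$. Type C: $R=\mathbb{Z}[t]\otimes\mathbb{Z}[z]\otimes\Gamma$; types B, D: $R=\mathbb{Z}[t]\otimes\mathbb{Z}[z]\otimes\Gamma'$; grading $\deg t_i=\deg z_i=1$, $\deg Q_k=\deg P_k=k$. $W_\infty$: finitely supported signed permutations of $\{1,2,\dots\}$, Coxeter group on $s_0=(1,\bar1)$, $s_i=(i,i+1)(\bar i,\overline{i+1})$; $W'_\infty$: subgroup with even number of sign changes, Coxeter on $s_{\hat1}=s_0s_1s_0,s_1,s_2,\dots$. Types B, C: $W=W_\infty$, $I=\{0,1,\dots\}$;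 type D: $W=W'_\infty$, $I=\{\hat1,1,2,\dots\}$; $\ell$ the Coxeter length. Actions on $R$: $s_i^z$ ($i\ge1$) swaps $z_i,z_{i+1}$; $s_0^z$: $z_1\mapsto-z_1$, $\varphi(x)\mapsto\varphi(z_1,x_1,x_2,\dots)$ for $\varphi\in\Gamma'$; $s_i^t$ swaps $t_i,t_{i+1}$; $s_0^t$: $t_1\mapsto-t_1$, $\varphi(x)\mapsto\varphi(-t_1,x_1,\dots)$; unmentioned generators fixed; $s_{\hat1}^{z}=s_0^zs_1^zs_0^z$, $s_{\hat1}^t=s_0^ts_1^ts_0^t$. Roots $\alpha_i=t_{i+1}-t_i$ ($i\ge1$), $\alpha_0=t_1$ (B), $2t_1$ (C), $\alpha_{\hat1}=t_1+t_2$ (D). $\omega$: involution $z_i\mapsto-t_i$, $t_i\mapsto -z_i$, fixing $\Gamma'$. $\partial_if=(f-s_i^zf)/\omega(\alpha_i)$, $\delta_if=(f-s_i^tf)/\alpha_i$. Double Schubert polynomials: the unique family $\{\mathfrak{S}_w\}_{w\in W}\subset R$ with $\partial_i\mathfrak{S}_w=\mathfrak{S}_{ws_i}$ if $\ell(ws_i)<\ell(w)$, else $0$; $\delta_i\mathfrak{S}_w=\mathfrak{S}_{s_iw}$ if $\ell(s_iw)<\ell(w)$, else $0$ ($i\in I$); $\mathfrak{S}_e=1$ and zero constant term for $w\ne e$. Billey–Haiman polynomials: the unique family $\{\mathfrak{S}_w(z;x)\}_{w\in W}$ in $\mathbb{Z}[z]\otimes\Gamma$ (type C) resp. $\mathbb{Z}[z]\otimes\Gamma'$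 (types B, D) with $\partial_i\mathfrak{S}_w(z;x)=\mathfrak{S}_{ws_i}(z;x)$ if $\ell(ws_i)<\ell(w)$ and $0$ otherwise, for all $i\in I$, $\mathfrak{S}_e=1$ and zero constant term for $w\ne e$ (existence and uniqueness due to Billey–Haiman). *)

theory Defs
  imports
    Complex_Main
    "HOL-Library.Poly_Mapping"
    "HOL-Computational_Algebra.Formal_Power_Series"
    "HOL-Combinatorics.Permutations"
begin

section \<open>Integral power series in arbitrarily many variables\<close>

typedef 'v series = "UNIV :: (('v \<Rightarrow>\<^sub>0 nat) \<Rightarrow> int) set"
  morphisms coeff Series by simp

setup_lifting type_definition_series

lemma coeff_Series [simp]: "coeff (Series f) m = f m"
  by (simp add: Series_inverse)

lemma series_eqI: "(\<And>m. coeff f m = coeff g m) \<Longrightarrow> f = g"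
  using coeff_inject by blast

lemma finite_below: "finite {a :: 'v \<Rightarrow>\<^sub>0 nat. \<forall>v. Poly_Mapping.lookup a v \<le> Poly_Mapping.lookup m v}"
proof (rule finite_imageD)
  let ?M = "Max (Poly_Mapping.lookup m ` Poly_Mapping.keys m)"
  let ?F = "{f. \<forall>v. (v \<in> Poly_Mapping.keys m \<longrightarrow> f v \<in> {..?M}) \<and> (v \<notin> Poly_Mapping.keys m \<longrightarrow> f v = 0)}"
  have "finite ?F"
    by (rule finite_set_of_finite_funs) auto
  moreover have "Poly_Mapping.lookup ` {a :: 'v \<Rightarrow>\<^sub>0 nat. \<forall>v. Poly_Mapping.lookup a v \<le> Poly_Mapping.lookup m v} \<subseteq> ?F"
  proof (clarsimp simp: in_keys_iff)
    fix a :: "'v \<Rightarrow>\<^sub>0 nat" and v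
    assume le: "\<forall>v. Poly_Mapping.lookup a v \<le> Poly_Mapping.lookup m v"
    show "(0 < Poly_Mapping.lookup m v \<longrightarrow> Poly_Mapping.lookup a v \<le> ?M) \<and>
      (Poly_Mapping.lookup m v = 0 \<longrightarrow> Poly_Mapping.lookup a v = 0)"
    proof (intro conjI impI)
      assume "0 < Poly_Mapping.lookup m v"
      then have "Poly_Mapping.lookup m v \<le> ?M"
        by (intro Max_ge) (auto simp: in_keys_iff)
      then show "Poly_Mapping.lookup a v \<le> ?M"
        using le le_trans by blast
    next
      assume "Poly_Mapping.lookup m v = 0"
      then show "Poly_Mapping.lookup a v = 0"
        using le by (metis le_zero_eq)
    qed
  qed
  ultimately show "finite (Poly_Mapping.lookup ` {a :: 'v \<Rightarrow>\<^sub>0 nat. \<forall>v. Poly_Mapping.lookup a v \<le> Poly_Mapping.lookup m v})"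
    by (rule rev_finite_subset)
  show "inj_on Poly_Mapping.lookup {a :: 'v \<Rightarrow>\<^sub>0 nat. \<forall>v. Poly_Mapping.lookup a v \<le> Poly_Mapping.lookup m v}"
    by (simp add: inj_on_def lookup_inject)
qed

lemma finite_split: "finite {(a, b). a + b = (m :: 'v \<Rightarrow>\<^sub>0 nat)}"
proof (rule finite_subset)
  let ?A = "{a :: 'v \<Rightarrow>\<^sub>0 nat. \<forall>v. Poly_Mapping.lookup a v \<le> Poly_Mapping.lookup m v}"
  show "{(a, b). a + b = m} \<subseteq> ?A \<times> ?A"
    by (auto simp: lookup_add)
  show "finite (?A \<times> ?A)"
    using finite_below by blast
qed

instantiation series :: (type) comm_ring_1
begin

lift_definition zero_series :: "'v series" is "\<lambda>_. 0" .
lift_definition one_series :: "'v series" is "\<lambda>m. if m = 0 then 1 else 0" .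
lift_definition plus_series :: "'v series \<Rightarrow> 'v series \<Rightarrow> 'v series"
  is "\<lambda>f g m. f m + g m" .
lift_definition minus_series :: "'v series \<Rightarrow> 'v series \<Rightarrow> 'v series"
  is "\<lambda>f g m. f m - g m" .
lift_definition uminus_series :: "'v series \<Rightarrow> 'v series"
  is "\<lambda>f m. - f m" .
lift_definition times_series :: "'v series \<Rightarrow> 'v series \<Rightarrow> 'v series"
  is "\<lambda>f g m. \<Sum>(a, b) | a + b = m. f a * g b" .

instance
proof
  fix f g h :: "'v series"
  have fin: "finite {p :: ('v \<Rightarrow>\<^sub>0 nat) \<times> ('v \<Rightarrow>\<^sub>0 nat). fst p + snd p = m}" for m
    using finite_split[of m] by (simp add: case_prod_unfold)
  show "f * g * h = f * (g * h)"
  proof transfer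
    fix f g h :: "('v \<Rightarrow>\<^sub>0 nat) \<Rightarrow> int"
    show "(\<lambda>m. \<Sum>(x, c) | x + c = m. (\<Sum>(a, b) | a + b = x. f a * g b) * h c)
       = (\<lambda>m. \<Sum>(a, y) | a + y = m. f a * (\<Sum>(b, c) | b + c = y. g b * h c))"
    proof
      fix m
      have "(\<Sum>(x, c) | x + c = m. (\<Sum>(a, b) | a + b = x. f a * g b) * h c)
         = (\<Sum>p | fst p + snd p = m. \<Sum>q | fst q + snd q = fst p. f (fst q) * g (snd q) * h (snd p))"
        by (simp add: case_prod_unfold sum_distrib_right)
      also have "\<dots> = (\<Sum>(p, q) \<in> (SIGMA p:{p. fst p + snd p = m}. {q. fst q + snd q = fst p}).
            f (fst q) * g (snd q) * h (snd p))"
        by (rule sum.Sigma) (auto simp: fin)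
      also have "\<dots> = (\<Sum>(p, q) \<in> (SIGMA p:{p. fst p + snd p = m}. {q. fst q + snd q = snd p}).
            f (fst p) * (g (fst q) * h (snd q)))"
        by (rule sum.reindex_bij_witness[where
              i = "\<lambda>((a, y), (b, c)). ((a + b, c), (a, b))" and
              j = "\<lambda>((x, c), (a, b)). ((a, b + c), (b, c))"])
           (auto simp: add.assoc mult.assoc)
      also have "\<dots> = (\<Sum>p | fst p + snd p = m. \<Sum>q | fst q + snd q = snd p.
            f (fst p) * (g (fst q) * h (snd q)))"
        by (rule sum.Sigma[symmetric]) (auto simp: fin)
      also have "\<dots> = (\<Sum>(a, y) | a + y = m. f a * (\<Sum>(b, c) | b + c = y. g b * h c))"
        by (simp add: case_prod_unfold sum_distrib_left)
      finally show "(\<Sum>(x, c) | x + c = m. (\<Sum>(a, b) | a + b = x. f a * g b) * h c)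
         = (\<Sum>(a, y) | a + y = m. f a * (\<Sum>(b, c) | b + c = y. g b * h c))" .
    qed
  qed
  show "f * g = g * f"
  proof transfer
    fix f g :: "('v \<Rightarrow>\<^sub>0 nat) \<Rightarrow> int"
    show "(\<lambda>m. \<Sum>(a, b) | a + b = m. f a * g b) = (\<lambda>m. \<Sum>(a, b) | a + b = m. g a * f b)"
      by (rule ext, rule sum.reindex_bij_witness[where i = prod.swap and j = prod.swap])
         (auto simp: ac_simps)
  qed
  show "1 * f = f"
  proof transfer
    fix f :: "('v \<Rightarrow>\<^sub>0 nat) \<Rightarrow> int"
    show "(\<lambda>m. \<Sum>(a, b) | a + b = m. (if a = 0 then 1 else 0) * f b) = f"
    proof
      fix m
      have "(\<Sum>(a, b) | a + b = m. (if a = 0 then 1 else 0) * f b)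
         = (\<Sum>p \<in> {(0 :: 'v \<Rightarrow>\<^sub>0 nat, m)}. (if fst p = 0 then 1 else 0) * f (snd p))"
        unfolding case_prod_unfold
        by (rule sum.mono_neutral_right) (auto simp: fin)
      then show "(\<Sum>(a, b) | a + b = m. (if a = 0 then 1 else 0) * f b) = f m"
        by simp
    qed
  qed
  show "(f + g) * h = f * h + g * h"
    by transfer (auto simp: case_prod_unfold distrib_right sum.distrib)
  show "(0 :: 'v series) \<noteq> 1"
    by transfer (metis zero_neq_one)
qed (transfer; simp add: fun_eq_iff)+

end

definition var :: "'v \<Rightarrow> 'v series" where
  "var v = Series (\<lambda>m. if m = Poly_Mapping.single v 1 then 1 else 0)"

text \<open>
  The substitution \<open>v \<mapsto> c v * var (h v)\<close>. It is used only for maps \<open>h\<close> with finite fibres, where it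
  is defined on all series: the variables in a monomial \<open>m\<close> have finitely many preimages
  in total, so only finitely many \<open>m'\<close> have image \<open>m\<close>.
\<close>

definition subst :: "('v \<Rightarrow> int) \<Rightarrow> ('v \<Rightarrow> 'v) \<Rightarrow> 'v series \<Rightarrow> 'v series" where
  "subst c h f = Series (\<lambda>m.
     \<Sum>m' | (\<Sum>v\<in>Poly_Mapping.keys m'. Poly_Mapping.single (h v) (Poly_Mapping.lookup m' v)) = m.
       (\<Prod>v\<in>Poly_Mapping.keys m'. c v ^ Poly_Mapping.lookup m' v) * coeff f m')"

text \<open>
  Power series over \<open>\<int>\<close> (in any set of variables) form an integral domain, so a quotient by a
  nonzero series is unique if it exists.
\<close>

definition exact_quot :: "'a :: comm_ring_1 \<Rightarrow> 'a \<Rightarrow> 'a" where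
  "exact_quot f g = (THE q. g * q = f)"

inductive_set subring_gen :: "'a :: comm_ring_1 set \<Rightarrow> 'a set" for G where
  gen: "g \<in> G \<Longrightarrow> g \<in> subring_gen G"
| one: "1 \<in> subring_gen G"
| diff: "f \<in> subring_gen G \<Longrightarrow> g \<in> subring_gen G \<Longrightarrow> f - g \<in> subring_gen G"
| mult: "f \<in> subring_gen G \<Longrightarrow> g \<in> subring_gen G \<Longrightarrow> f * g \<in> subring_gen G"

text \<open>\<open>A\<close> is a subring of the ambient ring, acting on \<open>M\<close> by multiplication.\<close>

definition is_basis :: "'a :: comm_ring_1 set \<Rightarrow> 'a set \<Rightarrow> ('i \<Rightarrow> 'a) \<Rightarrow> 'i set \<Rightarrow> bool" where
  "is_basis A M b J \<longleftrightarrow>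
     b ` J \<subseteq> M \<and>
     (\<forall>F c. finite F \<longrightarrow> F \<subseteq> J \<longrightarrow> c ` F \<subseteq> A \<longrightarrow> (\<Sum>j\<in>F. c j * b j) = 0 \<longrightarrow> (\<forall>j\<in>F. c j = 0)) \<and>
     (\<forall>f\<in>M. \<exists>F c. finite F \<and> F \<subseteq> J \<and> c ` F \<subseteq> A \<and> f = (\<Sum>j\<in>F. c j * b j))"


section \<open>The rings\<close>

text \<open>
  All variables are indexed by the positive integers; the variables with index 0 exist in the
  type but not in the rings below. The tensor products \<open>\<int>[t] \<otimes> \<int>[z] \<otimes> \<Gamma>\<close> and \<open>\<int>[t] \<otimes> \<int>[z] \<otimes> \<Gamma>'\<close> are realised
  as subrings of \<open>\<int>[[t,z,x]]\<close>; multiplication embeds them there because the three factors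
  involve disjoint sets of variables.
\<close>

datatype indet = TV nat | ZV nat | XV nat

abbreviation tvar :: "nat \<Rightarrow> indet series" where "tvar i \<equiv> var (TV i)"
abbreviation zvar :: "nat \<Rightarrow> indet series" where "zvar i \<equiv> var (ZV i)"
abbreviation xvar :: "nat \<Rightarrow> indet series" where "xvar i \<equiv> var (XV i)"

text \<open>
  The infinite product \<open>\<Prod>\<^sub>i (1 + x\<^sub>i u) / (1 - x\<^sub>i u)\<close> is the coefficientwise limit of the finite products,
  where \<open>u\<close> is \<open>fps_X\<close>. The limit is taken in the discrete space \<open>\<int>\<close>, i.e. it is an eventual value.
\<close>

definition Q_ser :: "nat \<Rightarrow> indet series" where
  "Q_ser k = Series (\<lambda>m. lim (\<lambda>N. coeff (fps_nth
     (\<Prod>i=1..N. exact_quot (1 + fps_const (xvar i) * fps_X) (1 - fps_const (xvar i) * fps_X)) k) m))"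

definition P_ser :: "nat \<Rightarrow> indet series" where
  "P_ser k = exact_quot (Q_ser k) 2"

datatype lie_type = TypeB | TypeC | TypeD

definition Gamma_gens :: "lie_type \<Rightarrow> indet series set" where
  "Gamma_gens X = (case X of TypeC \<Rightarrow> Q_ser ` {1..} | _ \<Rightarrow> P_ser ` {1..})"

definition Zt :: "indet series set" where
  "Zt = subring_gen (tvar ` {1..})"

definition ring_R :: "lie_type \<Rightarrow> indet series set" where
  "ring_R X = subring_gen (tvar ` {1..} \<union> zvar ` {1..} \<union> Gamma_gens X)"

definition ring_BH :: "lie_type \<Rightarrow> indet series set" where
  "ring_BH X = subring_gen (zvar ` {1..} \<union> Gamma_gens X)"


section \<open>The Weyl groups\<close>

text \<open>
  Signed permutations are odd permutations of \<open>\<int>\<close>, \<open>-i\<close> standing for \<open>i\<close> with a bar; \<^const>\<open>permutation\<close>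
  means a bijection with finite support.
\<close>

definition W_inf :: "(int \<Rightarrow> int) set" where
  "W_inf = {w. permutation w \<and> (\<forall>i. w (- i) = - w i)}"

definition W_inf' :: "(int \<Rightarrow> int) set" where
  "W_inf' = {w \<in> W_inf. even (card {i. i > 0 \<and> w i < 0})}"

definition weyl :: "lie_type \<Rightarrow> (int \<Rightarrow> int) set" where
  "weyl X = (case X of TypeD \<Rightarrow> W_inf' | _ \<Rightarrow> W_inf)"

datatype node = Node nat | Node_hat1

definition nodes :: "lie_type \<Rightarrow> node set" where
  "nodes X = (case X of TypeD \<Rightarrow> insert Node_hat1 (Node ` {1..}) | _ \<Rightarrow> range Node)"

definition simple_refl :: "nat \<Rightarrow> int \<Rightarrow> int" where
  "simple_refl i =
     (if i = 0 then transpose 1 (- 1)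
      else transpose (int i) (int i + 1) \<circ> transpose (- int i) (- (int i + 1)))"

fun gen_s :: "node \<Rightarrow> int \<Rightarrow> int" where
  "gen_s (Node i) = simple_refl i"
| "gen_s Node_hat1 = simple_refl 0 \<circ> simple_refl 1 \<circ> simple_refl 0"

definition len :: "lie_type \<Rightarrow> (int \<Rightarrow> int) \<Rightarrow> nat" where
  "len X w = (LEAST n. \<exists>is. length is = n \<and> set is \<subseteq> nodes X \<and> w = foldr (\<circ>) (map gen_s is) id)"


section \<open>Actions and divided differences\<close>

text \<open>
  In \<open>s\<^sub>0\<^sup>z\<close> the rule \<open>\<phi>(x) \<mapsto> \<phi>(z\<^sub>1, x\<^sub>1, x\<^sub>2, \<dots>)\<close> is the substitution \<open>x\<^sub>1 \<mapsto> z\<^sub>1\<close>, \<open>x\<^sub>i\<^sub>+\<^sub>1 \<mapsto> x\<^sub>i\<close>;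
  likewise in \<open>s\<^sub>0\<^sup>t\<close>, with \<open>x\<^sub>1 \<mapsto> - t\<^sub>1\<close>.
\<close>

definition refl_z :: "nat \<Rightarrow> indet series \<Rightarrow> indet series" where
  "refl_z i =
     (if i = 0 then
        subst (\<lambda>v. if v = ZV 1 then - 1 else 1)
              (\<lambda>v. case v of XV j \<Rightarrow> (if j = 0 then XV 0 else if j = 1 then ZV 1 else XV (j - 1))
                           | _ \<Rightarrow> v)
      else subst (\<lambda>_. 1) (transpose (ZV i) (ZV (i + 1))))"

definition refl_t :: "nat \<Rightarrow> indet series \<Rightarrow> indet series" where
  "refl_t i =
     (if i = 0 then
        subst (\<lambda>v. if v = TV 1 \<or> v = XV 1 then - 1 else 1)
              (\<lambda>v. case v of XV j \<Rightarrow> (if j = 0 then XV 0 else if j = 1 then TV 1 else XV (j - 1))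
                           | _ \<Rightarrow> v)
      else subst (\<lambda>_. 1) (transpose (TV i) (TV (i + 1))))"

fun s_z :: "node \<Rightarrow> indet series \<Rightarrow> indet series" where
  "s_z (Node i) = refl_z i"
| "s_z Node_hat1 = refl_z 0 \<circ> refl_z 1 \<circ> refl_z 0"

fun s_t :: "node \<Rightarrow> indet series \<Rightarrow> indet series" where
  "s_t (Node i) = refl_t i"
| "s_t Node_hat1 = refl_t 0 \<circ> refl_t 1 \<circ> refl_t 0"

text \<open>
  \<open>omega f\<close> is \<open>f(-t, -z; x)\<close> when \<open>f\<close> is written as \<open>f(z, t; x)\<close>.
\<close>

definition omega :: "indet series \<Rightarrow> indet series" where
  "omega = subst (\<lambda>v. case v of XV _ \<Rightarrow> 1 | _ \<Rightarrow> - 1)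
                 (\<lambda>v. case v of TV i \<Rightarrow> ZV i | ZV i \<Rightarrow> TV i | XV i \<Rightarrow> XV i)"

definition set_t_zero :: "indet series \<Rightarrow> indet series" where
  "set_t_zero = subst (\<lambda>v. case v of TV _ \<Rightarrow> 0 | _ \<Rightarrow> 1) id"

fun simple_root :: "lie_type \<Rightarrow> node \<Rightarrow> indet series" where
  "simple_root X (Node i) =
     (if i = 0 then (if X = TypeC then 2 * tvar 1 else tvar 1) else tvar (i + 1) - tvar i)"
| "simple_root X Node_hat1 = tvar 1 + tvar 2"

definition del_z :: "lie_type \<Rightarrow> node \<Rightarrow> indet series \<Rightarrow> indet series" where
  "del_z X i f = exact_quot (f - s_z i f) (omega (simple_root X i))"

definition del_t :: "lie_type \<Rightarrow> node \<Rightarrow> indet series \<Rightarrow> indet series" where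
  "del_t X i f = exact_quot (f - s_t i f) (simple_root X i)"


section \<open>Double Schubert polynomials and Billey--Haiman polynomials\<close>

text \<open>
  Families indexed by \<open>weyl X\<close> are functions on all maps \<open>int \<Rightarrow> int\<close>, constrained only on \<open>weyl X\<close>.
\<close>

definition double_schubert :: "lie_type \<Rightarrow> ((int \<Rightarrow> int) \<Rightarrow> indet series) \<Rightarrow> bool" where
  "double_schubert X S \<longleftrightarrow>
     (\<forall>w\<in>weyl X. S w \<in> ring_R X) \<and>
     (\<forall>w\<in>weyl X. \<forall>i\<in>nodes X.
        del_z X i (S w) = (if len X (w \<circ> gen_s i) < len X w then S (w \<circ> gen_s i) else 0)) \<and>
     (\<forall>w\<in>weyl X. \<forall>i\<in>nodes X.
        del_t X i (S w) = (if len X (gen_s i \<circ> w) < len X w then S (gen_s i \<circ> w) else 0)) \<and>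
     S id = 1 \<and>
     (\<forall>w\<in>weyl X. w \<noteq> id \<longrightarrow> coeff (S w) 0 = 0)"

definition billey_haiman :: "lie_type \<Rightarrow> ((int \<Rightarrow> int) \<Rightarrow> indet series) \<Rightarrow> bool" where
  "billey_haiman X B \<longleftrightarrow>
     (\<forall>w\<in>weyl X. B w \<in> ring_BH X) \<and>
     (\<forall>w\<in>weyl X. \<forall>i\<in>nodes X.
        del_z X i (B w) = (if len X (w \<circ> gen_s i) < len X w then B (w \<circ> gen_s i) else 0)) \<and>
     B id = 1 \<and>
     (\<forall>w\<in>weyl X. w \<noteq> id \<longrightarrow> coeff (B w) 0 = 0)"

end

theory Submission
  imports Defs "Jordan_Normal_Form.Determinant"
begin

text \<open>
  An element of \<open>R\<close> killed by all \<open>\<partial>\<^sub>i\<close> is invariant under all \<open>s\<^sub>i\<^sup>z\<close>. As it involves finitely many \<open>z\<^sub>j\<close> and is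
  symmetric in all of them, it involves none; then invariance under the sign-changing reflections, which
  move the variables \<open>x\<^sub>1, x\<^sub>2\<close> to \<open>z\<close>-variables, leaves no \<open>x\<^sub>j\<close>, so the element lies in \<open>\<int>[t]\<close>. The comparison
  with the Billey--Haiman polynomials and the symmetry follow by induction on the length: both sides
  satisfy the same recursion for the divided differences, and \<open>\<omega>\<close> exchanges \<open>\<partial>\<^sub>i\<close> and \<open>\<delta>\<^sub>i\<close>.

  For linear independence over \<open>\<int>[t]\<close>, apply \<open>\<partial>\<^sub>w\<close> with \<open>w\<close> of maximal length in the relation. An element
  \<open>f\<close> of \<open>R\<close> is expanded by induction on its degree: the coefficient of \<open>S\<^sub>w\<close> in \<open>f\<close> has to be that of \<open>S\<close> at \<open>w s\<^sub>i\<close> in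
  \<open>\<partial>\<^sub>i f\<close>, for every descent \<open>i\<close> of \<open>w\<close>, and these values agree by the braid relations for the \<open>\<partial>\<^sub>i\<close> on \<open>R\<close>. The
  braid relations are not computed. They hold on the \<open>S\<^sub>u\<close> by the defining recursion, and over the finite
  group of signed permutations of \<open>1, \<dots>, n\<close> the matrix \<open>(s\<^sub>v\<^sup>z S\<^sub>u)\<close> is nonsingular, since the operators \<open>\<partial>\<^sub>v\<close> turn
  it into a unitriangular one; so they hold on all of \<open>R\<close>.
\<close>

text \<open>Existence of the family is a hypothesis, and it is the source of the braid relations:
  the \<open>S u\<close> are sufficiently many test elements. The natural setting would be linear
  algebra over a fraction field; instead, denominators are cleared and only
  \<open>cancellable\<close> elements (non-zero-divisors) are divided out. Writing h_v \<partial>_v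
  as a combination of the s_w and applying it to the S_u gives a factorization diag(h) P = r T with
  P unitriangular, so det T divides a product of cancellable elements. The adjugate of T then
  expresses every s_v f, up to the factor det T, through the s_v S_u. Two facts have to be supplied.
  The operators s_w must depend on w alone; this comes from an invariant product rather than from
  checking Coxeter relations. And T must be finite and square, so a signed permutation fixing
  everything beyond n needs a word in the generators below n whose length is the one taken in the
  infinite group; counting inversions provides it.\<close>

text \<open>Cramer's rule without division: \<open>e\<close> and \<open>q\<close> are the
  determinants of \<open>T\<close> and \<open>r\<close>, and \<open>g\<close> is the adjugate of
  \<open>T\<close> applied to \<open>F\<close>. The factorization makes \<open>e * q\<close> the
  determinant of a triangular matrix with diagonal \<open>h\<close>, so \<open>e\<close> can be
  cancelled as soon as every \<open>h v\<close> can.\<close>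

lemma triangular_factor_solvable:
  fixes P r T :: "'a \<Rightarrow> 'a \<Rightarrow> 'b :: comm_ring_1" and h F :: "'a \<Rightarrow> 'b" and lv :: "'a \<Rightarrow> nat"
  assumes fin: "finite V"
    and eq: "\<And>v u. v \<in> V \<Longrightarrow> u \<in> V \<Longrightarrow> h v * P v u = (\<Sum>w\<in>V. r v w * T w u)"
    and diag: "\<And>v. v \<in> V \<Longrightarrow> P v v = 1"
    and tri: "\<And>v u. v \<in> V \<Longrightarrow> u \<in> V \<Longrightarrow> u \<noteq> v \<Longrightarrow> lv u \<le> lv v \<Longrightarrow> P v u = 0"
  shows "\<exists>e q g. e * q = (\<Prod>v\<in>V. h v) \<and> (\<forall>v\<in>V. e * F v = (\<Sum>u\<in>V. T v u * g u))"
proof -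
  obtain ys where ys: "set ys = V" "distinct ys"
    using fin finite_distinct_list by blast
  \<comment> \<open>Listing \<open>V\<close> by increasing \<open>lv\<close> turns
    \<open>tri\<close> into upper triangularity; ties are harmless because \<open>tri\<close> also
    covers distinct points with equal \<open>lv\<close>.\<close>
  define xs where "xs = sort_key lv ys"
  define n where "n = length xs"
  have xs: "set xs = V" "distinct xs" "sorted (map lv xs)"
    using ys by (simp_all add: xs_def)
  have bij: "bij_betw (\<lambda>i. xs ! i) {0..<n} V"
    using bij_betw_nth[OF xs(2) _ xs(1)[symmetric]] by (simp add: n_def lessThan_atLeast0)
  have nV: "xs ! i \<in> V" if "i < n" for i
    using that xs n_def by auto
  have sumV: "(\<Sum>w\<in>V. k w) = (\<Sum>i = 0..<n. k (xs ! i))" for k :: "'a \<Rightarrow> 'b"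
    using sum.reindex_bij_betw[OF bij, of k] by simp
  define Tm where "Tm = mat n n (\<lambda>(i, j). T (xs ! i) (xs ! j))"
  define rm where "rm = mat n n (\<lambda>(i, j). r (xs ! i) (xs ! j))"
  define Pm where "Pm = mat n n (\<lambda>(i, j). h (xs ! i) * P (xs ! i) (xs ! j))"
  define Fv where "Fv = vec n (\<lambda>i. F (xs ! i))"
  have car: "Tm \<in> carrier_mat n n" "rm \<in> carrier_mat n n" "Pm \<in> carrier_mat n n" "Fv \<in> carrier_vec n"
    by (auto simp: Tm_def rm_def Pm_def Fv_def)
  have PrT: "Pm = rm * Tm"
    by (rule eq_matI) (auto simp: Pm_def rm_def Tm_def scalar_prod_def eq nV sumV intro!: sum.cong)
  have "upper_triangular Pm"
  proof (rule upper_triangularI)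
    fix i j assume ij: "j < i" "i < dim_row Pm"
    then have "i < n" by (simp add: Pm_def)
    have "map lv xs ! j \<le> map lv xs ! i"
      using xs(3) ij \<open>i < n\<close> by (intro sorted_nth_mono) (auto simp: n_def)
    then have "lv (xs ! j) \<le> lv (xs ! i)"
      using ij \<open>i < n\<close> by (simp add: n_def)
    moreover have "xs ! j \<noteq> xs ! i"
      using ij \<open>i < n\<close> xs(2) by (simp add: n_def nth_eq_iff_index_eq)
    ultimately show "Pm $$ (i, j) = 0"
      using ij \<open>i < n\<close> nV by (simp add: Pm_def tri)
  qed
  then have "det Pm = prod_list (diag_mat Pm)"
    using car by (intro det_upper_triangular)
  also have "\<dots> = (\<Prod>i = 0..<n. h (xs ! i))"
    by (auto simp: prod_list_diag_prod Pm_def diag nV intro!: prod.cong)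
  also have "\<dots> = (\<Prod>v\<in>V. h v)"
    using prod.reindex_bij_betw[OF bij, of h] by simp
  finally have det: "det Tm * det rm = (\<Prod>v\<in>V. h v)"
    using det_mult[OF car(2,1)] PrT by (simp add: mult.commute)
  define gv where "gv = adj_mat Tm *\<^sub>v Fv"
  have gv: "gv \<in> carrier_vec n"
    using adj_mat[OF car(1)] car by (auto simp: gv_def)
  have "Tm *\<^sub>v gv = (Tm * adj_mat Tm) *\<^sub>v Fv"
    unfolding gv_def using adj_mat(1)[OF car(1)] car by (intro assoc_mult_mat_vec[symmetric])
  also have "\<dots> = det Tm \<cdot>\<^sub>v Fv"
    unfolding adj_mat(2)[OF car(1)] using car
    by (intro eq_vecI) (simp_all add: smult_scalar_prod_distrib[of _ n])
  finally have sol: "Tm *\<^sub>v gv = det Tm \<cdot>\<^sub>v Fv" .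
  define g where "g w = gv $ (inv_into {0..<n} (\<lambda>i. xs ! i) w)" for w
  have g: "g (xs ! j) = gv $ j" if "j < n" for j
    using bij that by (simp add: g_def bij_betw_def)
  have "det Tm * F v = (\<Sum>u\<in>V. T v u * g u)" if "v \<in> V" for v
  proof -
    have "v \<in> set xs"
      by (simp only: xs(1) that)
    then obtain i where i: "i < n" "v = xs ! i"
      unfolding n_def in_set_conv_nth by metis
    have "det Tm * F v = (det Tm \<cdot>\<^sub>v Fv) $ i"
      using i(1) by (simp add: Fv_def i(2))
    also have "\<dots> = (Tm *\<^sub>v gv) $ i"
      by (simp only: sol)
    also have "\<dots> = (\<Sum>j = 0..<n. T v (xs ! j) * g (xs ! j))"
      using i(1) gv by (auto simp: Tm_def scalar_prod_def g i(2) intro!: sum.cong)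
    finally show ?thesis
      by (simp add: sumV)
  qed
  then show ?thesis
    using det by blast
qed

(* HOL-Algebra would otherwise parse inv w as an inverse in a group record. *)
no_notation m_inv (\<open>(\<open>open_block notation=\<open>prefix inv\<close>\<close>inv\<index> _)\<close> [81] 80)
no_notation vec_index (infixl \<open>$\<close> 100)
unbundle fps_syntax
hide_const (open) Polynomial.coeff

section \<open>Substitutions in power series\<close>

abbreviation "exponent \<equiv> Poly_Mapping.lookup"
abbreviation "variables \<equiv> Poly_Mapping.keys"

text \<open>The action on exponents hidden in \<open>subst\<close>: a monomial \<open>m\<close> goes
  to \<open>mono_coeff c m\<close> times the monomial \<open>push h m\<close>.\<close>

definition push :: "('v \<Rightarrow> 'w) \<Rightarrow> ('v \<Rightarrow>\<^sub>0 nat) \<Rightarrow> ('w \<Rightarrow>\<^sub>0 nat)" where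
  "push h m = (\<Sum>v\<in>variables m. Poly_Mapping.single (h v) (exponent m v))"

definition mono_coeff :: "('v \<Rightarrow> int) \<Rightarrow> ('v \<Rightarrow>\<^sub>0 nat) \<Rightarrow> int" where
  "mono_coeff c m = (\<Prod>v\<in>variables m. c v ^ exponent m v)"

lemma push_superset: "finite A \<Longrightarrow> variables m \<subseteq> A \<Longrightarrow> push h m = (\<Sum>v\<in>A. Poly_Mapping.single (h v) (exponent m v))"
  unfolding push_def by (rule sum.mono_neutral_left) (auto simp: in_keys_iff)

lemma mono_coeff_superset: "finite A \<Longrightarrow> variables m \<subseteq> A \<Longrightarrow> mono_coeff c m = (\<Prod>v\<in>A. c v ^ exponent m v)"
  unfolding mono_coeff_def by (rule prod.mono_neutral_left) (auto simp: in_keys_iff)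

lemma keys_add_nat: "variables (a + b :: 'v \<Rightarrow>\<^sub>0 nat) = variables a \<union> variables b"
  by (auto simp: in_keys_iff lookup_add)

lemma push_add: "push h (a + b) = push h a + push h b"
proof -
  have "push h (a + b) = (\<Sum>v\<in>variables a \<union> variables b. Poly_Mapping.single (h v) (exponent (a + b) v))"
    by (rule push_superset) (auto simp: keys_add_nat)
  also have "\<dots> = push h a + push h b"
    by (simp add: push_superset[of "variables a \<union> variables b" a] push_superset[of "variables a \<union> variables b" b]
        lookup_add single_add sum.distrib)
  finally show ?thesis .
qed

lemma mono_coeff_add: "mono_coeff c (a + b) = mono_coeff c a * mono_coeff c b"
proof -
  have "mono_coeff c (a + b) = (\<Prod>v\<in>variables a \<union> variables b. c v ^ exponent (a + b) v)"
    by (rule mono_coeff_superset) (auto simp: keys_add_nat)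
  also have "\<dots> = mono_coeff c a * mono_coeff c b"
    by (simp add: mono_coeff_superset[of "variables a \<union> variables b" a] mono_coeff_superset[of "variables a \<union> variables b" b]
        lookup_add power_add prod.distrib)
  finally show ?thesis .
qed

lemma push_0 [simp]: "push h 0 = 0"
  by (simp add: push_def)

lemma mono_coeff_0 [simp]: "mono_coeff c 0 = 1"
  by (simp add: mono_coeff_def)

lemma push_single [simp]: "push h (Poly_Mapping.single v k) = Poly_Mapping.single (h v) k"
  by (simp add: push_def)

lemma mono_coeff_single [simp]: "mono_coeff c (Poly_Mapping.single v k) = c v ^ k"
  by (simp add: mono_coeff_def)

lemma push_sum: "push h (sum f A) = (\<Sum>x\<in>A. push h (f x))"
  by (induction A rule: infinite_finite_induct) (auto simp: push_add)

lemma mono_coeff_sum: "mono_coeff c (sum f A) = (\<Prod>x\<in>A. mono_coeff c (f x))"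
  by (induction A rule: infinite_finite_induct) (auto simp: mono_coeff_add)

lemma push_push: "push h (push h' m) = push (h \<circ> h') m"
  by (simp add: push_def[of h' m] push_sum) (simp add: push_def)

lemma mono_coeff_push: "mono_coeff c (push h m) = mono_coeff (c \<circ> h) m"
  by (simp add: push_def mono_coeff_sum) (simp add: mono_coeff_def)

lemma mono_coeff_mult: "mono_coeff (\<lambda>v. c v * c' v) m = mono_coeff c m * mono_coeff c' m"
  by (simp add: mono_coeff_def power_mult_distrib prod.distrib)

lemma mono_coeff_eq_1: "(\<And>v. v \<in> variables m \<Longrightarrow> c v = 1) \<Longrightarrow> mono_coeff c m = 1"
  by (simp add: mono_coeff_def)

lemma lookup_push: "exponent (push h m) w = (\<Sum>v\<in>{v \<in> variables m. h v = w}. exponent m v)"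
proof -
  have "exponent (push h m) w = (\<Sum>v\<in>variables m. if h v = w then exponent m v else 0)"
    by (simp add: push_def lookup_sum lookup_single when_def)
  then show ?thesis
    by (simp add: sum.inter_filter)
qed

lemma lookup_le_push: "exponent m v \<le> exponent (push h m) (h v)"
proof (cases "v \<in> variables m")
  case True
  then show ?thesis
    unfolding lookup_push by (intro member_le_sum) auto
qed (simp add: in_keys_iff)

lemma keys_push: "variables (push h m) = h ` variables m"
proof -
  have "exponent (push h m) w \<noteq> 0 \<longleftrightarrow> w \<in> h ` variables m" for w
    by (auto simp: lookup_push in_keys_iff)
  then show ?thesis
    by (auto simp: in_keys_iff)
qed

lemma lookup_push_inj:
  assumes "inj_on h A" "variables m \<subseteq> A" "v \<in> A"
  shows "exponent (push h m) (h v) = exponent m v"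
proof -
  have "{u \<in> variables m. h u = h v} = (if v \<in> variables m then {v} else {})"
    using assms by (auto dest: inj_onD)
  then show ?thesis
    by (auto simp: lookup_push in_keys_iff)
qed

lemma push_inj_on:
  assumes "inj_on h A" "variables m \<subseteq> A" "variables m' \<subseteq> A" "push h m = push h m'"
  shows "m = m'"
proof (rule poly_mapping_eqI)
  fix v
  show "exponent m v = exponent m' v"
  proof (cases "v \<in> A")
    case True
    then show ?thesis
      using lookup_push_inj[OF assms(1,2)] lookup_push_inj[OF assms(1,3)] assms(4) by metis
  next
    case False
    then show ?thesis
      using assms(2,3) by (metis in_keys_iff subsetD)
  qed
qed

lemma push_id: "(\<And>v. v \<in> variables m \<Longrightarrow> h v = v) \<Longrightarrow> push h m = m"
proof (rule poly_mapping_eqI)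
  fix k
  assume id: "\<And>v. v \<in> variables m \<Longrightarrow> h v = v"
  then have "{v \<in> variables m. h v = k} = (if k \<in> variables m then {k} else {})"
    by auto
  then show "exponent (push h m) k = exponent m k"
    by (auto simp: lookup_push in_keys_iff)
qed

definition finite_fibres :: "('v \<Rightarrow> 'w) \<Rightarrow> bool" where
  "finite_fibres h \<longleftrightarrow> (\<forall>w. finite (h -` {w}))"

lemma finite_fibres_vimage: "finite_fibres h \<Longrightarrow> finite A \<Longrightarrow> finite (h -` A)"
proof -
  assume "finite_fibres h" "finite A"
  moreover have "h -` A = (\<Union>w\<in>A. h -` {w})" by auto
  ultimately show "finite (h -` A)" by (auto simp: finite_fibres_def)
qed

lemma finite_fibres_comp: "finite_fibres h \<Longrightarrow> finite_fibres h' \<Longrightarrow> finite_fibres (h \<circ> h')"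
  using finite_fibres_vimage[of h'] by (auto simp: finite_fibres_def vimage_comp[symmetric])

lemma finite_fibres_bij: "bij h \<Longrightarrow> finite_fibres h"
  by (auto simp: finite_fibres_def bij_def intro: finite_vimageI)

text \<open>A preimage of \<open>m\<close> involves only variables that \<open>h\<close> sends into
  \<open>m\<close>, each with at most the exponent of its image; \<open>M\<close> is the monomial
  made of these bounds.\<close>

lemma finite_push_fibre:
  assumes "finite_fibres h"
  shows "finite {m'. push h m' = m}"
proof (rule finite_subset)
  define A where "A = h -` variables m"
  have A: "finite A"
    using finite_fibres_vimage[OF assms] by (simp add: A_def)
  define M where "M = (\<Sum>v\<in>A. Poly_Mapping.single v (exponent m (h v)))"
  show "finite {a. \<forall>v. exponent a v \<le> exponent M v}"
    by (rule finite_below)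
  show "{m'. push h m' = m} \<subseteq> {a. \<forall>v. exponent a v \<le> exponent M v}"
  proof clarify
    fix m' v assume m: "m = push h m'"
    have "exponent M v = (if v \<in> A then exponent m (h v) else 0)"
      using A by (simp add: M_def lookup_sum lookup_single when_def sum.delta)
    moreover have "v \<in> A" if "exponent m' v \<noteq> 0"
      using that by (auto simp: A_def m keys_push in_keys_iff)
    ultimately show "exponent m' v \<le> exponent M v"
      using lookup_le_push[of m' v h] m by auto
  qed
qed

lemma coeff_0 [simp]: "coeff 0 m = 0"
  by (simp add: zero_series.rep_eq)

lemma coeff_1: "coeff 1 m = (if m = 0 then 1 else 0)"
  by (simp add: one_series.rep_eq)

lemma coeff_add [simp]: "coeff (f + g) m = coeff f m + coeff g m"
  by (simp add: plus_series.rep_eq)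

lemma coeff_diff [simp]: "coeff (f - g) m = coeff f m - coeff g m"
  by (simp add: minus_series.rep_eq)

lemma coeff_uminus [simp]: "coeff (- f) m = - coeff f m"
  by (simp add: uminus_series.rep_eq)

lemma coeff_mult: "coeff (f * g) m = (\<Sum>(a, b) | a + b = m. coeff f a * coeff g b)"
  by (simp add: times_series.rep_eq)

lemma coeff_var: "coeff (var v) m = (if m = Poly_Mapping.single v 1 then 1 else 0)"
  by (simp add: var_def)

lemma coeff_subst: "coeff (subst c h f) m = (\<Sum>m' | push h m' = m. mono_coeff c m' * coeff f m')"
  by (simp add: subst_def push_def mono_coeff_def)

lemma coeff_sum: "coeff (sum f A) m = (\<Sum>x\<in>A. coeff (f x) m)"
  by (induction A rule: infinite_finite_induct) auto

lemma coeff_of_nat_mult: "coeff (of_nat k * f) m = int k * coeff f m"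
  by (induction k) (auto simp: algebra_simps)

lemma coeff_of_int_mult: "coeff (of_int k * f) m = k * coeff f m"
  by (cases k rule: int_diff_cases) (auto simp: coeff_of_nat_mult left_diff_distrib)

lemma coeff_numeral_mult [simp]: "coeff (numeral k * f) m = numeral k * coeff f m"
  using coeff_of_int_mult[of "numeral k" f m] by simp

text \<open>A splitting a + b of a preimage of \<open>m\<close> induces the splitting
  \<open>push h a + push h b\<close> of \<open>m\<close>; the double sum is regrouped accordingly,
  finite fibres keeping all sums finite.\<close>

lemma subst_mult:
  assumes "finite_fibres h"
  shows "subst c h (f * g) = subst c h f * subst c h g"
proof (rule series_eqI)
  fix m
  note fin = finite_push_fibre[OF assms]
  have finS: "finite {p :: ('a \<Rightarrow>\<^sub>0 nat) \<times> ('a \<Rightarrow>\<^sub>0 nat). fst p + snd p = m}" for m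
    using finite_split[of m] by (simp add: case_prod_unfold)
  let ?F = "\<lambda>a b. (mono_coeff c a * coeff f a) * (mono_coeff c b * coeff g b)"
  have "coeff (subst c h (f * g)) m =
     (\<Sum>m' | push h m' = m. \<Sum>p | fst p + snd p = m'. ?F (fst p) (snd p))"
    unfolding coeff_subst coeff_mult case_prod_unfold sum_distrib_left
    by (intro sum.cong refl) (auto simp: mono_coeff_add)
  also have "\<dots> = (\<Sum>(m', p)\<in>(SIGMA m':{m'. push h m' = m}. {p. fst p + snd p = m'}). ?F (fst p) (snd p))"
    by (rule sum.Sigma) (auto simp: fin finS)
  also have "\<dots> = (\<Sum>(q, p)\<in>(SIGMA q:{q. fst q + snd q = m}. {a. push h a = fst q} \<times> {b. push h b = snd q}).
       ?F (fst p) (snd p))"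
    by (rule sum.reindex_bij_witness[where
          i = "\<lambda>(q, p). (fst p + snd p, p)" and j = "\<lambda>(m', p). ((push h (fst p), push h (snd p)), p)"])
       (auto simp: push_add)
  also have "\<dots> = (\<Sum>q | fst q + snd q = m. \<Sum>p\<in>{a. push h a = fst q} \<times> {b. push h b = snd q}. ?F (fst p) (snd p))"
    by (rule sum.Sigma[symmetric]) (auto simp: fin finS)
  also have "\<dots> = (\<Sum>q | fst q + snd q = m. coeff (subst c h f) (fst q) * coeff (subst c h g) (snd q))"
    unfolding coeff_subst sum_product sum.cartesian_product by (simp add: case_prod_unfold)
  also have "\<dots> = coeff (subst c h f * subst c h g) m"
    by (simp add: coeff_mult case_prod_unfold)
  finally show "coeff (subst c h (f * g)) m = coeff (subst c h f * subst c h g) m" .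
qed

lemma subst_add: "subst c h (f + g) = subst c h f + subst c h g"
  by (rule series_eqI) (simp add: coeff_subst algebra_simps sum.distrib)

lemma subst_1: "finite_fibres h \<Longrightarrow> subst c h 1 = 1"
proof (rule series_eqI)
  fix m :: "'a \<Rightarrow>\<^sub>0 nat"
  assume ff: "finite_fibres h"
  have "coeff (subst c h 1) m = (\<Sum>m' | push h m' = m. if m' = 0 then 1 else 0)"
    unfolding coeff_subst by (intro sum.cong) (auto simp: coeff_1)
  also have "\<dots> = (if push h 0 = m then 1 else 0)"
    by (subst sum.delta) (auto simp: finite_push_fibre[OF ff])
  finally show "coeff (subst c h 1) m = coeff 1 m"
    by (auto simp: coeff_1)
qed

lemma subst_0: "subst c h 0 = 0"
  by (rule series_eqI) (simp add: coeff_subst)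

lemma comm_ring_hom_subst: "finite_fibres h \<Longrightarrow> comm_ring_hom (subst c h)"
  by unfold_locales (auto simp: subst_mult subst_add subst_1 subst_0)

lemma subst_var: "finite_fibres h \<Longrightarrow> subst c h (var v) = of_int (c v) * var (h v)"
proof (rule series_eqI)
  fix m :: "'a \<Rightarrow>\<^sub>0 nat"
  assume ff: "finite_fibres h"
  have "coeff (subst c h (var v)) m = (\<Sum>m' | push h m' = m. if m' = Poly_Mapping.single v 1 then c v else 0)"
    unfolding coeff_subst by (intro sum.cong) (auto simp: coeff_var)
  also have "\<dots> = (if Poly_Mapping.single (h v) 1 = m then c v else 0)"
    by (subst sum.delta) (auto simp: finite_push_fibre[OF ff])
  finally show "coeff (subst c h (var v)) m = coeff (of_int (c v) * var (h v)) m"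
    by (auto simp: coeff_of_int_mult coeff_var)
qed

lemma subst_subst:
  assumes "finite_fibres h" "finite_fibres h'"
  shows "subst c h (subst c' h' f) = subst (\<lambda>v. c' v * c (h' v)) (h \<circ> h') f"
proof (rule series_eqI)
  fix m
  note fin = finite_push_fibre[OF assms(1)] finite_push_fibre[OF assms(2)]
  let ?F = "\<lambda>m''. mono_coeff c (push h' m'') * (mono_coeff c' m'' * coeff f m'')"
  have "coeff (subst c h (subst c' h' f)) m = (\<Sum>m' | push h m' = m. \<Sum>m'' | push h' m'' = m'. ?F m'')"
    unfolding coeff_subst sum_distrib_left by (intro sum.cong) auto
  also have "\<dots> = (\<Sum>(m', m'')\<in>(SIGMA m':{m'. push h m' = m}. {m''. push h' m'' = m'}). ?F m'')"
    by (rule sum.Sigma) (auto simp: fin)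
  also have "\<dots> = (\<Sum>m'' | push h (push h' m'') = m. ?F m'')"
    by (rule sum.reindex_bij_witness[where i = "\<lambda>m''. (push h' m'', m'')" and j = snd]) auto
  also have "\<dots> = coeff (subst (\<lambda>v. c' v * c (h' v)) (h \<circ> h') f) m"
    unfolding coeff_subst push_push mono_coeff_push
    by (intro sum.cong) (auto simp: mono_coeff_mult o_def)
  finally show "coeff (subst c h (subst c' h' f)) m = coeff (subst (\<lambda>v. c' v * c (h' v)) (h \<circ> h') f) m" .
qed

definition vars_in :: "'v set \<Rightarrow> 'v series \<Rightarrow> bool" where
  "vars_in A f \<longleftrightarrow> (\<forall>m. coeff f m \<noteq> 0 \<longrightarrow> variables m \<subseteq> A)"

lemma vars_in_mono: "vars_in A f \<Longrightarrow> A \<subseteq> B \<Longrightarrow> vars_in B f"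
  by (auto simp: vars_in_def)

lemma vars_in_0: "vars_in A 0"
  by (simp add: vars_in_def)

lemma vars_in_1: "vars_in A 1"
  by (simp add: vars_in_def coeff_1)

lemma vars_in_var: "v \<in> A \<Longrightarrow> vars_in A (var v)"
  by (simp add: vars_in_def coeff_var)

lemma vars_in_add: "vars_in A f \<Longrightarrow> vars_in A g \<Longrightarrow> vars_in A (f + g)"
  unfolding vars_in_def by (metis add.left_neutral coeff_add)

lemma vars_in_diff: "vars_in A f \<Longrightarrow> vars_in A g \<Longrightarrow> vars_in A (f - g)"
  unfolding vars_in_def by (metis coeff_diff diff_zero)

lemma vars_in_numeral_mult: "vars_in A f \<Longrightarrow> vars_in A (numeral k * f)"
  by (simp add: vars_in_def)

lemma vars_in_mult:
  assumes "vars_in A f" "vars_in A g"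
  shows "vars_in A (f * g)"
  unfolding vars_in_def
proof (intro allI impI)
  fix m assume "coeff (f * g) m \<noteq> 0"
  then obtain p where "p \<in> {(a, b). a + b = m}" "(case p of (a, b) \<Rightarrow> coeff f a * coeff g b) \<noteq> 0"
    unfolding coeff_mult by (meson sum.not_neutral_contains_not_neutral)
  then show "variables m \<subseteq> A"
    using assms unfolding vars_in_def by (fastforce simp: keys_add_nat)
qed

text \<open>Injectivity of \<open>h\<close> on the variables that can occur leaves \<open>m\<close>
  as the only preimage that can contribute. This turns invariance under a reflection into a
  statement about which monomials occur.\<close>

lemma coeff_subst_push:
  assumes "vars_in A f" "inj_on h A" "\<And>v. v \<in> A \<Longrightarrow> c v = 1" "variables m \<subseteq> A" "finite_fibres h"
  shows "coeff (subst c h f) (push h m) = coeff f m"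
proof -
  have "coeff (subst c h f) (push h m) = (\<Sum>m' | push h m' = push h m. if m' = m then coeff f m else 0)"
    unfolding coeff_subst
  proof (intro sum.cong refl)
    fix m' assume m': "m' \<in> {m'. push h m' = push h m}"
    show "mono_coeff c m' * coeff f m' = (if m' = m then coeff f m else 0)"
    proof (cases "coeff f m' = 0")
      case False
      then have "variables m' \<subseteq> A"
        using assms(1) by (auto simp: vars_in_def)
      then have "m' = m"
        using push_inj_on[OF assms(2)] m' assms(4) by auto
      moreover have "mono_coeff c m = 1"
        using assms(3,4) by (intro mono_coeff_eq_1) auto
      ultimately show ?thesis by simp
    qed auto
  qed
  also have "\<dots> = coeff f m"
    by (subst sum.delta) (auto simp: finite_push_fibre[OF assms(5)])
  finally show ?thesis .
qed

lemma vars_in_subst: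
  assumes "vars_in A f"
  shows "vars_in (h ` A) (subst c h f)"
  unfolding vars_in_def
proof (intro allI impI)
  fix m assume "coeff (subst c h f) m \<noteq> 0"
  then obtain m' where "push h m' = m" "coeff f m' \<noteq> 0"
    unfolding coeff_subst by (metis (mono_tags, lifting) mem_Collect_eq mult_zero_right sum.neutral)
  then show "variables m \<subseteq> h ` A"
    using assms unfolding vars_in_def by (fastforce simp: keys_push)
qed

lemma subst_fixing:
  assumes "vars_in A f" "\<And>v. v \<in> A \<Longrightarrow> h v = v \<and> c v = 1" "finite_fibres h"
  shows "subst c h f = f"
proof (rule series_eqI)
  fix m
  have inj: "inj_on h A"
    using assms(2) by (auto simp: inj_on_def)
  have im: "h ` A = A"
    using assms(2) by force
  show "coeff (subst c h f) m = coeff f m"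
  proof (cases "variables m \<subseteq> A")
    case True
    then have "push h m = m"
      using assms(2) by (intro push_id) auto
    then show ?thesis
      using coeff_subst_push[OF assms(1) inj _ True assms(3), of c] assms(2) by auto
  next
    case False
    then show ?thesis
      using vars_in_subst[OF assms(1), where c = c and h = h] assms(1)
      unfolding im vars_in_def by metis
  qed
qed

section \<open>Non-zero-divisors and exact division\<close>

definition cancellable :: "'a :: comm_ring_1 \<Rightarrow> bool" where
  "cancellable a \<longleftrightarrow> (\<forall>x. a * x = 0 \<longrightarrow> x = 0)"

lemma cancellableD: "cancellable a \<Longrightarrow> a * x = a * y \<Longrightarrow> x = y"
  unfolding cancellable_def by (metis eq_iff_diff_eq_0 right_diff_distrib)

lemma cancellable_1: "cancellable 1"
  by (simp add: cancellable_def)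

lemma cancellable_mult: "cancellable a \<Longrightarrow> cancellable b \<Longrightarrow> cancellable (a * b)"
  unfolding cancellable_def mult.assoc by blast

lemma cancellable_factor: "cancellable (a * b) \<Longrightarrow> cancellable a"
  unfolding cancellable_def by (metis mult.assoc mult.commute mult_zero_right)

lemma cancellable_uminus: "cancellable a \<Longrightarrow> cancellable (- a)"
  unfolding cancellable_def by (metis minus_mult_left neg_equal_0_iff_equal)

lemma cancellable_prod: "(\<And>x. x \<in> A \<Longrightarrow> cancellable (f x)) \<Longrightarrow> cancellable (prod f A)"
  by (induction A rule: infinite_finite_induct) (auto simp: cancellable_1 cancellable_mult)

lemma exact_quot_eq: "cancellable g \<Longrightarrow> g * q = f \<Longrightarrow> exact_quot f g = q"
  unfolding exact_quot_def by (rule the_equality) (assumption, metis cancellableD)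

lemma coeff_var_mult: "coeff (var v * f) (m + Poly_Mapping.single v 1) = coeff f m"
proof -
  have "coeff (var v * f) (m + Poly_Mapping.single v 1)
      = (\<Sum>p\<in>{(a, b). a + b = m + Poly_Mapping.single v 1}. if p = (Poly_Mapping.single v 1, m) then coeff f m else 0)"
    unfolding coeff_mult by (intro sum.cong) (auto simp: coeff_var add.commute[of m] split: if_splits)
  also have "\<dots> = coeff f m"
    by (subst sum.delta) (auto simp: finite_split add.commute)
  finally show ?thesis .
qed

lemma coeff_var_mult_0: "exponent m v = 0 \<Longrightarrow> coeff (var v * f) m = 0"
  unfolding coeff_mult by (intro sum.neutral) (auto simp: coeff_var lookup_add)

text \<open>Compare coefficients at \<open>m\<close> times \<open>a\<close>: the coefficient of
  \<open>f\<close> at \<open>m\<close> is - s times the one at m a / b, where the exponent of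
  \<open>b\<close> is smaller because \<open>a\<close> and \<open>b\<close> differ. The descent ends
  at monomials free of \<open>b\<close>, where the coefficient vanishes.\<close>

lemma cancellable_linear:
  assumes "a \<noteq> b"
  shows "cancellable (var a + of_int s * var b :: 'v series)"
  unfolding cancellable_def
proof (intro allI impI)
  fix f assume f: "(var a + of_int s * var b) * f = 0"
  have "coeff f m = 0" for m
  proof (induction "exponent m b" arbitrary: m)
    case (0 m)
    have "coeff ((var a + of_int s * var b) * f) (m + Poly_Mapping.single a 1)
      = coeff f m + s * coeff (var b * f) (m + Poly_Mapping.single a 1)"
      by (simp add: distrib_right coeff_var_mult mult.assoc coeff_of_int_mult del: One_nat_def)
    moreover have "exponent (m + Poly_Mapping.single a 1) b = 0"
      using 0 assms by (simp add: lookup_add lookup_single when_def)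
    ultimately show ?case
      using f by (simp add: coeff_var_mult_0)
  next
    case (Suc n m)
    define m' where "m' = m - Poly_Mapping.single b 1"
    have m: "m = m' + Poly_Mapping.single b 1"
      using Suc.hyps(2) by (intro poly_mapping_eqI) (auto simp: m'_def lookup_add lookup_minus lookup_single when_def)
    have m2: "m + Poly_Mapping.single a 1 = (m' + Poly_Mapping.single a 1) + Poly_Mapping.single b 1"
      by (simp add: m algebra_simps)
    have "coeff ((var a + of_int s * var b) * f) (m + Poly_Mapping.single a 1)
      = coeff f m + s * coeff (var b * f) (m + Poly_Mapping.single a 1)"
      by (simp add: distrib_right coeff_var_mult mult.assoc coeff_of_int_mult del: One_nat_def)
    moreover have "coeff (var b * f) (m + Poly_Mapping.single a 1) = coeff f (m' + Poly_Mapping.single a 1)"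
      unfolding m2 by (rule coeff_var_mult)
    moreover have "coeff f (m' + Poly_Mapping.single a 1) = 0"
      using Suc.hyps(2) assms m by (intro Suc.hyps(1)) (auto simp: lookup_add lookup_single when_def)
    ultimately show ?case
      by (simp only: f) simp
  qed
  then show "f = 0"
    by (intro series_eqI) simp
qed

lemma cancellable_var: "cancellable (var v)"
  unfolding cancellable_def
proof (intro allI impI)
  fix f assume f: "var v * f = 0"
  show "f = 0"
  proof (rule series_eqI)
    fix m
    have "coeff f m = coeff (var v * f) (m + Poly_Mapping.single v 1)"
      by (rule coeff_var_mult[symmetric])
    then show "coeff f m = coeff 0 m"
      by (simp only: f coeff_0)
  qed
qed

lemma cancellable_numeral: "cancellable (numeral k :: 'v series)"
  unfolding cancellable_def
proof (intro allI impI)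
  fix f :: "'v series" assume f: "numeral k * f = 0"
  show "f = 0"
  proof (rule series_eqI)
    fix m
    show "coeff f m = coeff 0 m"
      using coeff_numeral_mult[of k f m] by (simp add: f)
  qed
qed

section \<open>The series of the Schur Q-functions\<close>

definition geo :: "'a :: comm_ring_1 \<Rightarrow> 'a fps" where
  "geo a = Abs_fps (\<lambda>n. a ^ n)"

text \<open>The factor (1 + a u)/(1 - a u) of the generating function of the Q_k, with
  \<open>geo a\<close> as the inverse of 1 - a u. It makes sense for every ring element
  \<open>a\<close>, so variables may be specialised inside it.\<close>

definition cayley :: "'a :: comm_ring_1 \<Rightarrow> 'a fps" where
  "cayley a = (1 + fps_const a * fps_X) * geo a"

lemma geo_inverse: "(1 - fps_const a * fps_X) * geo a = 1"
proof (rule fps_ext)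
  fix n
  have "((1 - fps_const a * fps_X) * geo a) $ n = geo a $ n - a * (fps_X * geo a) $ n"
    by (simp only: left_diff_distrib mult_1 mult.assoc fps_sub_nth fps_mult_left_const_nth)
  then show "((1 - fps_const a * fps_X) * geo a) $ n = 1 $ n"
    by (cases n) (simp_all add: geo_def)
qed

text \<open>From 1 + k = (1 - k) + 2 k. The factor 2 exposed here yields the integrality of P_k, and
  the factor \<open>a\<close> the divisibility by the root of a sign change.\<close>

lemma cayley_altdef: "cayley a = 1 + fps_const (2 * a) * (fps_X * geo a)"
proof -
  have "(1 + k) * g = (1 - k) * g + (k * g + k * g)" for k g :: "'a fps"
    by (simp add: algebra_simps)
  then have "cayley a = 1 + (fps_const a * fps_X * geo a + fps_const a * fps_X * geo a)"
    unfolding cayley_def by (simp only: geo_inverse)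
  also have "fps_const a * fps_X * geo a + fps_const a * fps_X * geo a = fps_const (a + a) * (fps_X * geo a)"
    by (simp only: fps_const_add[symmetric] distrib_right mult.assoc)
  finally show ?thesis by (simp only: mult_2)
qed

lemma cayley_nth: "cayley a $ k = (if k = 0 then 1 else 2 * a ^ k)"
  by (cases k) (simp_all add: cayley_altdef geo_def mult.assoc)

lemma cayley_0 [simp]: "cayley 0 = 1"
  by (simp add: cayley_altdef)

lemma cayley_uminus: "cayley a * cayley (- a) = 1"
proof -
  have "cayley a * cayley (- a) = ((1 - fps_const a * fps_X) * geo a) * ((1 - fps_const (- a) * fps_X) * geo (- a))"
    by (simp add: cayley_def fps_const_neg[symmetric] del: fps_const_neg)
  then show ?thesis
    by (simp add: geo_inverse)
qed

lemma exact_quot_cayley: "exact_quot (1 + fps_const a * fps_X) (1 - fps_const a * fps_X) = cayley a"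
proof (rule exact_quot_eq)
  show "cancellable (1 - fps_const a * fps_X)"
    by (rule cancellable_factor[of _ "geo a"]) (simp add: geo_inverse cancellable_1)
  show "(1 - fps_const a * fps_X) * cayley a = 1 + fps_const a * fps_X"
    unfolding cayley_def mult.left_commute[of "1 - fps_const a * fps_X"] by (simp only: geo_inverse mult_1_right)
qed

text \<open>Meant for ring homomorphisms, which can thus be evaluated on all Q_k at once through the
  product formula.\<close>

definition fmap :: "('a \<Rightarrow> 'b) \<Rightarrow> 'a fps \<Rightarrow> 'b fps" where
  "fmap \<phi> F = Abs_fps (\<lambda>k. \<phi> (F $ k))"

lemma fmap_nth [simp]: "fmap \<phi> F $ k = \<phi> (F $ k)"
  by (simp add: fmap_def)

lemma comm_ring_hom_fmap:
  assumes "comm_ring_hom \<phi>"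
  shows "comm_ring_hom (fmap \<phi>)"
proof -
  interpret comm_ring_hom \<phi> by fact
  show ?thesis
    by unfold_locales
      (auto simp: fps_eq_iff fps_mult_nth hom_distribs hom_sum fps_one_nth hom_one)
qed

lemma fmap_cayley:
  assumes "comm_ring_hom \<phi>"
  shows "fmap \<phi> (cayley a) = cayley (\<phi> a)"
proof -
  interpret comm_ring_hom \<phi> by fact
  show ?thesis
    by (auto simp: fps_eq_iff cayley_nth hom_distribs hom_one)
qed

section \<open>Truncation in the x-variables\<close>

definition low :: "nat \<Rightarrow> (indet \<Rightarrow>\<^sub>0 nat) \<Rightarrow> bool" where
  "low N m \<longleftrightarrow> (\<forall>j>N. exponent m (XV j) = 0)"

lemma low_add: "low N (a + b) \<longleftrightarrow> low N a \<and> low N b"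
  by (auto simp: low_def lookup_add)

lemma ex_low: "\<exists>N. low N m"
proof -
  have "finite (XV -` variables m)"
    by (intro finite_vimageI) (auto simp: inj_def)
  then obtain N where "\<forall>j\<in>XV -` variables m. j \<le> N"
    using finite_nat_set_iff_bounded_le by blast
  then have "exponent m (XV j) = 0" if "j > N" for j
    using that by (metis in_keys_iff not_le vimageI2)
  then show ?thesis
    by (auto simp: low_def)
qed

text \<open>Congruence modulo the ideal of series all of whose monomials contain some x_j with j >
  N. Modulo each of these ideals the infinite product is finite, and their intersection is
  0.\<close>

definition agree :: "nat \<Rightarrow> indet series \<Rightarrow> indet series \<Rightarrow> bool" where
  "agree N f g \<longleftrightarrow> (\<forall>m. low N m \<longrightarrow> coeff f m = coeff g m)"

definition fagree :: "nat \<Rightarrow> indet series fps \<Rightarrow> indet series fps \<Rightarrow> bool" where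
  "fagree N F G \<longleftrightarrow> (\<forall>k. agree N (F $ k) (G $ k))"

lemma agree_refl: "agree N f f"
  by (simp add: agree_def)

lemma agree_mult: "agree N f f' \<Longrightarrow> agree N g g' \<Longrightarrow> agree N (f * g) (f' * g')"
  unfolding agree_def coeff_mult by (intro allI impI sum.cong refl) (auto simp: low_add)

lemma agree_sum: "(\<And>x. x \<in> A \<Longrightarrow> agree N (f x) (g x)) \<Longrightarrow> agree N (sum f A) (sum g A)"
  by (simp add: agree_def coeff_sum)

lemma fagree_refl: "fagree N F F"
  by (simp add: fagree_def agree_refl)

lemma fagree_sym: "fagree N F G \<Longrightarrow> fagree N G F"
  by (simp add: fagree_def agree_def)

lemma fagree_trans: "fagree N F G \<Longrightarrow> fagree N G H \<Longrightarrow> fagree N F H"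
  by (simp add: fagree_def agree_def)

lemma fagree_mult: "fagree N F F' \<Longrightarrow> fagree N G G' \<Longrightarrow> fagree N (F * G) (F' * G')"
  unfolding fagree_def fps_mult_nth by (intro allI agree_sum agree_mult) auto

lemma fagree_eqI:
  assumes "\<And>N. fagree N F G"
  shows "F = G"
proof (rule fps_ext, rule series_eqI)
  fix k m
  obtain N where "low N m" using ex_low by blast
  then show "coeff (F $ k) m = coeff (G $ k) m"
    using assms[of N] by (auto simp: fagree_def agree_def)
qed

lemma fagree_cayley_1:
  assumes "i > N"
  shows "fagree N (cayley (xvar i)) 1"
  unfolding fagree_def
proof
  fix k
  have "agree N (xvar i) 0"
    using assms by (auto simp: agree_def coeff_var low_def)
  then have *: "agree N (xvar i * (2 * xvar i ^ (k - 1))) (0 * (2 * xvar i ^ (k - 1)))"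
    by (intro agree_mult agree_refl)
  show "agree N (cayley (xvar i) $ k) (1 $ k)"
  proof (cases k)
    case (Suc l)
    then show ?thesis
      using * by (simp add: cayley_nth mult.left_commute)
  qed (simp add: cayley_nth agree_refl)
qed

definition Q_trunc :: "nat \<Rightarrow> indet series fps" where
  "Q_trunc N = (\<Prod>i=1..N. cayley (xvar i))"

definition QF :: "indet series fps" where
  "QF = Abs_fps Q_ser"

lemma QF_nth [simp]: "QF $ k = Q_ser k"
  by (simp add: QF_def)

lemma Q_trunc_Suc: "Q_trunc (Suc N) = Q_trunc N * cayley (xvar (Suc N))"
  by (simp add: Q_trunc_def)

lemma fagree_Q_trunc:
  assumes "N \<le> M"
  shows "fagree N (Q_trunc M) (Q_trunc N)"
  using assms
proof (induction M rule: dec_induct)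
  case base
  then show ?case by (rule fagree_refl)
next
  case (step M)
  then have "fagree N (Q_trunc M * cayley (xvar (Suc M))) (Q_trunc N * 1)"
    by (intro fagree_mult fagree_cayley_1) auto
  then show ?case
    by (simp add: Q_trunc_Suc)
qed

text \<open>On a monomial without x_j for j > N, the factors after the N-th act as 1, so the partial
  products have a constant coefficient from N on and the limit in \<open>Q_ser\<close> is this
  value.\<close>

lemma fagree_QF: "fagree N QF (Q_trunc N)"
  unfolding fagree_def agree_def
proof (intro allI impI)
  fix k m assume "low N m"
  then have "eventually (\<lambda>M. coeff (Q_trunc M $ k) m = coeff (Q_trunc N $ k) m) sequentially"
    using fagree_Q_trunc[of N] unfolding fagree_def agree_def
    by (intro eventually_sequentiallyI[of N]) blast
  then have "(\<lambda>M. coeff (Q_trunc M $ k) m) \<longlonglongrightarrow> coeff (Q_trunc N $ k) m"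
    by (rule tendsto_eventually)
  then show "coeff (QF $ k) m = coeff (Q_trunc N $ k) m"
    by (simp add: Q_ser_def exact_quot_cayley Q_trunc_def limI)
qed

lemma coeff_Q_ser: "low N m \<Longrightarrow> coeff (Q_ser k) m = coeff (Q_trunc N $ k) m"
  using fagree_QF[of N] by (simp add: fagree_def agree_def)

lemma Q_ser_0: "Q_ser 0 = 1"
proof (rule series_eqI)
  fix m
  obtain N where N: "low N m" using ex_low by blast
  have "Q_trunc N $ 0 = 1"
    by (induction N) (simp_all add: Q_trunc_Suc cayley_nth Q_trunc_def)
  then show "coeff (Q_ser 0) m = coeff 1 m"
    by (simp add: coeff_Q_ser[OF N])
qed

lemma Q_trunc_even: "\<exists>F. Q_trunc N = 1 + 2 * F"
proof (induction N)
  case 0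
  show ?case
    by (rule exI[of _ 0]) (simp add: Q_trunc_def)
next
  case (Suc N)
  then obtain F where F: "Q_trunc N = 1 + 2 * F" by blast
  define G where "G = fps_const (xvar (Suc N)) * (fps_X * geo (xvar (Suc N)))"
  have "(2 :: indet series fps) = fps_const 2"
    by (simp add: fps_numeral_fps_const)
  then have G: "cayley (xvar (Suc N)) = 1 + 2 * G"
    by (simp add: cayley_altdef G_def mult.assoc[symmetric] fps_const_mult[symmetric] del: fps_const_mult)
  show ?case
    unfolding Q_trunc_Suc F G by (rule exI[of _ "F + G + 2 * F * G"]) (simp add: algebra_simps)
qed

text \<open>The exact quotient that defines \<open>P_ser\<close> exists because every factor
  \<open>cayley\<close> is 1 modulo 2; k = 0 is excluded since Q_0 = 1.\<close>

lemma two_P_ser: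
  assumes "k \<ge> 1"
  shows "2 * P_ser k = Q_ser k"
proof -
  have "even (coeff (Q_ser k) m)" for m
  proof -
    obtain N where N: "low N m" using ex_low by blast
    obtain F where "Q_trunc N = 1 + 2 * F" using Q_trunc_even by blast
    then have "Q_trunc N $ k = 2 * F $ k"
      using assms by (simp add: fps_numeral_fps_const fps_mult_left_const_nth)
    then show ?thesis
      by (simp add: coeff_Q_ser[OF N])
  qed
  then have "2 * Series (\<lambda>m. coeff (Q_ser k) m div 2) = Q_ser k"
    by (intro series_eqI) simp
  moreover from this have "P_ser k = Series (\<lambda>m. coeff (Q_ser k) m div 2)"
    unfolding P_ser_def by (intro exact_quot_eq cancellable_numeral)
  ultimately show ?thesis by simp
qed

lemma vars_in_Q_ser: "vars_in (XV ` {1..}) (Q_ser k)"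
  unfolding vars_in_def
proof (intro allI impI)
  fix m assume m: "coeff (Q_ser k) m \<noteq> 0"
  obtain N where N: "low N m" using ex_low by blast
  have sum: "vars_in A (sum f B)" if "\<And>x. x \<in> B \<Longrightarrow> vars_in A (f x)" for A B and f :: "nat \<Rightarrow> indet series"
    using that by (induction B rule: infinite_finite_induct) (auto simp: vars_in_0 vars_in_add)
  have pow: "vars_in A (x ^ n)" if "vars_in A x" for A n and x :: "indet series"
    using that by (induction n) (auto simp: vars_in_1 vars_in_mult)
  have c: "vars_in (XV ` {1..}) (cayley (xvar i) $ k)" if "i \<ge> 1" for i k
    using that by (auto simp: cayley_nth vars_in_1 intro!: vars_in_numeral_mult pow vars_in_var)
  have "vars_in (XV ` {1..}) (Q_trunc N $ k)" for k
  proof (induction N arbitrary: k)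
    case (Suc N)
    then show ?case
      unfolding Q_trunc_Suc fps_mult_nth by (intro sum vars_in_mult c) auto
  qed (auto simp: Q_trunc_def fps_one_nth vars_in_0 vars_in_1)
  then show "variables m \<subseteq> XV ` {1..}"
    using m unfolding coeff_Q_ser[OF N] vars_in_def by blast
qed

lemma vars_in_P_ser:
  assumes "k \<ge> 1"
  shows "vars_in (XV ` {1..}) (P_ser k)"
  unfolding vars_in_def
proof (intro allI impI)
  fix m assume "coeff (P_ser k) m \<noteq> 0"
  then have "coeff (Q_ser k) m \<noteq> 0"
    unfolding two_P_ser[OF assms, symmetric] by simp
  then show "variables m \<subseteq> XV ` {1..}"
    using vars_in_Q_ser by (auto simp: vars_in_def)
qed

lemma fmap_QF_fixed:
  assumes "finite_fibres h" "\<And>j. j \<ge> 1 \<Longrightarrow> h (XV j) = XV j \<and> c (XV j) = 1"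
  shows "fmap (subst c h) QF = QF"
proof (rule fps_ext)
  fix k
  have "subst c h (Q_ser k) = Q_ser k"
    using assms by (intro subst_fixing[OF vars_in_Q_ser]) auto
  then show "fmap (subst c h) QF $ k = QF $ k"
    by simp
qed

text \<open>If x-indices drop by \<open>d\<close>, a monomial without x_j for j > N has only
  preimages without x_j for j > N + d. The sign change s_0 uses d = 1, the specialisation x = 0 uses
  d = 0.\<close>

lemma agree_subst:
  assumes h: "\<And>j. j > d \<Longrightarrow> h (XV j) = XV (j - d)" and "agree (N + d) f g"
  shows "agree N (subst c h f) (subst c h g)"
  unfolding agree_def coeff_subst
proof (intro allI impI sum.cong refl)
  fix m m' assume m: "low N m" "m' \<in> {m'. push h m' = m}"
  have "low (N + d) m'"
    unfolding low_def
  proof (intro allI impI)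
    fix j assume j: "N + d < j"
    then have "exponent m' (XV j) \<le> exponent m (XV (j - d))"
      using lookup_le_push[of m' "XV j" h] m(2) h[of j] by simp
    then show "exponent m' (XV j) = 0"
      using m(1) j by (simp add: low_def)
  qed
  then show "mono_coeff c m' * coeff f m' = mono_coeff c m' * coeff g m'"
    using assms(2) by (simp add: agree_def)
qed

lemma fagree_fmap_subst:
  assumes "\<And>j. j > d \<Longrightarrow> h (XV j) = XV (j - d)" "fagree (N + d) F G"
  shows "fagree N (fmap (subst c h) F) (fmap (subst c h) G)"
  using assms agree_subst[of d h] by (simp add: fagree_def)

text \<open>In the product formula the factor of x_1 becomes the factor of its image, and the
  remaining factors shift back into the full product.\<close>

lemma fmap_QF_shift:
  assumes ff: "finite_fibres h"
    and h: "\<And>j. j > 1 \<Longrightarrow> h (XV j) = XV (j - 1) \<and> c (XV j) = 1"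
  shows "fmap (subst c h) QF = cayley (of_int (c (XV 1)) * var (h (XV 1))) * QF"
proof (rule fagree_eqI)
  fix N
  note hom = comm_ring_hom_subst[OF ff, of c]
  interpret F: comm_ring_hom "fmap (subst c h)"
    by (rule comm_ring_hom_fmap[OF hom])
  let ?E = "cayley (of_int (c (XV 1)) * var (h (XV 1)))"
  have "fmap (subst c h) (Q_trunc (N + 1)) = (\<Prod>i=1..Suc N. cayley (of_int (c (XV i)) * var (h (XV i))))"
    by (simp only: Q_trunc_def F.hom_prod fmap_cayley[OF hom] subst_var[OF ff] Suc_eq_plus1)
  also have "\<dots> = ?E * (\<Prod>i=Suc 1..Suc N. cayley (of_int (c (XV i)) * var (h (XV i))))"
    by (subst prod.atLeast_Suc_atMost) auto
  also have "(\<Prod>i=Suc 1..Suc N. cayley (of_int (c (XV i)) * var (h (XV i)))) = Q_trunc N"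
    unfolding prod.shift_bounds_cl_Suc_ivl Q_trunc_def using h by (intro prod.cong) auto
  finally have eq: "fmap (subst c h) (Q_trunc (N + 1)) = ?E * Q_trunc N" .
  have "fagree N (fmap (subst c h) QF) (fmap (subst c h) (Q_trunc (N + 1)))"
    using h by (intro fagree_fmap_subst[where d = 1] fagree_QF) auto
  moreover have "fagree N (?E * Q_trunc N) (?E * QF)"
    by (intro fagree_mult fagree_refl fagree_sym[OF fagree_QF])
  ultimately show "fagree N (fmap (subst c h) QF) (?E * QF)"
    using fagree_trans eq by metis
qed

lemma fmap_QF_zero:
  assumes ff: "finite_fibres h"
    and h: "\<And>j. h (XV j) = XV j" and c: "\<And>j. c (XV j) = 0"
  shows "fmap (subst c h) QF = 1"
proof (rule fagree_eqI)
  fix N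
  note hom = comm_ring_hom_subst[OF ff, of c]
  interpret F: comm_ring_hom "fmap (subst c h)"
    by (rule comm_ring_hom_fmap[OF hom])
  have "fmap (subst c h) (Q_trunc N) = 1"
    by (simp add: Q_trunc_def F.hom_prod fmap_cayley[OF hom] subst_var[OF ff] c)
  moreover have "fagree N (fmap (subst c h) QF) (fmap (subst c h) (Q_trunc N))"
    using h by (intro fagree_fmap_subst[where d = 0]) (auto simp: fagree_QF)
  ultimately show "fagree N (fmap (subst c h) QF) 1"
    by simp
qed

section \<open>Total degree\<close>

text \<open>The exponent left when all variables are identified, so additivity and invariance under
  substitution are inherited from \<open>push\<close>.\<close>

definition mdeg :: "('v \<Rightarrow>\<^sub>0 nat) \<Rightarrow> nat" where
  "mdeg m = exponent (push (\<lambda>_. ()) m) ()"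

lemma mdeg_add: "mdeg (a + b) = mdeg a + mdeg b"
  by (simp add: mdeg_def push_add lookup_add)

lemma mdeg_single [simp]: "mdeg (Poly_Mapping.single v k) = k"
  by (simp add: mdeg_def)

lemma mdeg_0 [simp]: "mdeg 0 = 0"
  by (simp add: mdeg_def)

lemma mdeg_push: "mdeg (push h m) = mdeg m"
  by (simp add: mdeg_def push_push o_def)

definition degle :: "nat \<Rightarrow> 'v series \<Rightarrow> bool" where
  "degle d f \<longleftrightarrow> (\<forall>m. coeff f m \<noteq> 0 \<longrightarrow> mdeg m \<le> d)"

lemma degle_mono: "degle d f \<Longrightarrow> d \<le> e \<Longrightarrow> degle e f"
  unfolding degle_def by (meson le_trans)

lemma degle_0: "degle d 0" and degle_1: "degle d 1"
  by (simp_all add: degle_def coeff_1)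

lemma degle_var: "degle 1 (var v)"
  by (simp add: degle_def coeff_var)

lemma degle_add: "degle d f \<Longrightarrow> degle d g \<Longrightarrow> degle d (f + g)"
  unfolding degle_def by (metis add.left_neutral coeff_add)

lemma degle_diff: "degle d f \<Longrightarrow> degle d g \<Longrightarrow> degle d (f - g)"
  unfolding degle_def by (metis coeff_diff diff_zero)

lemma degle_numeral_mult: "degle d f \<Longrightarrow> degle d (numeral k * f)"
  by (simp add: degle_def)

lemma degle_mult:
  assumes "degle d f" "degle e g"
  shows "degle (d + e) (f * g)"
  unfolding degle_def
proof (intro allI impI)
  fix m assume "coeff (f * g) m \<noteq> 0"
  then obtain p where "p \<in> {(a, b). a + b = m}" "(case p of (a, b) \<Rightarrow> coeff f a * coeff g b) \<noteq> 0"
    unfolding coeff_mult by (meson sum.not_neutral_contains_not_neutral)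
  then show "mdeg m \<le> d + e"
    using assms unfolding degle_def by (auto simp: mdeg_add add_mono)
qed

lemma degle_subst:
  assumes "degle d f"
  shows "degle d (subst c h f)"
  unfolding degle_def
proof (intro allI impI)
  fix m assume "coeff (subst c h f) m \<noteq> 0"
  then obtain m' where "push h m' = m" "coeff f m' \<noteq> 0"
    unfolding coeff_subst by (metis (mono_tags, lifting) mem_Collect_eq mult_zero_right sum.neutral)
  then show "mdeg m \<le> d"
    using assms by (auto simp: degle_def mdeg_push)
qed

lemma degle_Q_ser: "degle k (Q_ser k)"
  unfolding degle_def
proof (intro allI impI)
  fix m assume m: "coeff (Q_ser k) m \<noteq> 0"
  obtain N where N: "low N m" using ex_low by blast
  have sum: "degle d (sum f B)" if "\<And>x. x \<in> B \<Longrightarrow> degle d (f x)" for d B and f :: "nat \<Rightarrow> indet series"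
    using that by (induction B rule: infinite_finite_induct) (auto simp: degle_0 degle_add)
  have pow: "degle n (xvar i ^ n)" for n i
  proof (induction n)
    case (Suc n)
    then show ?case
      using degle_mult[OF degle_var[of "XV i"] Suc] by simp
  qed (simp add: degle_1)
  have c: "degle k (cayley (xvar i) $ k)" for i k
    by (auto simp: cayley_nth degle_1 intro!: degle_numeral_mult pow)
  have "degle k (Q_trunc N $ k)" for k
  proof (induction N arbitrary: k)
    case (Suc N)
    have "degle k (Q_trunc N $ i * cayley (xvar (Suc N)) $ (k - i))" if "i \<in> {0..k}" for i
      using degle_mult[OF Suc[of i] c[of "k - i" "Suc N"]] that by simp
    then show ?case
      by (auto simp: Q_trunc_Suc fps_mult_nth intro!: sum)
  qed (auto simp: Q_trunc_def fps_one_nth degle_0 degle_1)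
  then show "mdeg m \<le> k"
    using m unfolding coeff_Q_ser[OF N] degle_def by blast
qed

lemma degle_P_ser:
  assumes "k \<ge> 1"
  shows "degle k (P_ser k)"
  unfolding degle_def
proof (intro allI impI)
  fix m assume "coeff (P_ser k) m \<noteq> 0"
  then have "coeff (Q_ser k) m \<noteq> 0"
    unfolding two_P_ser[OF assms, symmetric] by simp
  then show "mdeg m \<le> k"
    using degle_Q_ser by (auto simp: degle_def)
qed

definition homogeneous_part :: "nat \<Rightarrow> 'v series \<Rightarrow> 'v series" where
  "homogeneous_part d f = Series (\<lambda>m. if mdeg m = d then coeff f m else 0)"

lemma homogeneous_part_linear_mult:
  assumes l: "\<And>m. coeff l m \<noteq> 0 \<Longrightarrow> mdeg m = 1"
  shows "l * homogeneous_part d f = homogeneous_part (Suc d) (l * f)"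
proof (rule series_eqI)
  fix m
  have "coeff (l * homogeneous_part d f) m = (\<Sum>p | fst p + snd p = m. if mdeg m = Suc d then coeff l (fst p) * coeff f (snd p) else 0)"
    unfolding coeff_mult case_prod_unfold homogeneous_part_def
    by (intro sum.cong refl) (use l in \<open>fastforce simp: mdeg_add\<close>)
  also have "\<dots> = coeff (homogeneous_part (Suc d) (l * f)) m"
    by (simp add: homogeneous_part_def coeff_mult case_prod_unfold)
  finally show "coeff (l * homogeneous_part d f) m = coeff (homogeneous_part (Suc d) (l * f)) m" .
qed

text \<open>Multiplication by a linear form moves homogeneous components up by one degree and, being
  injective, kills none. Hence divided differences strictly lower the degree, which drives the
  expansion of arbitrary elements of R.\<close>

lemma degle_linear_quotient:
  assumes "cancellable l" "\<And>m. coeff l m \<noteq> 0 \<Longrightarrow> mdeg m = 1" "degle d (l * f)" "coeff f m \<noteq> 0"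
  shows "Suc (mdeg m) \<le> d"
proof (rule ccontr)
  assume "\<not> Suc (mdeg m) \<le> d"
  then have "homogeneous_part (Suc (mdeg m)) (l * f) = 0"
    using assms(3) by (intro series_eqI) (auto simp: homogeneous_part_def degle_def)
  then have "l * homogeneous_part (mdeg m) f = 0"
    using homogeneous_part_linear_mult[of l "mdeg m" f] assms(2) by simp
  then have "homogeneous_part (mdeg m) f = 0"
    using assms(1) by (simp add: cancellable_def)
  then have "coeff (homogeneous_part (mdeg m) f) m = 0"
    by simp
  then show False
    using assms(4) by (simp add: homogeneous_part_def)
qed

section \<open>Reflections on the ring of double Schubert polynomials\<close>

lemma subring_gen_0: "0 \<in> subring_gen G"
  using subring_gen.diff[OF subring_gen.one subring_gen.one, of G] by simp

lemma subring_gen_uminus: "f \<in> subring_gen G \<Longrightarrow> - f \<in> subring_gen G"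
  using subring_gen.diff[OF subring_gen_0, of f G] by simp

lemma subring_gen_add: "f \<in> subring_gen G \<Longrightarrow> g \<in> subring_gen G \<Longrightarrow> f + g \<in> subring_gen G"
  using subring_gen.diff[OF _ subring_gen_uminus, of f G g] by simp

lemma subring_gen_sum: "(\<And>x. x \<in> A \<Longrightarrow> f x \<in> subring_gen G) \<Longrightarrow> sum f A \<in> subring_gen G"
  by (induction A rule: infinite_finite_induct) (auto simp: subring_gen_0 subring_gen_add)

lemma subring_gen_power: "f \<in> subring_gen G \<Longrightarrow> f ^ n \<in> subring_gen G"
  by (induction n) (auto simp: subring_gen.one subring_gen.mult)

lemma subring_gen_of_nat: "of_nat n \<in> subring_gen G"
  by (induction n) (auto simp: subring_gen_0 subring_gen.one subring_gen_add)

lemma subring_gen_numeral: "numeral n \<in> subring_gen G"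
  using subring_gen_of_nat[of "numeral n" G] by simp

lemma subring_gen_mono:
  assumes "f \<in> subring_gen G" "G \<subseteq> subring_gen H"
  shows "f \<in> subring_gen H"
  using assms(1)
  by induction (use assms(2) in \<open>auto intro: subring_gen.intros\<close>)

lemma subring_gen_hom_eq:
  assumes "f \<in> subring_gen G" "comm_ring_hom \<phi>" "comm_ring_hom \<psi>" "\<And>g. g \<in> G \<Longrightarrow> \<phi> g = \<psi> g"
  shows "\<phi> f = \<psi> f"
proof -
  interpret A: comm_ring_hom \<phi> by fact
  interpret B: comm_ring_hom \<psi> by fact
  show ?thesis
    using assms(1) by induction (auto simp: assms(4) A.hom_minus B.hom_minus A.hom_mult B.hom_mult)
qed

lemma subring_gen_hom_in:
  assumes "f \<in> subring_gen G" "comm_ring_hom \<phi>" "\<And>g. g \<in> G \<Longrightarrow> \<phi> g \<in> subring_gen H"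
  shows "\<phi> f \<in> subring_gen H"
proof -
  interpret A: comm_ring_hom \<phi> by fact
  show ?thesis
    using assms(1) by induction (auto simp: assms(3) A.hom_minus A.hom_mult intro: subring_gen.intros)
qed

lemma comm_ring_hom_comp:
  assumes "comm_ring_hom \<phi>" "comm_ring_hom \<psi>"
  shows "comm_ring_hom (\<phi> \<circ> \<psi>)"
proof -
  interpret A: comm_ring_hom \<phi> by fact
  interpret B: comm_ring_hom \<psi> by fact
  show ?thesis
    by unfold_locales (auto simp: A.hom_add B.hom_add A.hom_mult B.hom_mult)
qed

lemma comm_ring_hom_id: "comm_ring_hom id"
  by unfold_locales auto

text \<open>The index map common to both sign changes, with \<open>y\<close> standing for z_1 or
  t_1. It moves infinitely many variables but has finite fibres, as \<open>subst\<close> requires;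
  x_0 lies outside the rings and is kept fixed.\<close>

definition shift_to :: "indet \<Rightarrow> indet \<Rightarrow> indet" where
  "shift_to y v = (case v of XV j \<Rightarrow> (if j = 0 then XV 0 else if j = 1 then y else XV (j - 1)) | _ \<Rightarrow> v)"

lemma shift_to_simps [simp]:
  "shift_to y (TV j) = TV j" "shift_to y (ZV j) = ZV j" "shift_to y (XV 0) = XV 0"
  "shift_to y (XV 1) = y" "shift_to y (XV (Suc 0)) = y" "j > 1 \<Longrightarrow> shift_to y (XV j) = XV (j - 1)"
  "shift_to y (XV (Suc (Suc k))) = XV (Suc k)"
  by (simp_all add: shift_to_def)

lemma finite_fibres_shift_to: "finite_fibres (shift_to y)"
  unfolding finite_fibres_def
proof
  fix w
  have "shift_to y -` {w} \<subseteq> {w, XV 0, XV 1, (case w of XV j \<Rightarrow> XV (Suc j) | _ \<Rightarrow> w)}"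
    by (auto simp: shift_to_def split: indet.splits if_splits)
  then show "finite (shift_to y -` {w})"
    by (rule finite_subset) simp
qed

definition swap_tz :: "indet \<Rightarrow> indet" where
  "swap_tz v = (case v of TV i \<Rightarrow> ZV i | ZV i \<Rightarrow> TV i | XV i \<Rightarrow> XV i)"

lemma swap_tz_simps [simp]: "swap_tz (TV i) = ZV i" "swap_tz (ZV i) = TV i" "swap_tz (XV i) = XV i"
  by (simp_all add: swap_tz_def)

lemma swap_tz_swap_tz [simp]: "swap_tz (swap_tz v) = v"
  by (cases v) auto

lemma finite_fibres_swap_tz: "finite_fibres swap_tz"
  by (intro finite_fibres_bij o_bij[of swap_tz swap_tz]) (auto simp: fun_eq_iff)

lemma finite_fibres_transpose: "finite_fibres (transpose a b)"
  by (intro finite_fibres_bij) simp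

lemma finite_fibres_id: "finite_fibres id"
  by (intro finite_fibres_bij) simp

lemma refl_z_0: "refl_z 0 = subst (\<lambda>v. if v = ZV 1 then - 1 else 1) (shift_to (ZV 1))"
  by (simp add: refl_z_def shift_to_def[abs_def] del: One_nat_def)

lemma refl_z_pos: "i > 0 \<Longrightarrow> refl_z i = subst (\<lambda>_. 1) (transpose (ZV i) (ZV (i + 1)))"
  by (simp add: refl_z_def)

lemma refl_t_0: "refl_t 0 = subst (\<lambda>v. if v = TV 1 \<or> v = XV 1 then - 1 else 1) (shift_to (TV 1))"
  by (simp add: refl_t_def shift_to_def[abs_def] del: One_nat_def)

lemma refl_t_pos: "i > 0 \<Longrightarrow> refl_t i = subst (\<lambda>_. 1) (transpose (TV i) (TV (i + 1)))"
  by (simp add: refl_t_def)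

lemma omega_altdef: "omega = subst (\<lambda>v. case v of XV _ \<Rightarrow> 1 | _ \<Rightarrow> - 1) swap_tz"
  by (simp add: omega_def swap_tz_def[abs_def])

lemmas finite_fibres_intros = finite_fibres_shift_to finite_fibres_swap_tz finite_fibres_transpose finite_fibres_id

lemma comm_ring_hom_refl_z: "comm_ring_hom (refl_z i)"
  by (cases "i = 0") (auto simp: refl_z_0 refl_z_pos intro!: comm_ring_hom_subst finite_fibres_intros)

lemma comm_ring_hom_refl_t: "comm_ring_hom (refl_t i)"
  by (cases "i = 0") (auto simp: refl_t_0 refl_t_pos intro!: comm_ring_hom_subst finite_fibres_intros)

lemma comm_ring_hom_s_z: "comm_ring_hom (s_z n)"
  by (cases n) (auto intro!: comm_ring_hom_comp comm_ring_hom_refl_z)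

lemma comm_ring_hom_s_t: "comm_ring_hom (s_t n)"
  by (cases n) (auto intro!: comm_ring_hom_comp comm_ring_hom_refl_t)

lemma comm_ring_hom_omega: "comm_ring_hom omega"
  by (auto simp: omega_altdef intro!: comm_ring_hom_subst finite_fibres_intros)

lemma comm_ring_hom_set_t_zero: "comm_ring_hom set_t_zero"
  by (auto simp: set_t_zero_def intro!: comm_ring_hom_subst finite_fibres_intros)

interpretation omega: comm_ring_hom omega
  by (rule comm_ring_hom_omega)
interpretation set_t_zero: comm_ring_hom set_t_zero
  by (rule comm_ring_hom_set_t_zero)
interpretation refl_z: comm_ring_hom "refl_z i" for i
  by (rule comm_ring_hom_refl_z)
interpretation s_z: comm_ring_hom "s_z n" for n
  by (rule comm_ring_hom_s_z)
interpretation s_t: comm_ring_hom "s_t n" for n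
  by (rule comm_ring_hom_s_t)

lemma omega_omega [simp]: "omega (omega f) = f"
proof -
  have "omega (omega f) = subst (\<lambda>v. (case v of XV _ \<Rightarrow> 1 | _ \<Rightarrow> - 1) * (case swap_tz v of XV _ \<Rightarrow> 1 | _ \<Rightarrow> - 1))
     (swap_tz \<circ> swap_tz) f"
    by (simp add: omega_altdef subst_subst finite_fibres_intros)
  also have "\<dots> = f"
    by (rule subst_fixing[of UNIV])
      (auto simp: vars_in_def swap_tz_def split: indet.splits intro!: finite_fibres_comp finite_fibres_intros)
  finally show ?thesis .
qed

lemma subst_cong: "(\<And>v. c v = c' v) \<Longrightarrow> (\<And>v. h v = h' v) \<Longrightarrow> subst c h f = subst c' h' f"
  by presburger

text \<open>For s_0 both sides send x_1 to - t_1, which accounts for the sign at \<open>XV 1\<close>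
  in \<open>refl_t\<close>. Through this conjugation divided differences in z are carried to those
  in t.\<close>

lemma omega_refl_z: "omega (refl_z i f) = refl_t i (omega f)"
proof (cases "i = 0")
  case True
  show ?thesis
    unfolding True refl_z_0 refl_t_0 omega_altdef subst_subst[OF finite_fibres_swap_tz finite_fibres_shift_to]
      subst_subst[OF finite_fibres_shift_to finite_fibres_swap_tz]
    by (rule subst_cong; case_tac v) (auto simp: shift_to_def swap_tz_def)
next
  case False
  then have "i > 0" by simp
  show ?thesis
    unfolding refl_z_pos[OF \<open>i > 0\<close>] refl_t_pos[OF \<open>i > 0\<close>] omega_altdef
      subst_subst[OF finite_fibres_swap_tz finite_fibres_transpose]
      subst_subst[OF finite_fibres_transpose finite_fibres_swap_tz]
    by (rule subst_cong; case_tac v) (auto simp: transpose_def swap_tz_def)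
qed

lemma omega_s_z: "omega (s_z n f) = s_t n (omega f)"
  by (cases n) (simp_all add: omega_refl_z)

lemma set_t_zero_refl_z: "set_t_zero (refl_z i f) = refl_z i (set_t_zero f)"
proof (cases "i = 0")
  case True
  show ?thesis
    unfolding True refl_z_0 set_t_zero_def subst_subst[OF finite_fibres_id finite_fibres_shift_to]
      subst_subst[OF finite_fibres_shift_to finite_fibres_id]
    by (rule subst_cong; case_tac v) (auto simp: shift_to_def)
next
  case False
  then have "i > 0" by simp
  show ?thesis
    unfolding refl_z_pos[OF \<open>i > 0\<close>] set_t_zero_def
      subst_subst[OF finite_fibres_id finite_fibres_transpose]
      subst_subst[OF finite_fibres_transpose finite_fibres_id]
    by (rule subst_cong; case_tac v) (auto simp: transpose_def)
qed

lemma set_t_zero_s_z: "set_t_zero (s_z n f) = s_z n (set_t_zero f)"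
  by (cases n) (simp_all add: set_t_zero_refl_z)

text \<open>With z_{-j} = - z_j and z_0 = 0, a word in the reflections acts on these elements by
  applying its signed permutation to the index.\<close>

definition signed_z :: "int \<Rightarrow> indet series" where
  "signed_z j = (if j > 0 then zvar (nat j) else if j < 0 then - zvar (nat (- j)) else 0)"

lemma signed_z_uminus: "signed_z (- j) = - signed_z j"
  by (simp add: signed_z_def)

lemma signed_z_0 [simp]: "signed_z 0 = 0"
  by (simp add: signed_z_def)

lemma signed_z_of_nat: "k > 0 \<Longrightarrow> signed_z (int k) = zvar k"
  by (simp add: signed_z_def)

lemma simple_refl_0: "simple_refl 0 j = (if j = 1 then - 1 else if j = - 1 then 1 else j)"
  by (auto simp: simple_refl_def transpose_def)

lemma simple_refl_pos:
  "i > 0 \<Longrightarrow> simple_refl i j = (if j = int i then int i + 1 else if j = int i + 1 then int i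
     else if j = - int i then - int i - 1 else if j = - int i - 1 then - int i else j)"
  by (auto simp: simple_refl_def transpose_def)

lemma simple_refl_uminus: "simple_refl i (- j) = - simple_refl i j"
  by (cases "i = 0") (auto simp: simple_refl_0 simple_refl_pos)

lemma gen_s_uminus: "gen_s n (- j) = - gen_s n j"
  by (cases n) (simp_all add: simple_refl_uminus)

lemma refl_z_zvar:
  assumes "k > 0"
  shows "refl_z i (zvar k) = signed_z (simple_refl i (int k))"
proof (cases "i = 0")
  case True
  then show ?thesis
    using assms by (auto simp: refl_z_0 subst_var finite_fibres_intros simple_refl_0 signed_z_def)
next
  case False
  then show ?thesis
    using assms by (auto simp: refl_z_pos subst_var finite_fibres_intros simple_refl_pos signed_z_def transpose_def nat_add_distrib)
qed

lemma refl_z_signed_z: "refl_z i (signed_z j) = signed_z (simple_refl i j)"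
proof -
  consider "j > 0" | "j = 0" | "j < 0" by linarith
  then show ?thesis
  proof cases
    case 1
    then show ?thesis
      using refl_z_zvar[of "nat j" i] by (simp add: signed_z_def)
  next
    case 2
    then show ?thesis
      using simple_refl_uminus[of i 0] by simp
  next
    case 3
    then have "signed_z j = - zvar (nat (- j))"
      by (simp add: signed_z_def)
    then have "refl_z i (signed_z j) = - signed_z (simple_refl i (- j))"
      using 3 refl_z_zvar[of "nat (- j)" i] by (simp add: refl_z.hom_uminus)
    then show ?thesis
      by (simp add: simple_refl_uminus signed_z_uminus)
  qed
qed

lemma s_z_signed_z: "s_z n (signed_z j) = signed_z (gen_s n j)"
  by (cases n) (simp_all add: refl_z_signed_z)

lemma refl_z_tvar: "refl_z i (tvar j) = tvar j"
  by (cases "i = 0") (auto simp: refl_z_0 refl_z_pos subst_var finite_fibres_intros transpose_def)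

lemma s_z_tvar: "s_z n (tvar j) = tvar j"
  by (cases n) (simp_all add: refl_z_tvar)

lemma omega_tvar: "omega (tvar k) = - zvar k" and omega_zvar: "omega (zvar k) = - tvar k"
  by (simp_all add: omega_altdef subst_var finite_fibres_intros)

lemma set_t_zero_tvar: "set_t_zero (tvar k) = 0" and set_t_zero_zvar: "set_t_zero (zvar k) = zvar k"
  by (simp_all add: set_t_zero_def subst_var finite_fibres_intros)

text \<open>The indices j, k with \<omega>(\<alpha>) = z_j + z_k: equal ends give - 2 z_1 in type C,
  the end 0 gives - z_1 in type B. A signed permutation w turns the root into z_{w j} + z_{w k},
  which can still be cancelled because j \<noteq> - k is preserved.\<close>

fun root_ends :: "lie_type \<Rightarrow> node \<Rightarrow> int \<times> int" where
  "root_ends X (Node i) = (if i = 0 then if X = TypeC then (- 1, - 1) else (- 1, 0) else (int i, - (int i + 1)))"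
| "root_ends X Node_hat1 = (- 1, - 2)"

lemma omega_simple_root: "omega (simple_root X n) = signed_z (fst (root_ends X n)) + signed_z (snd (root_ends X n))"
proof (cases n)
  case (Node i)
  then show ?thesis
    by (auto simp: omega.hom_minus omega_tvar omega.hom_mult omega.hom_numeral signed_z_def nat_add_distrib)
next
  case Node_hat1
  then show ?thesis
    by (simp add: omega.hom_add omega_tvar signed_z_def)
qed

lemma root_nondegenerate: "fst (root_ends X n) \<noteq> - snd (root_ends X n)"
  by (cases n) auto

lemma cancellable_signed_z:
  assumes "j \<noteq> - k"
  shows "cancellable (signed_z j + signed_z k)"
proof -
  have one: "cancellable (signed_z i)" if "i \<noteq> 0" for i
    using that by (auto simp: signed_z_def cancellable_var cancellable_uminus)
  consider "j = 0" | "k = 0" | "j = k" | "\<bar>j\<bar> \<noteq> \<bar>k\<bar>" "j \<noteq> 0" "k \<noteq> 0"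
    using assms by linarith
  then show ?thesis
  proof cases
    case 3
    then have "signed_z j + signed_z k = 2 * signed_z j" by simp
    then show ?thesis
      using one[of j] 3 assms by (metis cancellable_mult cancellable_numeral neg_equal_0_iff_equal)
  next
    case 4
    have lin: "cancellable (zvar a + of_int s * zvar b)" if "a \<noteq> b" for a b s
      using that by (intro cancellable_linear) auto
    have lin': "cancellable (- zvar a + of_int s * zvar b)" if "a \<noteq> b" for a b s
      using cancellable_uminus[OF lin[OF that, of "- s"]] by simp
    show ?thesis
      using 4 lin[of "nat \<bar>j\<bar>" "nat \<bar>k\<bar>" 1] lin[of "nat \<bar>j\<bar>" "nat \<bar>k\<bar>" "- 1"]
        lin'[of "nat \<bar>j\<bar>" "nat \<bar>k\<bar>" 1] lin'[of "nat \<bar>j\<bar>" "nat \<bar>k\<bar>" "- 1"]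
      by (auto simp: signed_z_def split: if_splits)
  qed (use one assms in auto)
qed

lemma cancellable_root: "cancellable (omega (simple_root X n))"
  unfolding omega_simple_root by (rule cancellable_signed_z[OF root_nondegenerate])

lemma cancellable_simple_root: "cancellable (simple_root X n)"
  unfolding cancellable_def
proof (intro allI impI)
  fix x assume "simple_root X n * x = 0"
  then have "omega (simple_root X n) * omega x = 0"
    by (metis omega.hom_mult omega.hom_zero)
  then have "omega x = 0"
    using cancellable_root cancellable_def by blast
  then show "x = 0"
    by (metis omega_omega omega.hom_zero)
qed

lemma coeff_signed_z_mdeg: "coeff (signed_z j + signed_z k) m \<noteq> 0 \<Longrightarrow> mdeg m = 1"
  by (auto simp: signed_z_def coeff_var split: if_splits)

lemma ring_R_1: "1 \<in> ring_R X" and ring_R_diff: "f \<in> ring_R X \<Longrightarrow> g \<in> ring_R X \<Longrightarrow> f - g \<in> ring_R X"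
  and ring_R_mult: "f \<in> ring_R X \<Longrightarrow> g \<in> ring_R X \<Longrightarrow> f * g \<in> ring_R X"
  and ring_R_0: "0 \<in> ring_R X" and ring_R_add: "f \<in> ring_R X \<Longrightarrow> g \<in> ring_R X \<Longrightarrow> f + g \<in> ring_R X"
  and ring_R_uminus: "f \<in> ring_R X \<Longrightarrow> - f \<in> ring_R X"
  and ring_R_numeral: "numeral k \<in> ring_R X"
  and ring_R_sum: "(\<And>x. x \<in> A \<Longrightarrow> h x \<in> ring_R X) \<Longrightarrow> sum h A \<in> ring_R X"
  and ring_R_power: "f \<in> ring_R X \<Longrightarrow> f ^ n \<in> ring_R X"
  unfolding ring_R_def
  by (auto intro: subring_gen.intros subring_gen_0 subring_gen_add subring_gen_uminus subring_gen_numeral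
      subring_gen_sum subring_gen_power)

lemma Zt_subset_ring_R: "Zt \<subseteq> ring_R X"
  unfolding Zt_def ring_R_def by (auto elim!: subring_gen_mono intro: subring_gen.gen)

lemma ring_BH_subset_ring_R: "ring_BH X \<subseteq> ring_R X"
  unfolding ring_BH_def ring_R_def by (auto elim!: subring_gen_mono intro: subring_gen.gen)

lemma zvar_in_ring_R: "k \<ge> 1 \<Longrightarrow> zvar k \<in> ring_R X"
  unfolding ring_R_def by (auto intro: subring_gen.gen)

lemma signed_z_in_ring_R: "signed_z j \<in> ring_R X"
  by (auto simp: signed_z_def ring_R_0 intro!: ring_R_uminus zvar_in_ring_R)

lemma Q_ser_in_ring_R: "Q_ser k \<in> ring_R X"
proof (cases "k = 0")
  case True
  then show ?thesis by (simp add: Q_ser_0 ring_R_1)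
next
  case False
  then have k: "k \<ge> 1" by simp
  show ?thesis
  proof (cases "X = TypeC")
    case True
    then show ?thesis
      using k by (auto simp: ring_R_def Gamma_gens_def intro: subring_gen.gen)
  next
    case False
    then have "P_ser k \<in> Gamma_gens X"
      using k by (cases X) (auto simp: Gamma_gens_def)
    then have "P_ser k \<in> ring_R X"
      by (auto simp: ring_R_def intro: subring_gen.gen)
    then show ?thesis
      unfolding two_P_ser[OF k, symmetric] by (intro ring_R_mult ring_R_numeral)
  qed
qed

lemma geo_in_ring_R: "a \<in> ring_R X \<Longrightarrow> geo a $ k \<in> ring_R X"
  by (simp add: geo_def ring_R_power)

lemma fps_mult_in_ring_R:
  "(\<And>k. F $ k \<in> ring_R X) \<Longrightarrow> (\<And>k. G $ k \<in> ring_R X) \<Longrightarrow> (F * G) $ k \<in> ring_R X"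
  unfolding fps_mult_nth by (intro ring_R_sum ring_R_mult)

lemma fmap_refl_z_0_QF: "fmap (refl_z 0) QF = cayley (signed_z 1) * QF"
  unfolding refl_z_0 by (subst fmap_QF_shift) (auto simp: finite_fibres_intros signed_z_def)

lemma fmap_refl_z_pos_QF: "i > 0 \<Longrightarrow> fmap (refl_z i) QF = QF"
  unfolding refl_z_pos by (rule fmap_QF_fixed) (auto simp: finite_fibres_intros transpose_def)

lemma fmap_comp: "fmap (\<phi> \<circ> \<psi>) F = fmap \<phi> (fmap \<psi> F)"
  by (simp add: fps_eq_iff)

text \<open>By (1 + k)(1 + l) = (1 - k)(1 - l) + 2 (k + l), the product differs from 1 by a multiple
  of 2 (a + b). For a = z_2 and b = z_1 this is, up to sign, twice the root of
  \<open>Node_hat1\<close>.\<close>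

lemma cayley_mult: "cayley a * cayley b = 1 + fps_const (2 * (a + b)) * (fps_X * (geo a * geo b))"
proof -
  let ?a = "fps_const a * fps_X" and ?b = "fps_const b * fps_X"
  have "((1 + k) * g) * ((1 + l) * h) = ((1 - k) * g) * ((1 - l) * h) + (k + l + k + l) * (g * h)"
    for k l g h :: "'a fps"
    by (simp add: algebra_simps)
  then have "cayley a * cayley b = ((1 - ?a) * geo a) * ((1 - ?b) * geo b) + (?a + ?b + ?a + ?b) * (geo a * geo b)"
    unfolding cayley_def by blast
  also have "?a + ?b + ?a + ?b = fps_const (a + b + a + b) * fps_X"
    by (simp only: fps_const_add[symmetric] distrib_right)
  also have "a + b + a + b = 2 * (a + b)"
    by simp
  finally show ?thesis
    by (simp only: geo_inverse mult_1 mult.assoc)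
qed

text \<open>A uniform form for all types: up to sign the root is 2 l in type C and l in types B and
  D. So Q_k changes by a multiple of the root in type C, and in types B and D, after halving, P_k
  does. The nodes with i > 0 fix \<open>QF\<close> and have H = 0.\<close>

lemma fmap_s_z_QF:
  assumes "n \<in> nodes X"
  obtains l H where "\<And>k. H $ k \<in> ring_R X" "fmap (s_z n) QF = QF + fps_const (2 * l) * H"
    "H = 0 \<or> omega (simple_root X n) = (if X = TypeC then - (2 * l) else - l)"
proof (cases n)
  case (Node i)
  show ?thesis
  proof (cases "i = 0")
    case True
    show ?thesis
    proof (rule that)
      show "(fps_X * (geo (signed_z 1) * QF)) $ k \<in> ring_R X" for k
        by (cases k) (auto intro!: fps_mult_in_ring_R geo_in_ring_R signed_z_in_ring_R simp: ring_R_0 Q_ser_in_ring_R)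
      show "fmap (s_z n) QF = QF + fps_const (2 * signed_z 1) * (fps_X * (geo (signed_z 1) * QF))"
        by (simp add: Node True fmap_refl_z_0_QF cayley_altdef distrib_right mult.assoc)
      have "X \<noteq> TypeD"
        using assms Node True by (auto simp: nodes_def)
      then show "fps_X * (geo (signed_z 1) * QF) = 0 \<or> omega (simple_root X n) = (if X = TypeC then - (2 * signed_z 1) else - signed_z 1)"
        unfolding omega_simple_root Node True by (simp add: signed_z_uminus)
    qed
  next
    case False
    then show ?thesis
      using Node by (intro that[of 0 0]) (auto simp: fmap_refl_z_pos_QF ring_R_0)
  qed
next
  case Node_hat1
  interpret F: comm_ring_hom "fmap (refl_z i)" for i
    by (rule comm_ring_hom_fmap[OF comm_ring_hom_refl_z])
  have "fmap (s_z n) QF = cayley (signed_z 2) * cayley (signed_z 1) * QF"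
    by (simp add: Node_hat1 fmap_comp fmap_refl_z_0_QF fmap_refl_z_pos_QF F.hom_mult fmap_cayley comm_ring_hom_refl_z
        refl_z_signed_z simple_refl_0 simple_refl_pos mult.assoc)
  then have eq: "fmap (s_z n) QF = QF + fps_const (2 * (signed_z 2 + signed_z 1)) * (fps_X * (geo (signed_z 2) * geo (signed_z 1) * QF))"
    by (simp only: cayley_mult distrib_right mult_1 mult.assoc)
  have mem: "(fps_X * (geo (signed_z 2) * geo (signed_z 1) * QF)) $ k \<in> ring_R X" for k
    by (cases k) (auto intro!: fps_mult_in_ring_R geo_in_ring_R signed_z_in_ring_R simp: ring_R_0 Q_ser_in_ring_R)
  have om: "omega (simple_root X n) = (if X = TypeC then - (2 * (signed_z 2 + signed_z 1)) else - (signed_z 2 + signed_z 1))"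
    using assms unfolding omega_simple_root Node_hat1
    by (cases X) (auto simp: nodes_def signed_z_uminus signed_z_uminus[of 2, simplified])
  show ?thesis
    by (rule that[OF mem eq disjI2[OF om]])
qed

lemma s_z_Q_ser_divisible:
  assumes "n \<in> nodes X" "X = TypeC"
  shows "\<exists>q\<in>ring_R X. Q_ser k - s_z n (Q_ser k) = omega (simple_root X n) * q"
proof -
  obtain l H where H: "\<And>k. H $ k \<in> ring_R X" "fmap (s_z n) QF = QF + fps_const (2 * l) * H"
    "H = 0 \<or> omega (simple_root X n) = (if X = TypeC then - (2 * l) else - l)"
    using fmap_s_z_QF[OF assms(1)] by blast
  have "fmap (s_z n) QF $ k = Q_ser k + 2 * l * H $ k"
    by (simp add: H(2) fps_mult_left_const_nth)
  then have "Q_ser k - s_z n (Q_ser k) = - (2 * l) * H $ k"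
    by simp
  then show ?thesis
    using H(1,3) assms(2) by (intro bexI[of _ "H $ k"]) auto
qed

lemma s_z_P_ser_divisible:
  assumes "n \<in> nodes X" "X \<noteq> TypeC" "k \<ge> 1"
  shows "\<exists>q\<in>ring_R X. P_ser k - s_z n (P_ser k) = omega (simple_root X n) * q"
proof -
  obtain l H where H: "\<And>k. H $ k \<in> ring_R X" "fmap (s_z n) QF = QF + fps_const (2 * l) * H"
    "H = 0 \<or> omega (simple_root X n) = (if X = TypeC then - (2 * l) else - l)"
    using fmap_s_z_QF[OF assms(1)] by blast
  have "fmap (s_z n) QF $ k = Q_ser k + 2 * l * H $ k"
    by (simp add: H(2) fps_mult_left_const_nth)
  then have "s_z n (2 * P_ser k) = 2 * P_ser k + 2 * l * H $ k"
    unfolding two_P_ser[OF assms(3)] by simp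
  then have "2 * (P_ser k - s_z n (P_ser k)) = 2 * (- l * H $ k)"
    by (simp add: s_z.hom_mult s_z.hom_numeral algebra_simps)
  then have "P_ser k - s_z n (P_ser k) = - l * H $ k"
    by (rule cancellableD[OF cancellable_numeral])
  then show ?thesis
    using H(1,3) assms(2) by (intro bexI[of _ "H $ k"]) auto
qed

lemma gen_s_hat1: "gen_s Node_hat1 j = (if j = 1 then - 2 else if j = 2 then - 1 else if j = - 1 then 2 else if j = - 2 then 1 else j)"
  by (auto simp: simple_refl_0 simple_refl_pos)

lemma s_z_zvar_divisible:
  assumes "n \<in> nodes X" "k \<ge> 1"
  shows "\<exists>q\<in>ring_R X. zvar k - s_z n (zvar k) = omega (simple_root X n) * q"
proof -
  have z: "zvar k = signed_z (int k)"
    using assms by (simp add: signed_z_of_nat)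
  have uminus_1: "- 1 \<in> ring_R Y" and uminus_2: "- 2 \<in> ring_R Y" for Y
    by (intro ring_R_uminus ring_R_1 ring_R_numeral)+
  show ?thesis
  proof (cases n)
    case (Node i)
    have "i = 0 \<and> k = 1 \<or> i > 0 \<and> k = i \<or> i > 0 \<and> k = i + 1 \<or> simple_refl i (int k) = int k"
      using assms(2) by (cases "i = 0") (auto simp: simple_refl_0 simple_refl_pos)
    then consider "i = 0" "k = 1" | "i > 0" "k = i" | "i > 0" "k = i + 1" | "simple_refl i (int k) = int k"
      by blast
    then show ?thesis
    proof cases
      case 1
      then show ?thesis
        unfolding z s_z_signed_z omega_simple_root
        by (intro bexI[of _ "if X = TypeC then - 1 else - 2"])
          (auto simp: Node simple_refl_0 signed_z_uminus uminus_1 uminus_2)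
    next
      case 2
      then show ?thesis
        unfolding z s_z_signed_z omega_simple_root
        by (intro bexI[of _ 1]) (auto simp: Node simple_refl_pos signed_z_def ring_R_1 nat_add_distrib)
    next
      case 3
      then show ?thesis
        unfolding z s_z_signed_z omega_simple_root
        by (intro bexI[of _ "- 1"]) (auto simp: Node simple_refl_pos signed_z_def uminus_1 nat_add_distrib)
    next
      case 4
      then show ?thesis
        unfolding z s_z_signed_z omega_simple_root
        by (intro bexI[of _ 0]) (auto simp: Node ring_R_0)
    qed
  next
    case Node_hat1
    have "k = 1 \<or> k = 2 \<or> gen_s n (int k) = int k"
      using assms(2) unfolding Node_hat1 gen_s_hat1 by auto
    then consider "k = 1 \<or> k = 2" | "gen_s n (int k) = int k"
      by blast
    then show ?thesis
    proof cases
      case 1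
      then show ?thesis
        unfolding z s_z_signed_z omega_simple_root
        by (intro bexI[of _ "- 1"]) (auto simp: Node_hat1 gen_s_hat1 signed_z_def uminus_1 simp del: gen_s.simps)
    next
      case 2
      then show ?thesis
        unfolding z s_z_signed_z by (intro bexI[of _ 0]) (auto simp: ring_R_0)
    qed
  qed
qed

lemma root_in_ring_R: "omega (simple_root X n) \<in> ring_R X"
  unfolding omega_simple_root by (intro ring_R_add signed_z_in_ring_R)

text \<open>By the twisted Leibniz rule it suffices to check the generators.\<close>

lemma ring_R_divisible:
  assumes n: "n \<in> nodes X" and "f \<in> ring_R X"
  shows "\<exists>q\<in>ring_R X. f - s_z n f = omega (simple_root X n) * q"
  using assms(2) unfolding ring_R_def
proof (induction rule: subring_gen.induct)
  case (gen g)
  consider k where "k \<ge> 1" "g = tvar k" | k where "k \<ge> 1" "g = zvar k" | "g \<in> Gamma_gens X"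
    using gen by auto
  then show ?case
  proof cases
    case 1
    then show ?thesis
      by (intro bexI[of _ 0]) (auto simp: s_z_tvar subring_gen_0)
  next
    case 2
    then show ?thesis
      using s_z_zvar_divisible[OF n] by (simp add: ring_R_def)
  next
    case 3
    then show ?thesis
      using s_z_Q_ser_divisible[OF n] s_z_P_ser_divisible[OF n]
      by (cases X) (auto simp: Gamma_gens_def ring_R_def)
  qed
next
  case one
  then show ?case
    by (intro bexI[of _ 0]) (auto simp: subring_gen_0 s_z.hom_one)
next
  case (diff f g)
  then obtain p q where "p \<in> ring_R X" "q \<in> ring_R X" "f - s_z n f = omega (simple_root X n) * p"
    "g - s_z n g = omega (simple_root X n) * q"
    by (auto simp: ring_R_def)
  then have "f - g - s_z n (f - g) = omega (simple_root X n) * (p - q)" "p - q \<in> ring_R X"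
    by (auto simp: s_z.hom_minus right_diff_distrib ring_R_diff algebra_simps)
  then show ?case
    unfolding ring_R_def by blast
next
  case (mult f g)
  then obtain p q where pq: "p \<in> ring_R X" "q \<in> ring_R X" "f - s_z n f = omega (simple_root X n) * p"
    "g - s_z n g = omega (simple_root X n) * q" "f \<in> ring_R X" "g \<in> ring_R X"
    by (auto simp: ring_R_def)
  \<comment> \<open>The factor s(f) is written as f - (f - s(f)), because membership of f - s(f) in
    R is what the induction supplies.\<close>
  have "f * g - s_z n (f * g) = (f - s_z n f) * g + (f - (f - s_z n f)) * (g - s_z n g)"
    by (simp add: s_z.hom_mult algebra_simps)
  also have "\<dots> = omega (simple_root X n) * (p * g + (f - omega (simple_root X n) * p) * q)"
    unfolding pq(3,4) by (simp add: algebra_simps)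
  finally have "f * g - s_z n (f * g) = omega (simple_root X n) * (p * g + (f - omega (simple_root X n) * p) * q)" .
  moreover have "p * g + (f - omega (simple_root X n) * p) * q \<in> ring_R X"
    using pq by (intro ring_R_add ring_R_mult ring_R_diff root_in_ring_R)
  ultimately show ?case
    unfolding ring_R_def by blast
qed

lemma del_z_eqI: "omega (simple_root X n) * q = f - s_z n f \<Longrightarrow> del_z X n f = q"
  unfolding del_z_def by (rule exact_quot_eq[OF cancellable_root])

lemma del_z_in_ring_R: "n \<in> nodes X \<Longrightarrow> f \<in> ring_R X \<Longrightarrow> del_z X n f \<in> ring_R X"
  using ring_R_divisible[of n X f] del_z_eqI[of X n _ f] by metis

lemma root_mult_del_z: "n \<in> nodes X \<Longrightarrow> f \<in> ring_R X \<Longrightarrow> omega (simple_root X n) * del_z X n f = f - s_z n f"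
  using ring_R_divisible[of n X f] del_z_eqI[of X n _ f] by metis

lemma omega_Q_ser: "omega (Q_ser k) = Q_ser k"
  unfolding omega_altdef by (rule subst_fixing[OF vars_in_Q_ser]) (auto simp: finite_fibres_intros)

lemma omega_P_ser: "k \<ge> 1 \<Longrightarrow> omega (P_ser k) = P_ser k"
  unfolding omega_altdef by (rule subst_fixing[OF vars_in_P_ser]) (auto simp: finite_fibres_intros)

lemma set_t_zero_Q_ser: "set_t_zero (Q_ser k) = Q_ser k"
  unfolding set_t_zero_def by (rule subst_fixing[OF vars_in_Q_ser]) (auto simp: finite_fibres_intros)

lemma set_t_zero_P_ser: "k \<ge> 1 \<Longrightarrow> set_t_zero (P_ser k) = P_ser k"
  unfolding set_t_zero_def by (rule subst_fixing[OF vars_in_P_ser]) (auto simp: finite_fibres_intros)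

lemma Gamma_gens_fixed: "g \<in> Gamma_gens X \<Longrightarrow> omega g = g \<and> set_t_zero g = g"
  by (cases X) (auto simp: Gamma_gens_def omega_Q_ser omega_P_ser set_t_zero_Q_ser set_t_zero_P_ser)

lemma omega_in_ring_R:
  assumes "f \<in> ring_R X"
  shows "omega f \<in> ring_R X"
  using assms unfolding ring_R_def
proof (rule subring_gen_hom_in[OF _ comm_ring_hom_omega])
  fix g assume g: "g \<in> tvar ` {1..} \<union> zvar ` {1..} \<union> Gamma_gens X"
  then consider k where "k \<ge> 1" "g = tvar k" | k where "k \<ge> 1" "g = zvar k" | "g \<in> Gamma_gens X"
    by auto
  then show "omega g \<in> subring_gen (tvar ` {1..} \<union> zvar ` {1..} \<union> Gamma_gens X)"
  proof cases
    case 3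
    then show ?thesis
      using g Gamma_gens_fixed[OF 3] by (simp add: subring_gen.gen)
  qed (auto simp: omega_tvar omega_zvar intro!: subring_gen_uminus intro: subring_gen.gen)
qed

lemma set_t_zero_in_ring_BH: "f \<in> ring_R X \<Longrightarrow> set_t_zero f \<in> ring_BH X"
  unfolding ring_R_def ring_BH_def
  by (rule subring_gen_hom_in[OF _ comm_ring_hom_set_t_zero])
    (auto simp: set_t_zero_tvar set_t_zero_zvar Gamma_gens_fixed subring_gen_0 intro: subring_gen.gen)

lemma omega_del_z:
  assumes "n \<in> nodes X" "f \<in> ring_R X"
  shows "omega (del_z X n f) = del_t X n (omega f)"
proof -
  have "simple_root X n * omega (del_z X n f) = omega f - s_t n (omega f)"
    using arg_cong[OF root_mult_del_z[OF assms], of omega] by (simp add: omega.hom_mult omega.hom_minus omega_s_z)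
  then show ?thesis
    unfolding del_t_def by (intro exact_quot_eq[symmetric] cancellable_simple_root)
qed

lemma simple_root_mult_del_t:
  assumes "n \<in> nodes X" "f \<in> ring_R X"
  shows "simple_root X n * del_t X n f = f - s_t n f"
proof -
  have "simple_root X n * del_t X n f = omega (omega (simple_root X n) * del_z X n (omega f))"
    using omega_del_z[OF assms(1) omega_in_ring_R[OF assms(2)]] by (simp add: omega.hom_mult)
  also have "\<dots> = f - s_t n f"
    unfolding root_mult_del_z[OF assms(1) omega_in_ring_R[OF assms(2)]] by (simp add: omega.hom_minus omega_s_z)
  finally show ?thesis .
qed

section \<open>Invariants of the reflections\<close>

lemma ring_R_vars_in:
  assumes "f \<in> ring_R X"
  shows "\<exists>N. vars_in (TV ` {1..N} \<union> ZV ` {1..N} \<union> XV ` {1..}) f"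
  using assms unfolding ring_R_def
proof (induction rule: subring_gen.induct)
  case (gen g)
  consider k where "k \<ge> 1" "g = tvar k" | k where "k \<ge> 1" "g = zvar k" | "g \<in> Gamma_gens X"
    using gen by auto
  then show ?case
  proof cases
    case 3
    then have "vars_in (XV ` {1..}) g"
      using vars_in_Q_ser vars_in_P_ser by (cases X) (auto simp: Gamma_gens_def)
    then show ?thesis
      by (intro exI[of _ 0]) (auto elim: vars_in_mono)
  next
    case (1 k)
    then show ?thesis
      by (intro exI[of _ k]) (simp add: vars_in_var)
  next
    case (2 k)
    then show ?thesis
      by (intro exI[of _ k]) (simp add: vars_in_var)
  qed
next
  case one
  then show ?case by (simp add: vars_in_1)
next
  case (diff f g)
  then obtain M N where MN: "vars_in (TV ` {1..M} \<union> ZV ` {1..M} \<union> XV ` {1..}) f"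
    "vars_in (TV ` {1..N} \<union> ZV ` {1..N} \<union> XV ` {1..}) g" by blast
  show ?case
    by (intro exI[of _ "max M N"] vars_in_diff vars_in_mono[OF MN(1)] vars_in_mono[OF MN(2)]) auto
next
  case (mult f g)
  then obtain M N where MN: "vars_in (TV ` {1..M} \<union> ZV ` {1..M} \<union> XV ` {1..}) f"
    "vars_in (TV ` {1..N} \<union> ZV ` {1..N} \<union> XV ` {1..}) g" by blast
  show ?case
    by (intro exI[of _ "max M N"] vars_in_mult vars_in_mono[OF MN(1)] vars_in_mono[OF MN(2)]) auto
qed

lemma ring_R_degle:
  assumes "f \<in> ring_R X"
  shows "\<exists>d. degle d f"
  using assms unfolding ring_R_def
proof (induction rule: subring_gen.induct)
  case (gen g)
  then have "g \<in> range var \<or> (\<exists>k\<ge>1. g = Q_ser k \<or> g = P_ser k)"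
    by (cases X) (auto simp: Gamma_gens_def)
  then show ?case
    by (metis degle_P_ser degle_Q_ser degle_var imageE)
next
  case one
  then show ?case by (simp add: degle_1)
next
  case (diff f g)
  then obtain d e where de: "degle d f" "degle e g" by blast
  show ?case
    by (intro exI[of _ "max d e"] degle_diff degle_mono[OF de(1)] degle_mono[OF de(2)]) auto
next
  case (mult f g)
  then show ?case using degle_mult by blast
qed

lemma Zt_vars_in:
  assumes "f \<in> Zt"
  shows "\<exists>N. vars_in (TV ` {1..N}) f"
  using assms unfolding Zt_def
proof (induction rule: subring_gen.induct)
  case (gen g)
  then obtain k where "k \<ge> 1" "g = tvar k" by auto
  then show ?case
    by (intro exI[of _ k]) (simp add: vars_in_var)
next
  case one
  then show ?case by (simp add: vars_in_1)
next
  case (diff f g)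
  then obtain M N where MN: "vars_in (TV ` {1..M}) f" "vars_in (TV ` {1..N}) g" by blast
  show ?case
    by (intro exI[of _ "max M N"] vars_in_diff vars_in_mono[OF MN(1)] vars_in_mono[OF MN(2)]) auto
next
  case (mult f g)
  then obtain M N where MN: "vars_in (TV ` {1..M}) f" "vars_in (TV ` {1..N}) g" by blast
  show ?case
    by (intro exI[of _ "max M N"] vars_in_mult vars_in_mono[OF MN(1)] vars_in_mono[OF MN(2)]) auto
qed

text \<open>Adjacent transpositions carry a variable that occurs in \<open>f\<close> beyond the last variable that does.\<close>

lemma symmetric_vars_in:
  fixes V :: "nat \<Rightarrow> 'v"
  assumes "vars_in (A \<union> V ` {1..N}) f" "inj V" "A \<inter> range V = {}"
    and sym: "\<And>i. i \<ge> 1 \<Longrightarrow> subst (\<lambda>_. 1) (transpose (V i) (V (i + 1))) f = f"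
  shows "vars_in A f"
proof -
  have *: "V i \<notin> variables m" if "coeff f m \<noteq> 0" "i \<ge> 1" "i + k > N" for m i k
    using that
  proof (induction k arbitrary: i m)
    case (0 i m)
    then have "variables m \<subseteq> A \<union> V ` {1..N}"
      using assms(1) by (auto simp: vars_in_def)
    moreover have "V i \<notin> A \<union> V ` {1..N}"
      using 0 assms(2,3) by (auto simp: inj_eq)
    ultimately show ?case by blast
  next
    case (Suc k i m)
    let ?\<tau> = "transpose (V i) (V (i + 1))"
    have "coeff (subst (\<lambda>_. 1) ?\<tau> f) (push ?\<tau> m) = coeff f m"
      by (rule coeff_subst_push[of UNIV]) (auto simp: vars_in_def intro!: finite_fibres_bij)
    then have "coeff f (push ?\<tau> m) \<noteq> 0"
      using sym[OF Suc.prems(2)] Suc.prems(1) by simp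
    then have "V (i + 1) \<notin> variables (push ?\<tau> m)"
      using Suc.prems by (intro Suc.IH) auto
    then show ?case
      by (auto simp: keys_push image_iff transpose_def)
  qed
  show ?thesis
    unfolding vars_in_def
  proof (intro allI impI subsetI)
    fix m v assume m: "coeff f m \<noteq> 0" "v \<in> variables m"
    then have "v \<in> A \<union> V ` {1..N}"
      using assms(1) by (auto simp: vars_in_def)
    moreover have "v \<notin> V ` {1..N}"
      using *[OF m(1), of _ N] m(2) by auto
    ultimately show "v \<in> A" by blast
  qed
qed

text \<open>
  On series without \<open>z\<close>-variables the reflection acts by \<open>x\<^sub>1 \<mapsto> z\<^sub>2, x\<^sub>2 \<mapsto> z\<^sub>1, x\<^sub>j \<mapsto> x\<^sub>j\<^sub>-\<^sub>2\<close>,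
  so an invariant series involves no \<open>x\<^sub>j\<close>.
\<close>

lemma hat1_invariant_vars_in:
  assumes f: "vars_in (TV ` {1..} \<union> XV ` {1..}) f" and inv: "s_z Node_hat1 f = f"
  shows "vars_in (TV ` {1..}) f"
proof -
  let ?A0 = "TV ` {1..} \<union> XV ` {1..} :: indet set"
  let ?h = "shift_to (ZV 1)" and ?\<tau> = "transpose (ZV 1) (ZV 2)"
  let ?c = "\<lambda>v. if v = ZV 1 then - 1 else 1 :: int"
  let ?A1 = "?h ` ?A0"
  let ?A2 = "?\<tau> ` ?A1"
  define H where "H = ?h \<circ> ?\<tau> \<circ> ?h"
  have r: "s_z Node_hat1 f = subst ?c ?h (subst (\<lambda>_. 1) ?\<tau> (subst ?c ?h f))"
    by (simp add: refl_z_0 refl_z_pos numeral_2_eq_2)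
  have inj0: "inj_on ?h ?A0"
    by (auto simp: inj_on_def shift_to_def split: if_splits)
  have A1: "?A1 \<subseteq> TV ` {1..} \<union> {ZV 1} \<union> XV ` {1..}"
  proof (intro image_subsetI)
    fix v assume "v \<in> ?A0"
    then show "?h v \<in> TV ` {1..} \<union> {ZV 1} \<union> XV ` {1..}"
      by (auto simp: shift_to_def intro!: imageI)
  qed
  \<comment> \<open>The transposition moves z_1, where the first \<open>?h\<close> has put x_1, to
    z_2. Hence the second \<open>?h\<close>, which carries a sign at z_1 and sends x_1 there, acts
    without sign and injectively.\<close>
  have "?\<tau> ` (TV ` {1..} \<union> {ZV 1} \<union> XV ` {1..}) \<subseteq> TV ` {1..} \<union> {ZV 2} \<union> XV ` {1..}"
    by (auto simp: transpose_def)
  then have A2: "?A2 \<subseteq> TV ` {1..} \<union> {ZV 2} \<union> XV ` {1..}"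
    using image_mono[OF A1, of ?\<tau>] by (rule order_trans[rotated])
  have inj2: "inj_on ?h (TV ` {1..} \<union> {ZV 2} \<union> XV ` {1..})"
    by (auto simp: inj_on_def shift_to_def split: if_splits)
  have coeff: "coeff f (push H m) = coeff f m" if m: "variables m \<subseteq> ?A0" for m
  proof -
    have "coeff (subst ?c ?h f) (push ?h m) = coeff f m"
      by (rule coeff_subst_push[OF f inj0 _ m]) (auto simp: finite_fibres_intros)
    moreover have "coeff (subst (\<lambda>_. 1) ?\<tau> (subst ?c ?h f)) (push ?\<tau> (push ?h m)) = coeff (subst ?c ?h f) (push ?h m)"
      by (rule coeff_subst_push[of UNIV]) (auto simp: vars_in_def finite_fibres_intros)
    moreover have "coeff (subst ?c ?h (subst (\<lambda>_. 1) ?\<tau> (subst ?c ?h f))) (push ?h (push ?\<tau> (push ?h m)))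
      = coeff (subst (\<lambda>_. 1) ?\<tau> (subst ?c ?h f)) (push ?\<tau> (push ?h m))"
    proof (rule coeff_subst_push[of ?A2])
      show "vars_in ?A2 (subst (\<lambda>_. 1) ?\<tau> (subst ?c ?h f))"
        by (intro vars_in_subst f)
      show "inj_on ?h ?A2"
        by (rule inj_on_subset[OF inj2 A2])
      show "variables (push ?\<tau> (push ?h m)) \<subseteq> ?A2"
        unfolding keys_push using m by (intro image_mono)
      show "?c v = 1" if "v \<in> ?A2" for v
        using subsetD[OF A2 that] by auto
    qed (rule finite_fibres_shift_to)
    moreover have "push H m = push ?h (push ?\<tau> (push ?h m))"
      by (simp only: H_def push_push comp_assoc)
    ultimately show ?thesis
      unfolding inv[unfolded r] by (simp only:)
  qed
  have "XV j \<notin> variables m" if "j \<ge> 1" "coeff f m \<noteq> 0" for j m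
    using that
  proof (induction j arbitrary: m rule: less_induct)
    case (less j m)
    have m: "variables m \<subseteq> ?A0"
      using f less.prems by (auto simp: vars_in_def)
    then have nz: "coeff f (push H m) \<noteq> 0"
      using coeff less.prems by simp
    then have "variables (push H m) \<subseteq> ?A0"
      using f by (auto simp: vars_in_def)
    then have sub: "H ` variables m \<subseteq> ?A0"
      by (simp add: keys_push)
    show ?case
    proof
      assume j: "XV j \<in> variables m"
      have "j = Suc (Suc (j - 2)) \<and> j - 2 \<ge> 1" if "j \<noteq> 1" "j \<noteq> 2"
        using that less.prems(1) by linarith
      then consider "j = 1" | "j = 2" | i where "j = Suc (Suc i)" "i \<ge> 1"
        by metis
      then show False
      proof cases
        case 1
        then have "H (XV j) = ZV 2" by (simp add: H_def transpose_def)
        then show False using sub j by force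
      next
        case 2
        then have "H (XV j) = ZV 1" by (simp add: H_def transpose_def numeral_2_eq_2)
        then show False using sub j by force
      next
        case 3
        then have "H (XV j) = XV i"
          by (auto simp: H_def transpose_def shift_to_def)
        then have "XV i \<in> variables (push H m)"
          using j by (force simp: keys_push)
        then show False
          using less.IH[OF _ _ nz, of i] 3 by auto
      qed
    qed
  qed
  then show ?thesis
    using f unfolding vars_in_def by fast
qed

text \<open>The homomorphism that keeps the t_i and sends all z_i and x_i to 0 fixes
  \<open>f\<close>; it kills every Q_k and P_k with k \<ge> 1, so it maps R into \<int>[t].\<close>

lemma ring_R_vars_in_Zt:
  assumes "f \<in> ring_R X" "vars_in (TV ` {1..}) f"
  shows "f \<in> Zt"
proof -
  let ?c = "\<lambda>v. (case v of TV _ \<Rightarrow> 1 | _ \<Rightarrow> 0) :: int"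
  let ?\<pi> = "subst ?c id"
  note hom = comm_ring_hom_subst[OF finite_fibres_id, of ?c]
  interpret \<pi>: comm_ring_hom ?\<pi> by (rule hom)
  have Q: "?\<pi> (Q_ser k) = 0" if "k \<ge> 1" for k
  proof -
    have "fmap ?\<pi> QF = 1"
      by (rule fmap_QF_zero) (auto simp: finite_fibres_id)
    then have "fmap ?\<pi> QF $ k = 1 $ k" by simp
    then show ?thesis using that by simp
  qed
  have P: "?\<pi> (P_ser k) = 0" if "k \<ge> 1" for k
  proof -
    have "2 * ?\<pi> (P_ser k) = 2 * 0"
      using Q[OF that] unfolding two_P_ser[OF that, symmetric] by (simp add: \<pi>.hom_mult \<pi>.hom_numeral)
    then show ?thesis
      by (rule cancellableD[OF cancellable_numeral])
  qed
  have "?\<pi> f = f"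
    by (rule subst_fixing[OF assms(2)]) (auto simp: finite_fibres_id)
  moreover have "?\<pi> f \<in> Zt"
    using assms(1) unfolding ring_R_def Zt_def
  proof (rule subring_gen_hom_in[OF _ hom])
    fix g assume "g \<in> tvar ` {1..} \<union> zvar ` {1..} \<union> Gamma_gens X"
    then consider k where "k \<ge> 1" "g = tvar k" | k where "k \<ge> 1" "g = zvar k" | "g \<in> Gamma_gens X"
      by auto
    then show "?\<pi> g \<in> subring_gen (tvar ` {1..})"
    proof cases
      case 3
      then have "?\<pi> g = 0"
        using Q P by (cases X) (auto simp: Gamma_gens_def)
      then show ?thesis by (simp add: subring_gen_0)
    qed (auto simp: subst_var finite_fibres_id subring_gen_0 intro: subring_gen.gen)
  qed
  ultimately show ?thesis by simp
qed

lemma Zt_fixed: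
  assumes "f \<in> Zt"
  shows "s_z n f = f"
proof -
  have "s_z n f = id f"
    using assms unfolding Zt_def
    by (rule subring_gen_hom_eq[OF _ comm_ring_hom_s_z comm_ring_hom_id]) (auto simp: s_z_tvar)
  then show ?thesis by simp
qed

lemma invariant_in_Zt:
  assumes f: "f \<in> ring_R X" and inv: "\<And>n. n \<in> nodes X \<Longrightarrow> s_z n f = f"
  shows "f \<in> Zt"
proof (rule ring_R_vars_in_Zt[OF f], rule hat1_invariant_vars_in)
  have pos: "refl_z i f = f" if "i \<ge> 1" for i
    using inv[of "Node i"] that by (cases X) (auto simp: nodes_def)
  \<comment> \<open>In types B and C this reflection is the word s_0 s_1 s_0, so all three types are
    handled through the generator of type D.\<close>
  show "s_z Node_hat1 f = f"
  proof (cases "X = TypeD")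
    case True
    then show ?thesis
      using inv[of Node_hat1] by (simp add: nodes_def)
  next
    case False
    then have "refl_z 0 f = f"
      using inv[of "Node 0"] by (cases X) (auto simp: nodes_def)
    then show ?thesis
      using pos[of 1] by simp
  qed
  obtain N where N: "vars_in (TV ` {1..N} \<union> ZV ` {1..N} \<union> XV ` {1..}) f"
    using ring_R_vars_in[OF f] by blast
  show "vars_in (TV ` {1..} \<union> XV ` {1..}) f"
  proof (rule symmetric_vars_in)
    show "vars_in (TV ` {1..} \<union> XV ` {1..} \<union> ZV ` {1..N}) f"
      by (rule vars_in_mono[OF N]) auto
    show "subst (\<lambda>_. 1) (transpose (ZV i) (ZV (i + 1))) f = f" if "i \<ge> 1" for i
      using pos[OF that] that by (simp add: refl_z_pos)
  qed (auto simp: inj_def)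
qed

text \<open>Symmetry in infinitely many t_i, of which only finitely many occur, makes
  \<open>f\<close> constant.\<close>

lemma Zt_invariant_eq_0:
  assumes "f \<in> Zt" "\<And>n. n \<in> nodes X \<Longrightarrow> s_t n f = f" "coeff f 0 = 0"
  shows "f = 0"
proof -
  obtain N where N: "vars_in (TV ` {1..N}) f"
    using Zt_vars_in[OF assms(1)] by blast
  have "vars_in {} f"
  proof (rule symmetric_vars_in)
    show "vars_in ({} \<union> TV ` {1..N}) f"
      using N by simp
    show "subst (\<lambda>_. 1) (transpose (TV i) (TV (i + 1))) f = f" if "i \<ge> 1" for i
      using assms(2)[of "Node i"] that by (cases X) (auto simp: nodes_def refl_t_pos)
  qed (auto simp: inj_def)
  then have "coeff f m = 0" for m
    using assms(3) by (cases "m = 0") (auto simp: vars_in_def)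
  then show ?thesis
    by (intro series_eqI) simp
qed

text \<open>A reflection beyond the last z-variable of \<open>f\<close> fixes it. Hence only
  finitely many divided differences of \<open>f\<close> are nonzero, which keeps its expansion
  finite.\<close>

lemma finite_moved_nodes:
  assumes "f \<in> ring_R X"
  shows "finite {n \<in> nodes X. s_z n f \<noteq> f}"
proof -
  obtain N where N: "vars_in (TV ` {1..N} \<union> ZV ` {1..N} \<union> XV ` {1..}) f"
    using ring_R_vars_in[OF assms] by blast
  have "refl_z i f = f" if "i > N" for i
    unfolding refl_z_pos[OF le_less_trans[OF le0 that]]
    by (rule subst_fixing[OF N]) (use that in \<open>auto simp: finite_fibres_intros transpose_def\<close>)
  then have "{n \<in> nodes X. s_z n f \<noteq> f} \<subseteq> insert Node_hat1 (Node ` {..N})"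
  proof -
    have "n \<in> insert Node_hat1 (Node ` {..N})" if "s_z n f \<noteq> f" for n
      using that \<open>\<And>i. i > N \<Longrightarrow> refl_z i f = f\<close> by (cases n) (auto simp: not_le[symmetric])
    then show ?thesis by blast
  qed
  then show ?thesis
    by (rule finite_subset) simp
qed

section \<open>Reduced words of signed permutations\<close>

definition wprod :: "node list \<Rightarrow> int \<Rightarrow> int" where
  "wprod is = foldr (\<circ>) (map gen_s is) id"

lemma wprod_Nil [simp]: "wprod [] = id"
  and wprod_Cons [simp]: "wprod (n # is) = gen_s n \<circ> wprod is"
  by (simp_all add: wprod_def)

lemma wprod_append: "wprod (is @ js) = wprod is \<circ> wprod js"
  by (induction "is") (auto simp: comp_assoc)

lemma wprod_snoc: "wprod (is @ [n]) = wprod is \<circ> gen_s n"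
  by (simp only: wprod_append wprod_Cons wprod_Nil comp_id)

lemma simple_refl_simple_refl: "simple_refl i (simple_refl i j) = j"
  by (cases "i = 0") (auto simp: simple_refl_0 simple_refl_pos)

lemma gen_s_gen_s [simp]: "gen_s n (gen_s n j) = j"
  by (cases n) (simp_all add: simple_refl_simple_refl)

lemma gen_s_comp [simp]: "gen_s n \<circ> gen_s n = id"
  by (simp add: fun_eq_iff)

lemma comp_gen_s_gen_s [simp]: "w \<circ> gen_s n \<circ> gen_s n = w" "gen_s n \<circ> (gen_s n \<circ> w) = w"
  by (simp_all add: fun_eq_iff)

lemma bij_gen_s: "bij (gen_s n)"
  by (rule o_bij[of "gen_s n"]) simp_all

lemma inv_gen_s: "inv (gen_s n) = gen_s n"
  by (rule inv_unique_comp) simp_all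

lemma permutation_gen_s: "permutation (gen_s n)"
proof (cases n)
  case (Node i)
  have "{j. gen_s n j \<noteq> j} \<subseteq> {- 1, 1, int i, int i + 1, - int i, - int i - 1}"
    by (cases "i = 0") (auto simp: Node simple_refl_0 simple_refl_pos)
  then show ?thesis
    unfolding permutation by (intro conjI bij_gen_s) (erule finite_subset, simp)
next
  case Node_hat1
  have "{j. gen_s n j \<noteq> j} \<subseteq> {1, 2, - 1, - 2}"
    unfolding Node_hat1 gen_s_hat1 by auto
  then show ?thesis
    unfolding permutation by (intro conjI bij_gen_s) (erule finite_subset, simp)
qed

definition fixes_above :: "nat \<Rightarrow> (int \<Rightarrow> int) \<Rightarrow> bool" where
  "fixes_above n w \<longleftrightarrow> (\<forall>j. \<bar>j\<bar> > int n \<longrightarrow> w j = j)"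

definition nodes_below :: "lie_type \<Rightarrow> nat \<Rightarrow> node set" where
  "nodes_below X n = {m \<in> nodes X. \<forall>i. m = Node i \<longrightarrow> i < n}"

lemma W_infD:
  assumes "w \<in> W_inf"
  shows "bij w" "w (- i) = - w i" "w 0 = 0"
proof -
  show "bij w" using assms by (simp add: W_inf_def permutation)
  show *: "w (- i) = - w i" for i using assms by (simp add: W_inf_def)
  show "w 0 = 0" using *[of 0] by simp
qed

lemma weyl_subset_W_inf: "w \<in> weyl X \<Longrightarrow> w \<in> W_inf"
  by (cases X) (auto simp: weyl_def W_inf'_def)

lemma weyl_inj: "w \<in> weyl X \<Longrightarrow> w i = w j \<longleftrightarrow> i = j"
  using W_infD(1)[OF weyl_subset_W_inf] by (metis bij_def inj_eq)

lemma id_in_weyl: "id \<in> weyl X"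
proof -
  have "{i :: int. 0 < i \<and> i < 0} = {}" by auto
  then show ?thesis
    by (cases X) (auto simp: weyl_def W_inf_def W_inf'_def simp del: Collect_empty_eq)
qed

lemma W_inf_finite_negs: "w \<in> W_inf \<Longrightarrow> finite {i. i > 0 \<and> w i < 0}"
  by (rule finite_subset[of _ "{i. w i \<noteq> i}"]) (auto simp: W_inf_def permutation)

lemma inv_in_W_inf:
  assumes "w \<in> W_inf"
  shows "inv w \<in> W_inf"
proof -
  note b = W_infD[OF assms]
  have "inv w (- i) = - inv w i" for i
    using b(1,2) by (metis bij_inv_eq_iff)
  then show ?thesis
    using assms by (simp add: W_inf_def permutation_inverse)
qed

text \<open>For type D, i \<mapsto> - w i matches the sign changes of w with those of its inverse,
  so their numbers have the same parity.\<close>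

lemma inv_in_weyl:
  assumes "w \<in> weyl X"
  shows "inv w \<in> weyl X"
proof (cases "X = TypeD")
  case False
  then show ?thesis
    using assms inv_in_W_inf by (cases X) (auto simp: weyl_def)
next
  case True
  then have w: "w \<in> W_inf" "even (card {i. i > 0 \<and> w i < 0})"
    using assms by (auto simp: weyl_def W_inf'_def)
  note b = W_infD[OF w(1)]
  have "{i. i > 0 \<and> inv w i < 0} = (\<lambda>i. - w i) ` {i. i > 0 \<and> w i < 0}"
  proof (intro equalityI subsetI)
    fix k assume k: "k \<in> {i. i > 0 \<and> inv w i < 0}"
    have "w (- inv w k) = - k"
      using b by (simp add: bij_is_surj surj_f_inv_f)
    then show "k \<in> (\<lambda>i. - w i) ` {i. i > 0 \<and> w i < 0}"
      using k by (intro image_eqI[of _ _ "- inv w k"]) auto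
  next
    fix k assume "k \<in> (\<lambda>i. - w i) ` {i. i > 0 \<and> w i < 0}"
    then obtain i where i: "i > 0" "w i < 0" "k = - w i" by auto
    then have "k = w (- i)" using b(2) by simp
    then have "inv w k = - i"
      using b(1) by (simp add: bij_is_inj inv_f_f)
    then show "k \<in> {i. i > 0 \<and> inv w i < 0}"
      using i by simp
  qed
  moreover have "inj_on (\<lambda>i. - w i) {i. i > 0 \<and> w i < 0}"
    using weyl_inj[OF assms] by (simp add: inj_on_def)
  ultimately have "card {i. i > 0 \<and> inv w i < 0} = card {i. i > 0 \<and> w i < 0}"
    by (simp only: card_image)
  then show ?thesis
    using True w inv_in_W_inf[OF w(1)] by (simp add: weyl_def W_inf'_def)
qed

lemma weyl_comp_gen_s:
  assumes "w \<in> weyl X" "n \<in> nodes X"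
  shows "w \<circ> gen_s n \<in> weyl X"
proof -
  have w: "w \<in> W_inf" using assms(1) by (rule weyl_subset_W_inf)
  have ws: "w \<circ> gen_s n \<in> W_inf"
    using w by (auto simp: W_inf_def gen_s_uminus intro: permutation_compose permutation_gen_s)
  show ?thesis
  proof (cases "X = TypeD")
    case False
    then show ?thesis
      using ws by (cases X) (auto simp: weyl_def)
  next
    case True
    then have ev: "even (card {i. i > 0 \<and> w i < 0})"
      using assms by (auto simp: weyl_def W_inf'_def)
    have "even (card {i. i > 0 \<and> (w \<circ> gen_s n) i < 0})"
    proof (cases n)
      case (Node i)
      then have i: "i > 0"
        using assms(2) True by (auto simp: nodes_def)
      have pos: "gen_s n j > 0" if "j > 0" for j
        using that i by (auto simp: Node simple_refl_pos)
      have "{j. j > 0 \<and> (w \<circ> gen_s n) j < 0} = gen_s n ` {j. j > 0 \<and> w j < 0}"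
      proof (intro equalityI subsetI)
        fix j assume "j \<in> {j. j > 0 \<and> (w \<circ> gen_s n) j < 0}"
        then show "j \<in> gen_s n ` {j. j > 0 \<and> w j < 0}"
          using pos[of j] by (intro image_eqI[of _ _ "gen_s n j"]) auto
      next
        fix j assume "j \<in> gen_s n ` {j. j > 0 \<and> w j < 0}"
        then show "j \<in> {j. j > 0 \<and> (w \<circ> gen_s n) j < 0}"
          using pos by auto
      qed
      moreover have "inj_on (gen_s n) A" for A
        using bij_gen_s by (metis bij_def inj_on_subset subset_UNIV)
      ultimately show ?thesis
        using ev by (simp add: card_image)
    next
      case Node_hat1
      \<comment> \<open>Outside {1, 2} nothing changes; on {1, 2} the values w 1 and w 2 are
        exchanged and both negated, so k sign changes there become 2 - k.\<close>
      define A where "A = {i. i > 0 \<and> w i < 0}"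
      define B where "B = {i. i > 0 \<and> (w \<circ> gen_s n) i < 0}"
      have fin: "finite A" "finite B"
        using W_inf_finite_negs[OF w] W_inf_finite_negs[OF ws] by (auto simp: A_def B_def)
      have ne: "w 1 \<noteq> 0" "w 2 \<noteq> 0"
        using weyl_inj[OF assms(1), of _ 0] W_infD(3)[OF w] by auto
      have d: "A - {1, 2} = B - {1, 2}"
        unfolding A_def B_def Node_hat1 comp_def gen_s_hat1 by auto
      have g: "gen_s n 1 = - 2" "gen_s n 2 = - 1"
        unfolding Node_hat1 gen_s_hat1 by auto
      have cA: "A \<inter> {1, 2} = (if w 1 < 0 then {1} else {}) \<union> (if w 2 < 0 then {2} else {})"
        by (auto simp: A_def)
      have cB: "B \<inter> {1, 2} = (if w 2 > 0 then {1} else {}) \<union> (if w 1 > 0 then {2} else {})"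
        using g W_infD(2)[OF w] by (auto simp: B_def)
      have "card A = card (A - {1, 2}) + card (A \<inter> {1, 2})" "card B = card (B - {1, 2}) + card (B \<inter> {1, 2})"
        using fin by (simp_all add: card_Diff_subset_Int card_mono)
      moreover have "even (card (A \<inter> {1, 2})) \<longleftrightarrow> even (card (B \<inter> {1, 2}))"
        unfolding cA cB using ne by auto
      ultimately have "even (card B)"
        using ev[folded A_def] d by simp
      then show ?thesis
        unfolding B_def .
    qed
    then show ?thesis
      using True ws by (simp add: weyl_def W_inf'_def)
  qed
qed

lemma wprod_in_weyl: "set is \<subseteq> nodes X \<Longrightarrow> wprod is \<in> weyl X"
  by (induction "is" rule: rev_induct) (auto simp: id_in_weyl wprod_append intro: weyl_comp_gen_s)

lemma gen_s_comp_weyl: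
  assumes "w \<in> weyl X" "n \<in> nodes X"
  shows "gen_s n \<circ> w \<in> weyl X" "inv (gen_s n \<circ> w) = inv w \<circ> gen_s n" "inv (w \<circ> gen_s n) = gen_s n \<circ> inv w"
proof -
  have b: "bij w" using W_infD(1)[OF weyl_subset_W_inf[OF assms(1)]] .
  show *: "inv (gen_s n \<circ> w) = inv w \<circ> gen_s n" "inv (w \<circ> gen_s n) = gen_s n \<circ> inv w"
    using o_inv_distrib[OF bij_gen_s b] o_inv_distrib[OF b bij_gen_s] by (simp_all add: inv_gen_s)
  have "inv (inv w \<circ> gen_s n) \<in> weyl X"
    by (intro inv_in_weyl weyl_comp_gen_s assms)
  also have "inv (inv w \<circ> gen_s n) = gen_s n \<circ> w"
    using o_inv_distrib[OF bij_imp_bij_inv[OF b] bij_gen_s] b by (simp add: inv_gen_s inv_inv_eq)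
  finally show "gen_s n \<circ> w \<in> weyl X" .
qed

lemma ex_fixes_above:
  assumes "w \<in> W_inf"
  obtains n where "n \<ge> m" "fixes_above n w"
proof -
  have "finite (abs ` {j. w j \<noteq> j})"
    using assms by (auto simp: W_inf_def permutation)
  then obtain k where k: "\<forall>j\<in>abs ` {j. w j \<noteq> j}. j \<le> k"
    by (meson finite_has_maximal2 Max_ge)
  have "fixes_above (max m (nat k)) w"
    using k by (force simp: fixes_above_def)
  then show ?thesis
    by (intro that[of "max m (nat k)"]) auto
qed

lemma fixes_above_bound:
  assumes "fixes_above n w" "w \<in> W_inf" "\<bar>j\<bar> \<le> int n"
  shows "\<bar>w j\<bar> \<le> int n"
proof (rule ccontr)
  assume neg: "\<not> \<bar>w j\<bar> \<le> int n"
  then have "w (w j) = w j"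
    using assms(1) neg by (simp add: fixes_above_def)
  then have "w j = j"
    using W_infD(1)[OF assms(2)] by (metis bij_def inj_eq)
  then show False
    using neg assms(3) by simp
qed

lemma fixes_above_gen_s:
  assumes "m \<in> nodes_below X n" "n \<ge> 2"
  shows "fixes_above n (gen_s m)"
proof (cases m)
  case (Node i)
  then have "i < n" using assms by (simp add: nodes_below_def)
  then show ?thesis
    using assms(2) by (cases "i = 0") (auto simp: fixes_above_def Node simple_refl_0 simple_refl_pos)
next
  case Node_hat1
  then show ?thesis
    using assms(2) unfolding fixes_above_def Node_hat1 gen_s_hat1 by auto
qed

lemma fixes_above_comp: "fixes_above n v \<Longrightarrow> fixes_above n w \<Longrightarrow> fixes_above n (v \<circ> w)"
  by (simp add: fixes_above_def)

text \<open>
  Inversions are counted on pairs of integers, so that each inversion occurs together with its image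
  under \<open>(a, b) \<mapsto> (-b, -a)\<close>; the number of pairs is twice the length. The pairs with an entry \<open>0\<close> count
  the sign changes, which contribute to the length in types B and C only.
\<close>

definition pairs :: "lie_type \<Rightarrow> (int \<times> int) set" where
  "pairs X = {(a, b). a < b \<and> a \<noteq> - b \<and> (X = TypeD \<longrightarrow> a \<noteq> 0 \<and> b \<noteq> 0)}"

definition inversions :: "lie_type \<Rightarrow> (int \<Rightarrow> int) \<Rightarrow> (int \<times> int) set" where
  "inversions X w = {(a, b) \<in> pairs X. w a > w b}"

text \<open>The two elements of \<open>pairs X\<close> whose order the generator reverses, mirror
  images under (a, b) \<mapsto> (- b, - a). For a node of the type, the generator permutes all other
  elements of \<open>pairs X\<close>.\<close>

fun node_pairs :: "node \<Rightarrow> (int \<times> int) set" where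
  "node_pairs (Node i) = (if i = 0 then {(- 1, 0), (0, 1)} else {(int i, int i + 1), (- int i - 1, - int i)})"
| "node_pairs Node_hat1 = {(- 2, 1), (- 1, 2)}"

lemma finite_inversions:
  assumes "w \<in> W_inf"
  shows "finite (inversions X w)"
proof -
  obtain n where n: "fixes_above n w"
    using ex_fixes_above[OF assms, of 0] by blast
  have "inversions X w \<subseteq> {- int n..int n} \<times> {- int n..int n}"
  proof clarify
    fix a b assume "(a, b) \<in> inversions X w"
    then have ab: "a < b" "w b < w a"
      by (auto simp: inversions_def pairs_def)
    have big: "w j = j" if "\<bar>j\<bar> > int n" for j
      using n that by (simp add: fixes_above_def)
    have small: "\<bar>w j\<bar> \<le> int n" if "\<bar>j\<bar> \<le> int n" for j
      using fixes_above_bound[OF n assms that] .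
    have "\<bar>b\<bar> \<le> int n"
      using ab big[of a] big[of b] small[of a] by linarith
    moreover have "\<bar>a\<bar> \<le> int n"
      using ab big[of a] big[of b] small[of b] by linarith
    ultimately show "a \<in> {- int n..int n} \<and> b \<in> {- int n..int n}" by auto
  qed
  then show ?thesis
    by (rule finite_subset) simp
qed

lemma gen_s_pairs:
  assumes "(a, b) \<in> pairs X - node_pairs n" "n \<in> nodes X"
  shows "(gen_s n a, gen_s n b) \<in> pairs X - node_pairs n"
proof (cases n)
  case (Node i)
  show ?thesis
  proof (cases "i = 0")
    case True
    moreover have "X \<noteq> TypeD"
      using assms(2) Node True by (auto simp: nodes_def)
    ultimately show ?thesis
      using assms(1) by (auto simp: Node pairs_def simple_refl_0)
  next
    case False
    then show ?thesis
      using assms(1) by (auto simp: Node pairs_def simple_refl_pos)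
  qed
next
  case Node_hat1
  then have "X = TypeD"
    using assms(2) by (cases X) (auto simp: nodes_def)
  then show ?thesis
    using assms(1) unfolding Node_hat1 gen_s_hat1 by (auto simp: pairs_def)
qed

lemma gen_s_node_pairs:
  assumes "(a, b) \<in> node_pairs n"
  shows "(gen_s n b, gen_s n a) \<in> node_pairs n"
proof (cases n)
  case (Node i)
  then show ?thesis
    using assms by (cases "i = 0") (auto simp: simple_refl_0 simple_refl_pos)
next
  case Node_hat1
  then have "a = - 2 \<and> b = 1 \<or> a = - 1 \<and> b = 2"
    using assms by auto
  then show ?thesis
    unfolding Node_hat1 gen_s_hat1 by (elim disjE conjE) simp_all
qed

lemma card_node_pairs: "card (node_pairs n) = 2" "finite (node_pairs n)"
proof -
  have "card (node_pairs n) = 2 \<and> finite (node_pairs n)"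
  proof (cases n)
    case (Node i)
    then show ?thesis by (cases "i = 0") simp_all
  qed simp
  then show "card (node_pairs n) = 2" "finite (node_pairs n)" by blast+
qed

lemma inversions_gen_s:
  assumes "n \<in> nodes X"
  shows "inversions X (w \<circ> gen_s n) - node_pairs n = map_prod (gen_s n) (gen_s n) ` (inversions X w - node_pairs n)"
proof (intro equalityI subsetI)
  fix p assume "p \<in> inversions X (w \<circ> gen_s n) - node_pairs n"
  then obtain a b where p: "p = (a, b)" "(a, b) \<in> pairs X - node_pairs n" "w (gen_s n a) > w (gen_s n b)"
    by (auto simp: inversions_def)
  then show "p \<in> map_prod (gen_s n) (gen_s n) ` (inversions X w - node_pairs n)"
    using gen_s_pairs[OF p(2) assms]
    by (intro image_eqI[of _ _ "(gen_s n a, gen_s n b)"]) (auto simp: inversions_def)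
next
  fix p assume "p \<in> map_prod (gen_s n) (gen_s n) ` (inversions X w - node_pairs n)"
  then obtain a b where p: "p = (gen_s n a, gen_s n b)" "(a, b) \<in> pairs X - node_pairs n" "w a > w b"
    by (auto simp: inversions_def)
  then show "p \<in> inversions X (w \<circ> gen_s n) - node_pairs n"
    using gen_s_pairs[OF p(2) assms] by (auto simp: inversions_def)
qed

lemma card_inversions_gen_s:
  assumes "n \<in> nodes X"
  shows "card (inversions X (w \<circ> gen_s n) - node_pairs n) = card (inversions X w - node_pairs n)"
proof -
  have "inj_on (map_prod (gen_s n) (gen_s n)) A" for A
    by (rule inj_on_subset[OF prod.inj_map[OF bij_is_inj[OF bij_gen_s] bij_is_inj[OF bij_gen_s]] subset_UNIV])
  then show ?thesis
    unfolding inversions_gen_s[OF assms] by (rule card_image)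
qed

lemma card_inversions_le:
  assumes "w \<in> W_inf" "n \<in> nodes X"
  shows "card (inversions X (w \<circ> gen_s n)) \<le> card (inversions X w) + 2"
proof -
  have "card (inversions X (w \<circ> gen_s n)) \<le> card (inversions X (w \<circ> gen_s n) - node_pairs n) + card (node_pairs n)"
    using diff_card_le_card_Diff[OF card_node_pairs(2), of "inversions X (w \<circ> gen_s n)" n] by linarith
  also have "\<dots> \<le> card (inversions X w) + 2"
    unfolding card_inversions_gen_s[OF assms(2)] card_node_pairs
    using finite_inversions[OF assms(1)] by (intro add_right_mono card_mono) auto
  finally show ?thesis .
qed

lemma card_inversions_descent:
  assumes "w \<in> W_inf" "n \<in> nodes X" "node_pairs n \<subseteq> inversions X w"
  shows "card (inversions X (w \<circ> gen_s n)) + 2 = card (inversions X w)"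
proof -
  have "inversions X (w \<circ> gen_s n) \<inter> node_pairs n = {}"
  proof (rule ccontr)
    assume "\<not> ?thesis"
    then obtain a b where ab: "(a, b) \<in> node_pairs n" "(a, b) \<in> inversions X (w \<circ> gen_s n)"
      by auto
    then have "w (gen_s n b) > w (gen_s n a)"
      using gen_s_node_pairs[OF ab(1)] assms(3) by (auto simp: inversions_def)
    then show False
      using ab(2) by (auto simp: inversions_def)
  qed
  then have "inversions X (w \<circ> gen_s n) = inversions X (w \<circ> gen_s n) - node_pairs n"
    by blast
  then have "card (inversions X (w \<circ> gen_s n)) = card (inversions X w - node_pairs n)"
    using card_inversions_gen_s[OF assms(2)] by metis
  also have "\<dots> + 2 = card (inversions X w)"
    using card_Diff_subset[OF card_node_pairs(2) assms(3)] card_mono[OF finite_inversions[OF assms(1)] assms(3)]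
    by (simp add: card_node_pairs)
  finally show ?thesis .
qed

text \<open>Strictly increasing integers that start above 0 satisfy w i \<ge> i, and those that end
  at or below n satisfy w i \<le> i.\<close>

lemma increasing_positive_eq_id:
  assumes w: "w \<in> W_inf" and n: "fixes_above n w" and inc: "\<And>i. 1 \<le> i \<Longrightarrow> i < n \<Longrightarrow> w (int i) < w (int i + 1)"
    and pos: "w 1 > 0"
  shows "w = id"
proof -
  have lower: "w (int i) \<ge> int i" if "1 \<le> i" "i \<le> n" for i
    using that
  proof (induction i rule: dec_induct)
    case base
    then show ?case using pos by simp
  next
    case (step i)
    then show ?case using inc[of i] by (simp add: add.commute)
  qed
  have upper: "w (int (n - k)) \<le> int (n - k)" if "k < n" for k
    using that
  proof (induction k)
    case 0
    then show ?case using fixes_above_bound[OF n w, of "int n"] by simp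
  next
    case (Suc k)
    have "n - k = Suc (n - Suc k)" using Suc.prems by simp
    then have eq: "int (n - k) = int (n - Suc k) + 1" by linarith
    have "w (int (n - k)) \<le> int (n - k)"
      using Suc.prems by (intro Suc.IH) simp
    moreover have "w (int (n - Suc k)) < w (int (n - Suc k) + 1)"
      using Suc.prems by (intro inc) auto
    ultimately show ?case
      unfolding eq by linarith
  qed
  have eq: "w (int i) = int i" for i
  proof -
    consider "i = 0" | "1 \<le> i" "i \<le> n" | "i > n" by linarith
    then show ?thesis
    proof cases
      case 1
      then show ?thesis using W_infD(3)[OF w] by simp
    next
      case 2
      then show ?thesis using lower[of i] upper[of "n - i"] by simp
    next
      case 3
      then show ?thesis using n by (simp add: fixes_above_def)
    qed
  qed
  show ?thesis
  proof
    fix j show "w j = id j"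
      using eq[of "nat j"] eq[of "nat (- j)"] W_infD(2)[OF w, of "- j"] by (cases "j \<ge> 0") auto
  qed
qed

text \<open>Without a descent, w increases on 1, ..., n, and it remains to exclude w 1 < 0. In types
  B and C the node 0 does so. In type D, \<open>Node_hat1\<close> gives w 1 + w 2 > 0, so a negative
  w 1 would be the only sign change, against the parity.\<close>

lemma ex_descent:
  assumes w: "w \<in> weyl X" and n: "fixes_above n w" "n \<ge> 2" and "w \<noteq> id"
  shows "\<exists>m\<in>nodes_below X n. node_pairs m \<subseteq> inversions X w"
proof (rule ccontr)
  assume "\<not> ?thesis"
  then have no: "\<not> node_pairs m \<subseteq> inversions X w" if "m \<in> nodes_below X n" for m
    using that by blast
  note W = weyl_subset_W_inf[OF w] and odd = W_infD(2)[OF weyl_subset_W_inf[OF w]]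
  have inc: "w (int i) < w (int i + 1)" if i: "1 \<le> i" "i < n" for i
  proof (rule ccontr)
    assume "\<not> ?thesis"
    then have "w (int i) > w (int i + 1)"
      using weyl_inj[OF w, of "int i" "int i + 1"] by linarith
    moreover from this have "w (- int i - 1) > w (- int i)"
      using odd[of "int i"] odd[of "int i + 1"] by simp
    ultimately have "node_pairs (Node i) \<subseteq> inversions X w"
      using i by (auto simp: inversions_def pairs_def)
    moreover have "Node i \<in> nodes_below X n"
      using i by (cases X) (auto simp: nodes_below_def nodes_def)
    ultimately show False using no by blast
  qed
  have ne: "w 1 \<noteq> 0" "w 2 \<noteq> 0"
    using weyl_inj[OF w, of _ 0] W_infD(3)[OF W] by auto
  have "w 1 > 0"
  proof (cases "X = TypeD")
    case False
    show ?thesis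
    proof (rule ccontr)
      assume "\<not> ?thesis"
      then have "w 1 < 0" using ne by linarith
      then have "node_pairs (Node 0) \<subseteq> inversions X w"
        using False odd[of 1] W_infD(3)[OF W] by (auto simp: inversions_def pairs_def)
      moreover have "Node 0 \<in> nodes_below X n"
        using n False by (cases X) (auto simp: nodes_below_def nodes_def)
      ultimately show False using no by blast
    qed
  next
    case True
    have 12: "w 1 + w 2 > 0"
    proof (rule ccontr)
      assume "\<not> ?thesis"
      moreover have "w 1 \<noteq> w (- 2)"
        using weyl_inj[OF w, of 1 "- 2"] by simp
      ultimately have "w 1 + w 2 < 0"
        using odd[of 2] by linarith
      then have "node_pairs Node_hat1 \<subseteq> inversions X w"
        using odd[of 1] odd[of 2] by (auto simp: inversions_def pairs_def)
      moreover have "Node_hat1 \<in> nodes_below X n"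
        using True by (auto simp: nodes_below_def nodes_def)
      ultimately show False using no by blast
    qed
    show ?thesis
    proof (rule ccontr)
      assume "\<not> ?thesis"
      then have neg1: "w 1 < 0" using ne by linarith
      then have pos2: "w 2 > 0" using 12 by linarith
      have pos: "w (int i) > 0" if "2 \<le> i" "i \<le> n" for i
        using that
      proof (induction i rule: dec_induct)
        case base
        then show ?case using pos2 by simp
      next
        case (step i)
        then show ?case using inc[of i] by (simp add: add.commute)
      qed
      have "{i. i > 0 \<and> w i < 0} = {1}"
      proof (intro equalityI subsetI)
        fix i assume i: "i \<in> {i. i > 0 \<and> w i < 0}"
        show "i \<in> {1}"
        proof (rule ccontr)
          assume "i \<notin> {1}"
          then have "i \<ge> 2" using i by auto
          moreover have "w i = i" if "i > int n"
            using n(1) that by (simp add: fixes_above_def)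
          ultimately have "w i > 0"
            using pos[of "nat i"] by (cases "i > int n") auto
          then show False using i by auto
        qed
      qed (use neg1 in auto)
      then have "card {i. i > 0 \<and> w i < 0} = 1" by simp
      then show False
        using w True by (auto simp: weyl_def W_inf'_def)
    qed
  qed
  then have "w = id"
    using increasing_positive_eq_id[OF W n(1) inc] by blast
  then show False using assms(4) by blast
qed

text \<open>Removing a descent on the right costs exactly two inversion pairs and stays within the
  signed permutations that fix everything above \<open>n\<close>.\<close>

lemma ex_word_inversions:
  assumes "w \<in> weyl X" "fixes_above n w" "n \<ge> 2"
  shows "\<exists>is. set is \<subseteq> nodes_below X n \<and> wprod is = w \<and> 2 * length is = card (inversions X w)"
  using assms(1,2)
proof (induction "card (inversions X w)" arbitrary: w rule: less_induct)
  case (less w)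
  show ?case
  proof (cases "w = id")
    case True
    then have "inversions X w = {}"
      by (auto simp: inversions_def pairs_def)
    then show ?thesis
      using True by (intro exI[of _ "[]"]) auto
  next
    case False
    then obtain m where m: "m \<in> nodes_below X n" "node_pairs m \<subseteq> inversions X w"
      using ex_descent[OF less.prems assms(3)] by blast
    then have mX: "m \<in> nodes X" by (simp add: nodes_below_def)
    note card = card_inversions_descent[OF weyl_subset_W_inf[OF less.prems(1)] mX m(2)]
    have "fixes_above n (w \<circ> gen_s m)"
      by (intro fixes_above_comp less.prems fixes_above_gen_s[OF m(1) assms(3)])
    then obtain "is" where "is": "set is \<subseteq> nodes_below X n" "wprod is = w \<circ> gen_s m"
      "2 * length is = card (inversions X (w \<circ> gen_s m))"
      using less.hyps[of "w \<circ> gen_s m"] card weyl_comp_gen_s[OF less.prems(1) mX] by auto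
    then show ?thesis
      using m(1) card by (intro exI[of _ "is @ [m]"]) (auto simp: wprod_append)
  qed
qed

lemma card_inversions_wprod: "set is \<subseteq> nodes X \<Longrightarrow> card (inversions X (wprod is)) \<le> 2 * length is"
proof (induction "is" rule: rev_induct)
  case Nil
  have "inversions X id = {}"
    by (auto simp: inversions_def pairs_def)
  then show ?case by (simp only: wprod_Nil card.empty le0)
next
  case (snoc n "is")
  then have "card (inversions X (wprod is \<circ> gen_s n)) \<le> card (inversions X (wprod is)) + 2"
    by (intro card_inversions_le weyl_subset_W_inf[OF wprod_in_weyl]) auto
  then show ?case
    unfolding wprod_snoc using snoc by (simp add: o_def)
qed

lemma len_wprod_le: "set is \<subseteq> nodes X \<Longrightarrow> len X (wprod is) \<le> length is"
  unfolding len_def wprod_def by (rule Least_le) blast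

lemma ex_reduced_word_len:
  assumes "set js \<subseteq> nodes X"
  shows "\<exists>is. length is = len X (wprod js) \<and> set is \<subseteq> nodes X \<and> wprod js = wprod is"
  unfolding len_def wprod_def using assms by (intro LeastI_ex[of "\<lambda>n. \<exists>is. length is = n \<and> set is \<subseteq> nodes X \<and> _ = _ is"]) auto

text \<open>\<open>len\<close> minimises over words in all generators. The word built from descents
  has half as many letters as there are inversion pairs, and no word can have fewer, so the minimum
  is attained by generators below \<open>n\<close>.\<close>

lemma ex_reduced_word:
  assumes "w \<in> weyl X" "fixes_above n w" "n \<ge> 2"
  shows "\<exists>is. set is \<subseteq> nodes_below X n \<and> wprod is = w \<and> length is = len X w"
proof -
  obtain "is" where "is": "set is \<subseteq> nodes_below X n" "wprod is = w" "2 * length is = card (inversions X w)"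
    using ex_word_inversions[OF assms] by blast
  then have sub: "set is \<subseteq> nodes X" by (auto simp: nodes_below_def)
  obtain js where js: "length js = len X w" "set js \<subseteq> nodes X" "w = wprod js"
    using ex_reduced_word_len[OF sub] "is"(2) by auto
  have "length is \<le> len X w"
    using card_inversions_wprod[OF js(2)] js "is"(3) by simp
  then have "length is = len X w"
    using len_wprod_le[OF sub] "is"(2) by simp
  then show ?thesis using "is" by blast
qed

lemma ex_reduced_word_weyl:
  assumes "w \<in> weyl X"
  shows "\<exists>is. set is \<subseteq> nodes X \<and> wprod is = w \<and> length is = len X w"
proof -
  obtain n where "n \<ge> 2" "fixes_above n w"
    using ex_fixes_above[OF weyl_subset_W_inf[OF assms]] by blast
  then show ?thesis
    using ex_reduced_word[OF assms, of n] by (auto simp: nodes_below_def)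
qed

lemma len_id [simp]: "len X id = 0"
  using len_wprod_le[of "[]" X] by simp

lemma len_eq_0: "w \<in> weyl X \<Longrightarrow> len X w = 0 \<Longrightarrow> w = id"
  using ex_reduced_word_weyl[of w X] by auto

lemma len_comp_gen_s_le:
  assumes "w \<in> weyl X" "n \<in> nodes X"
  shows "len X (w \<circ> gen_s n) \<le> len X w + 1"
proof -
  obtain "is" where "is": "set is \<subseteq> nodes X" "wprod is = w" "length is = len X w"
    using ex_reduced_word_weyl[OF assms(1)] by blast
  then show ?thesis
    using len_wprod_le[of "is @ [n]" X, unfolded wprod_snoc] assms(2) by simp
qed

lemma len_le_comp_gen_s:
  assumes "w \<in> weyl X" "n \<in> nodes X"
  shows "len X w \<le> len X (w \<circ> gen_s n) + 1"
  using len_comp_gen_s_le[OF weyl_comp_gen_s[OF assms] assms(2)] by simp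

lemma wprod_rev: "set is \<subseteq> nodes X \<Longrightarrow> wprod (rev is) = inv (wprod is)"
proof (induction "is")
  case (Cons n "is")
  then show ?case
    using gen_s_comp_weyl(2)[OF wprod_in_weyl[of "is" X], of n] by (simp add: wprod_append o_def)
qed (simp add: id_def)

lemma len_inv:
  assumes "w \<in> weyl X"
  shows "len X (inv w) = len X w"
proof -
  have le: "len X (inv v) \<le> len X v" if v: "v \<in> weyl X" for v
  proof -
    obtain "is" where "is": "set is \<subseteq> nodes X" "wprod is = v" "length is = len X v"
      using ex_reduced_word_weyl[OF v] by blast
    then show ?thesis
      using len_wprod_le[of "rev is" X] wprod_rev[OF "is"(1)] by simp
  qed
  have "inv (inv w) = w"
    using W_infD(1)[OF weyl_subset_W_inf[OF assms]] by (rule inv_inv_eq)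
  then show ?thesis
    using le[OF assms] le[OF inv_in_weyl[OF assms]] by simp
qed

section \<open>Braid relations for divided differences\<close>

definition s_word :: "node list \<Rightarrow> indet series \<Rightarrow> indet series" where
  "s_word is = foldr (\<circ>) (map s_z is) id"

lemma s_word_Nil: "s_word [] f = f"
  and s_word_Cons: "s_word (n # is) f = s_z n (s_word is f)"
  by (simp_all add: s_word_def)

lemma s_word_snoc: "s_word (is @ [n]) f = s_word is (s_z n f)"
  by (induction "is") (simp_all add: s_word_Nil s_word_Cons)

lemma comm_ring_hom_s_word: "comm_ring_hom (s_word is)"
proof (induction "is")
  case Nil
  have "s_word [] = id" by (simp add: s_word_def)
  then show ?case by (simp only: comm_ring_hom_id)
next
  case (Cons n "is")
  have "s_word (n # is) = s_z n \<circ> s_word is" by (simp add: s_word_def)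
  then show ?case by (simp only: comm_ring_hom_comp[OF comm_ring_hom_s_z Cons])
qed

interpretation s_word: comm_ring_hom "s_word is" for "is"
  by (rule comm_ring_hom_s_word)

lemma s_word_signed_z: "s_word is (signed_z j) = signed_z (wprod is j)"
  by (induction "is") (simp_all add: s_word_Nil s_word_Cons s_z_signed_z)

lemma s_word_tvar: "s_word is (tvar j) = tvar j"
  by (induction "is") (simp_all add: s_word_Nil s_word_Cons s_z_tvar)

text \<open>
  The square of \<open>\<Prod>\<^sub>i (1 + x\<^sub>i u) / (1 - x\<^sub>i u) \<cdot> \<Prod>\<^sub>j ((1 + z\<^sub>j u) / (1 - z\<^sub>j u))\<^sup>1\<^sup>/\<^sup>2\<close>, \<open>j \<le> n\<close>. It is invariant
  under the reflections, which determines their action on \<open>QF\<close> by the action on the \<open>z\<^sub>j\<close>.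
\<close>

definition invariant_series :: "nat \<Rightarrow> indet series fps" where
  "invariant_series n = QF ^ 2 * (\<Prod>j=1..n. cayley (signed_z (int j)))"

lemma fmap_invariant_series_refl_z:
  assumes "i < n"
  shows "fmap (refl_z i) (invariant_series n) = invariant_series n"
proof -
  interpret F: comm_ring_hom "fmap (refl_z i)"
    by (rule comm_ring_hom_fmap[OF comm_ring_hom_refl_z])
  have eq: "fmap (refl_z i) (invariant_series n) = fmap (refl_z i) QF ^ 2 * (\<Prod>j=1..n. cayley (signed_z (simple_refl i (int j))))"
    by (simp only: invariant_series_def F.hom_mult F.hom_power F.hom_prod fmap_cayley[OF comm_ring_hom_refl_z] refl_z_signed_z)
  show ?thesis
  proof (cases "i = 0")
    case True
    have split: "(\<Prod>j=1..n. k (int j)) = k 1 * (\<Prod>j=Suc 1..n. k (int j))" for k :: "int \<Rightarrow> indet series fps"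
      using assms by (subst prod.atLeast_Suc_atMost) auto
    let ?P = "\<Prod>j=Suc 1..n. cayley (signed_z (int j))"
    have "(\<Prod>j=Suc 1..n. cayley (signed_z (simple_refl 0 (int j)))) = ?P"
      by (intro prod.cong) (auto simp: simple_refl_0)
    moreover have "simple_refl 0 1 = - 1"
      by (simp add: simple_refl_0)
    \<comment> \<open>The square of \<open>QF\<close> gains two factors of z_1 while the factor of
      z_1 in the product is inverted: one of the two cancels it and the other replaces it.\<close>
    ultimately have "fmap (refl_z i) (invariant_series n) = (cayley (signed_z 1) * QF) ^ 2 * (cayley (- signed_z 1) * ?P)"
      unfolding eq[unfolded True] True fmap_refl_z_0_QF split[of "\<lambda>j. cayley (signed_z (simple_refl 0 j))"]
      by (simp only: signed_z_uminus)
    also have "\<dots> = (cayley (signed_z 1) * cayley (- signed_z 1)) * (QF ^ 2 * (cayley (signed_z 1) * ?P))"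
      by (simp only: power2_eq_square ac_simps)
    also have "\<dots> = QF ^ 2 * (cayley (signed_z 1) * ?P)"
      by (simp only: cayley_uminus mult_1)
    finally show ?thesis
      unfolding invariant_series_def split[of "\<lambda>j. cayley (signed_z j)"] .
  next
    case False
    have "(\<Prod>j=1..n. cayley (signed_z (simple_refl i (int j)))) = (\<Prod>j=1..n. cayley (signed_z (int j)))"
    proof (rule prod.reindex_bij_witness[where i = "transpose i (i + 1)" and j = "transpose i (i + 1)"])
      fix j assume j: "j \<in> {1..n}"
      show "transpose i (i + 1) (transpose i (i + 1) j) = j" by simp
      then show "transpose i (i + 1) (transpose i (i + 1) j) = j" .
      show "transpose i (i + 1) j \<in> {1..n}"
        using j assms False by (auto simp: transpose_def)
      then show "transpose i (i + 1) j \<in> {1..n}" .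
      have "int (transpose i (i + 1) j) = simple_refl i (int j)"
        using j False by (auto simp: transpose_def simple_refl_pos)
      then show "cayley (signed_z (int (transpose i (i + 1) j))) = cayley (signed_z (simple_refl i (int j)))"
        by simp
    qed
    moreover have "fmap (refl_z i) QF = QF"
      using False by (intro fmap_refl_z_pos_QF) simp
    ultimately have "fmap (refl_z i) (invariant_series n) = QF ^ 2 * (\<Prod>j=1..n. cayley (signed_z (int j)))"
      by (simp only: eq)
    then show ?thesis
      by (simp only: invariant_series_def)
  qed
qed

lemma fmap_invariant_series_s_word:
  assumes "set is \<subseteq> nodes_below X n" "n \<ge> 2"
  shows "fmap (s_word is) (invariant_series n) = invariant_series n"
  using assms(1)
proof (induction "is")
  case Nil
  then show ?case by (simp add: fps_eq_iff s_word_Nil)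
next
  case (Cons m "is")
  have m: "fmap (s_z m) (invariant_series n) = invariant_series n"
  proof (cases m)
    case (Node i)
    then have "i < n" using Cons.prems by (simp add: nodes_below_def)
    then show ?thesis by (simp add: Node fmap_invariant_series_refl_z)
  next
    case Node_hat1
    then show ?thesis
      using assms(2) by (simp add: fmap_comp fmap_invariant_series_refl_z)
  qed
  have "fmap (s_word (m # is)) (invariant_series n) = fmap (s_z m) (fmap (s_word is) (invariant_series n))"
    by (simp add: fps_eq_iff s_word_Cons)
  then show ?case
    using m Cons by simp
qed

text \<open>(F + G)(F - G) = 0, and F + G starts with 2, which can be cancelled, so the coefficients
  of F - G vanish one after the other.\<close>

lemma fps_sqrt_unique:
  fixes F G :: "'v series fps"
  assumes "F ^ 2 = G ^ 2" "F $ 0 = 1" "G $ 0 = 1"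
  shows "F = G"
proof -
  define K where "K = F + G"
  define H where "H = F - G"
  have KH: "K * H = 0"
    using assms(1) by (simp add: K_def H_def power2_eq_square algebra_simps)
  have K0: "K $ 0 = 2"
    using assms(2,3) by (simp add: K_def)
  have "H $ n = 0" for n
  proof (induction n rule: less_induct)
    case (less n)
    have "(K * H) $ n = K $ 0 * H $ n + (\<Sum>i=Suc 0..n. K $ i * H $ (n - i))"
      unfolding fps_mult_nth by (subst sum.atLeast_Suc_atMost) auto
    also have "(\<Sum>i=Suc 0..n. K $ i * H $ (n - i)) = 0"
      using less by (intro sum.neutral) auto
    finally have "2 * H $ n = 0"
      by (simp add: KH K0)
    then have "2 * H $ n = 2 * 0" by simp
    then show ?case
      by (rule cancellableD[OF cancellable_numeral])
  qed
  then have "H = 0" by (simp add: fps_eq_iff)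
  then show ?thesis by (simp add: H_def)
qed

text \<open>Invariance of \<open>invariant_series\<close> determines the square of the image of
  \<open>QF\<close> up to a product that depends on the signed permutation only and is invertible by
  \<open>cayley_uminus\<close>.\<close>

lemma fmap_s_word_QF_eq:
  assumes "set is \<subseteq> nodes_below X n" "set js \<subseteq> nodes_below X n" "n \<ge> 2" "wprod is = wprod js"
  shows "fmap (s_word is) QF = fmap (s_word js) QF"
proof (rule fps_sqrt_unique)
  define U where "U = (\<Prod>j=1..n. cayley (signed_z (wprod is (int j))))"
  define U' where "U' = (\<Prod>j=1..n. cayley (- signed_z (wprod is (int j))))"
  have U: "U * U' = 1"
    by (simp add: U_def U'_def cayley_uminus flip: prod.distrib)
  have sq: "fmap (s_word ks) QF ^ 2 * U = invariant_series n"
    if "set ks \<subseteq> nodes_below X n" "wprod ks = wprod is" for ks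
  proof -
    interpret F: comm_ring_hom "fmap (s_word ks)"
      by (rule comm_ring_hom_fmap[OF comm_ring_hom_s_word])
    have "fmap (s_word ks) (invariant_series n) = fmap (s_word ks) QF ^ 2 * U"
      by (simp only: invariant_series_def F.hom_mult F.hom_power F.hom_prod fmap_cayley[OF comm_ring_hom_s_word]
          s_word_signed_z that(2) U_def)
    then show ?thesis
      using fmap_invariant_series_s_word[OF that(1) assms(3)] by simp
  qed
  have "fmap (s_word is) QF ^ 2 * U * U' = fmap (s_word js) QF ^ 2 * U * U'"
    using sq[OF assms(1)] sq[OF assms(2)] assms(4) by simp
  then show "fmap (s_word is) QF ^ 2 = fmap (s_word js) QF ^ 2"
    by (simp only: mult.assoc U mult_1_right)
qed (simp_all add: Q_ser_0 s_word.hom_one)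

text \<open>On R a word acts through its signed permutation: on the z_i this is read off the
  indices, on Q_k it comes from \<open>QF\<close>, and on P_k from cancelling 2.\<close>

lemma s_word_eq:
  assumes "set is \<subseteq> nodes_below X n" "set js \<subseteq> nodes_below X n" "n \<ge> 2" "wprod is = wprod js" "f \<in> ring_R X"
  shows "s_word is f = s_word js f"
proof (rule subring_gen_hom_eq[OF assms(5)[unfolded ring_R_def] comm_ring_hom_s_word comm_ring_hom_s_word])
  have Q: "s_word is (Q_ser k) = s_word js (Q_ser k)" for k
    using arg_cong[OF fmap_s_word_QF_eq[OF assms(1-4)], of "\<lambda>F. F $ k"] by simp
  have P: "s_word is (P_ser k) = s_word js (P_ser k)" if "k \<ge> 1" for k
  proof -
    have "2 * s_word is (P_ser k) = 2 * s_word js (P_ser k)"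
      using Q[of k] unfolding two_P_ser[OF that, symmetric] by (simp add: s_word.hom_mult s_word.hom_numeral)
    then show ?thesis
      by (rule cancellableD[OF cancellable_numeral])
  qed
  fix g assume "g \<in> tvar ` {1..} \<union> zvar ` {1..} \<union> Gamma_gens X"
  then consider k where "g = tvar k" | k where "k \<ge> 1" "g = zvar k" | "g \<in> Gamma_gens X"
    by auto
  then show "s_word is g = s_word js g"
  proof cases
    case 1
    then show ?thesis by (simp only: s_word_tvar)
  next
    case (2 k)
    then show ?thesis
      using s_word_signed_z[of "is" "int k"] s_word_signed_z[of js "int k"] assms(4) by (simp add: signed_z_of_nat)
  next
    case 3
    then obtain k where "k \<ge> 1" "g = Q_ser k \<or> g = P_ser k"
      by (cases X) (auto simp: Gamma_gens_def)
    then show ?thesis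
      using Q P by auto
  qed
qed

lemma nodes_below_subset: "nodes_below X n \<subseteq> nodes X"
  by (auto simp: nodes_below_def)

lemma ex_nodes_below:
  assumes "set is \<subseteq> nodes X"
  shows "\<exists>n\<ge>2. set is \<subseteq> nodes_below X n"
  using assms
proof (induction "is")
  case Nil
  then show ?case by auto
next
  case (Cons m "is")
  then obtain n where n: "n \<ge> 2" "set is \<subseteq> nodes_below X n" by auto
  define k where "k = (case m of Node i \<Rightarrow> Suc i | _ \<Rightarrow> 0)"
  have "m \<in> nodes_below X (max n k)"
    using Cons.prems by (auto simp: nodes_below_def k_def)
  moreover have "set is \<subseteq> nodes_below X (max n k)"
    using n(2) by (auto simp: nodes_below_def less_max_iff_disj)
  ultimately show ?case
    using n(1) by (intro exI[of _ "max n k"]) auto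
qed

definition weyl_below :: "lie_type \<Rightarrow> nat \<Rightarrow> (int \<Rightarrow> int) set" where
  "weyl_below X n = {w \<in> weyl X. fixes_above n w}"

lemma finite_weyl_below: "finite (weyl_below X n)"
proof (rule finite_subset)
  show "weyl_below X n \<subseteq> {w. w permutes {- int n..int n}}"
  proof
    fix w assume w: "w \<in> weyl_below X n"
    then have "bij w" using W_infD(1)[OF weyl_subset_W_inf] by (auto simp: weyl_below_def)
    moreover have "w j = j" if "j \<notin> {- int n..int n}" for j
      using w that by (auto simp: weyl_below_def fixes_above_def)
    ultimately show "w \<in> {w. w permutes {- int n..int n}}"
      by (auto simp: permutes_def bij_iff)
  qed
qed (simp add: finite_permutations)

section \<open>Words of divided differences\<close>

definition del_word :: "lie_type \<Rightarrow> node list \<Rightarrow> indet series \<Rightarrow> indet series" where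
  "del_word X is f = foldr (del_z X) is f"

lemma del_word_Nil: "del_word X [] f = f"
  and del_word_Cons: "del_word X (n # is) f = del_z X n (del_word X is f)"
  and del_word_snoc: "del_word X (is @ [n]) f = del_word X is (del_z X n f)"
  by (simp_all add: del_word_def)

lemma del_word_in_ring_R: "set is \<subseteq> nodes X \<Longrightarrow> f \<in> ring_R X \<Longrightarrow> del_word X is f \<in> ring_R X"
  by (induction "is") (auto simp: del_word_Nil del_word_Cons del_z_in_ring_R)

lemma del_z_0: "del_z X n 0 = 0"
  by (rule del_z_eqI) (simp add: s_z.hom_zero)

lemma del_z_add:
  assumes "n \<in> nodes X" "f \<in> ring_R X" "g \<in> ring_R X"
  shows "del_z X n (f + g) = del_z X n f + del_z X n g"
  by (rule del_z_eqI) (simp add: distrib_left root_mult_del_z assms s_z.hom_add)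

lemma del_z_diff:
  assumes "n \<in> nodes X" "f \<in> ring_R X" "g \<in> ring_R X"
  shows "del_z X n (f - g) = del_z X n f - del_z X n g"
  by (rule del_z_eqI) (simp add: right_diff_distrib root_mult_del_z assms s_z.hom_minus)

lemma del_z_scale:
  assumes "n \<in> nodes X" "f \<in> ring_R X" "c \<in> Zt"
  shows "del_z X n (c * f) = c * del_z X n f"
proof (rule del_z_eqI)
  have "omega (simple_root X n) * (c * del_z X n f) = c * (omega (simple_root X n) * del_z X n f)"
    by (rule mult.left_commute)
  then show "omega (simple_root X n) * (c * del_z X n f) = c * f - s_z n (c * f)"
    by (simp add: root_mult_del_z assms s_z.hom_mult Zt_fixed right_diff_distrib)
qed

lemma Zt_in_ring_R: "c \<in> Zt \<Longrightarrow> c \<in> ring_R X"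
  using Zt_subset_ring_R by blast

lemma del_word_lincomb:
  assumes "set is \<subseteq> nodes X" "\<And>w. w \<in> F \<Longrightarrow> c w \<in> Zt" "\<And>w. w \<in> F \<Longrightarrow> S w \<in> ring_R X"
  shows "del_word X is (\<Sum>w\<in>F. c w * S w) = (\<Sum>w\<in>F. c w * del_word X is (S w))"
  using assms(1)
proof (induction "is")
  case Nil
  then show ?case by (simp add: del_word_Nil)
next
  case (Cons n "is")
  have one: "del_z X n (\<Sum>w\<in>G. c w * T w) = (\<Sum>w\<in>G. c w * del_z X n (T w))"
    if "G \<subseteq> F" "\<And>w. w \<in> F \<Longrightarrow> T w \<in> ring_R X" for G T
    using that(1)
  proof (induction G rule: infinite_finite_induct)
    case (insert w G)
    have cT: "c w * T w \<in> ring_R X" if "w \<in> F" for w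
      by (rule ring_R_mult[OF Zt_in_ring_R[OF assms(2)[OF that]] \<open>\<And>w. w \<in> F \<Longrightarrow> T w \<in> ring_R X\<close>[OF that]])
    have "del_z X n (c w * T w + (\<Sum>w\<in>G. c w * T w)) = del_z X n (c w * T w) + del_z X n (\<Sum>w\<in>G. c w * T w)"
      using insert.prems Cons.prems by (intro del_z_add ring_R_sum cT) auto
    also have "del_z X n (c w * T w) = c w * del_z X n (T w)"
      using insert.prems Cons.prems that(2) assms(2) by (intro del_z_scale) auto
    finally show ?case
      using insert by simp
  qed (simp_all add: del_z_0)
  have "del_word X (n # is) (\<Sum>w\<in>F. c w * S w) = del_z X n (\<Sum>w\<in>F. c w * del_word X is (S w))"
    using Cons by (simp add: del_word_Cons)
  also have "\<dots> = (\<Sum>w\<in>F. c w * del_z X n (del_word X is (S w)))"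
    using Cons.prems assms(3) by (intro one del_word_in_ring_R) auto
  finally show ?case
    by (simp add: del_word_Cons)
qed

lemma len_le_comp_word:
  assumes "u \<in> weyl X" "set is \<subseteq> nodes X"
  shows "u \<circ> wprod is \<in> weyl X \<and> len X u \<le> len X (u \<circ> wprod is) + length is"
  using assms(2)
proof (induction "is" rule: rev_induct)
  case Nil
  then show ?case using assms(1) by simp
next
  case (snoc n "is")
  let ?v = "u \<circ> wprod is"
  have sub: "set is \<subseteq> nodes X" and n: "n \<in> nodes X"
    using snoc.prems by auto
  note v = conjunct1[OF snoc.IH[OF sub]] conjunct2[OF snoc.IH[OF sub]]
  have eq: "u \<circ> wprod (is @ [n]) = ?v \<circ> gen_s n"
    by (simp only: wprod_snoc comp_assoc)
  have "len X u \<le> len X (?v \<circ> gen_s n) + length (is @ [n])"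
    using v(2) len_le_comp_gen_s[OF v(1) n] by (simp only: length_append list.size)
  then show ?case
    unfolding eq using weyl_comp_gen_s[OF v(1) n] by (rule conjI[rotated])
qed

definition red_word :: "lie_type \<Rightarrow> nat \<Rightarrow> (int \<Rightarrow> int) \<Rightarrow> node list" where
  "red_word X n w = (SOME is. set is \<subseteq> nodes_below X n \<and> wprod is = w \<and> length is = len X w)"

lemma red_word:
  assumes "w \<in> weyl_below X n" "n \<ge> 2"
  shows "set (red_word X n w) \<subseteq> nodes_below X n" "wprod (red_word X n w) = w" "length (red_word X n w) = len X w"
  using someI_ex[OF ex_reduced_word[of w X n]] assms by (auto simp: red_word_def weyl_below_def)

lemma weyl_below_comp_gen_s:
  assumes "w \<in> weyl_below X n" "n \<ge> 2" "m \<in> nodes_below X n"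
  shows "w \<circ> gen_s m \<in> weyl_below X n"
proof -
  have "m \<in> nodes X" using assms(3) nodes_below_subset by blast
  then show ?thesis
    using assms(1) weyl_comp_gen_s[of w X m] fixes_above_comp[OF _ fixes_above_gen_s[OF assms(3,2)], of w]
    by (auto simp: weyl_below_def)
qed

lemma id_in_weyl_below: "id \<in> weyl_below X n"
  by (simp add: weyl_below_def id_in_weyl fixes_above_def)

text \<open>Each divided difference is (1 - s) divided by a root, so a word is a combination of
  group elements whose denominators are images of roots; \<open>h\<close> collects them. It is
  essential that \<open>h\<close> and \<open>r\<close> do not depend on f.\<close>

lemma del_word_eq_sum_s_word:
  assumes n: "n \<ge> 2" and "set is \<subseteq> nodes_below X n"
  shows "\<exists>h r. cancellable h \<and>
    (\<forall>f\<in>ring_R X. h * del_word X is f = (\<Sum>w\<in>weyl_below X n. r w * s_word (red_word X n w) f))"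
  using assms(2)
proof (induction "is" rule: rev_induct)
  case Nil
  have "f = (\<Sum>w\<in>weyl_below X n. (if w = id then 1 else 0) * s_word (red_word X n w) f)" if f: "f \<in> ring_R X" for f
  proof -
    have "(\<Sum>w\<in>weyl_below X n. (if w = id then 1 else 0) * s_word (red_word X n w) f)
       = (\<Sum>w\<in>weyl_below X n. if w = id then s_word (red_word X n id) f else 0)"
      by (intro sum.cong) auto
    also have "\<dots> = s_word (red_word X n id) f"
      using finite_weyl_below id_in_weyl_below by (subst sum.delta) auto
    also have "\<dots> = s_word [] f"
      using red_word[OF id_in_weyl_below n] by (intro s_word_eq[OF _ _ n _ f]) auto
    finally show ?thesis by (simp add: s_word_Nil)
  qed
  then show ?case
    by (intro exI[of _ 1] exI[of _ "\<lambda>w. if w = id then 1 else 0"]) (auto simp: cancellable_1 del_word_Nil)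
next
  case (snoc m "is")
  let ?V = "weyl_below X n"
  let ?s = "\<lambda>w. s_word (red_word X n w)"
  have m: "m \<in> nodes_below X n" and mX: "m \<in> nodes X"
    using snoc.prems nodes_below_subset by auto
  obtain h r where h: "cancellable h" and r: "\<And>f. f \<in> ring_R X \<Longrightarrow> h * del_word X is f = (\<Sum>w\<in>?V. r w * ?s w f)"
    using snoc by auto
  \<comment> \<open>The denominator of the new letter \<open>m\<close> after s_w has been moved past
    it. The weights \<open>d\<close> below bring all summands over the common denominator, the
    product of the \<open>c v\<close>.\<close>
  define c where "c w = ?s w (omega (simple_root X m))" for w
  define d where "d w = r w * (\<Prod>v\<in>?V - {w}. c v)" for w
  have c: "cancellable (c w)" if "w \<in> ?V" for w
  proof -
    have "w \<in> weyl X" using that by (simp add: weyl_below_def)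
    then have "w (fst (root_ends X m)) \<noteq> - w (snd (root_ends X m))"
      using weyl_inj[of w X "fst (root_ends X m)" "- snd (root_ends X m)"] root_nondegenerate[of X m]
        W_infD(2)[OF weyl_subset_W_inf, of w X] by metis
    then show ?thesis
      using red_word(2)[OF that n] by (simp add: c_def omega_simple_root s_word.hom_add s_word_signed_z cancellable_signed_z)
  qed
  have s: "c w * ?s w (del_z X m f) = ?s w f - ?s (w \<circ> gen_s m) f" if w: "w \<in> ?V" and f: "f \<in> ring_R X" for w f
  proof -
    have "c w * ?s w (del_z X m f) = ?s w (f - s_z m f)"
      by (simp add: c_def root_mult_del_z[OF mX f] flip: s_word.hom_mult)
    also have "\<dots> = ?s w f - s_word (red_word X n w @ [m]) f"
      by (simp add: s_word.hom_minus s_word_snoc)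
    also have "s_word (red_word X n w @ [m]) f = ?s (w \<circ> gen_s m) f"
      using red_word[OF w n] red_word[OF weyl_below_comp_gen_s[OF w n m] n] m
      by (intro s_word_eq[OF _ _ n _ f]) (auto simp: wprod_snoc)
    finally show ?thesis .
  qed
  have eq: "(h * prod c ?V) * del_word X (is @ [m]) f = (\<Sum>w\<in>?V. (d w - d (w \<circ> gen_s m)) * ?s w f)"
    if f: "f \<in> ring_R X" for f
  proof -
    have "(h * prod c ?V) * del_word X (is @ [m]) f = prod c ?V * (\<Sum>w\<in>?V. r w * ?s w (del_z X m f))"
      by (simp only: del_word_snoc r[OF del_z_in_ring_R[OF mX f], symmetric] ac_simps)
    also have "\<dots> = (\<Sum>w\<in>?V. d w * (?s w f - ?s (w \<circ> gen_s m) f))"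
      unfolding sum_distrib_left
    proof (intro sum.cong refl)
      fix w assume w: "w \<in> ?V"
      have "prod c ?V = c w * (\<Prod>v\<in>?V - {w}. c v)"
        by (rule prod.remove[OF finite_weyl_below w])
      then have "prod c ?V * (r w * ?s w (del_z X m f)) = d w * (c w * ?s w (del_z X m f))"
        by (simp only: d_def ac_simps)
      then show "prod c ?V * (r w * ?s w (del_z X m f)) = d w * (?s w f - ?s (w \<circ> gen_s m) f)"
        by (simp only: s[OF w f])
    qed
    also have "\<dots> = (\<Sum>w\<in>?V. d w * ?s w f) - (\<Sum>w\<in>?V. d w * ?s (w \<circ> gen_s m) f)"
      by (simp only: right_diff_distrib sum_subtractf)
    also have "(\<Sum>w\<in>?V. d w * ?s (w \<circ> gen_s m) f) = (\<Sum>w\<in>?V. d (w \<circ> gen_s m) * ?s w f)"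
      by (rule sum.reindex_bij_witness[where i = "\<lambda>w. w \<circ> gen_s m" and j = "\<lambda>w. w \<circ> gen_s m"])
        (auto simp: weyl_below_comp_gen_s n m)
    also have "(\<Sum>w\<in>?V. d w * ?s w f) - (\<Sum>w\<in>?V. d (w \<circ> gen_s m) * ?s w f) = (\<Sum>w\<in>?V. (d w - d (w \<circ> gen_s m)) * ?s w f)"
      by (simp only: left_diff_distrib sum_subtractf)
    finally show ?thesis .
  qed
  have "cancellable (h * prod c ?V)"
    by (intro cancellable_mult h cancellable_prod c)
  then show ?case
    using eq by (intro exI[of _ "h * prod c ?V"] exI[of _ "\<lambda>w. d w - d (w \<circ> gen_s m)"] conjI ballI)
qed

text \<open>The family is assumed to exist. \<open>del_word_cong\<close> and
  \<open>del_word_nonreduced\<close> do not mention it in their statements but are deduced from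
  it.\<close>

locale schubert_family =
  fixes X :: lie_type and S :: "(int \<Rightarrow> int) \<Rightarrow> indet series"
  assumes schubert: "double_schubert X S"
begin

lemma S_in: "w \<in> weyl X \<Longrightarrow> S w \<in> ring_R X"
  using schubert by (simp add: double_schubert_def)

lemma S_id: "S id = 1"
  using schubert by (simp add: double_schubert_def)

lemma del_z_S: "w \<in> weyl X \<Longrightarrow> n \<in> nodes X \<Longrightarrow>
   del_z X n (S w) = (if len X (w \<circ> gen_s n) < len X w then S (w \<circ> gen_s n) else 0)"
  using schubert by (simp add: double_schubert_def)

text \<open>The last letter acts first and each letter multiplies \<open>u\<close> on the right,
  whence the reversed word. A letter lowers the length by at most one, so a total drop of
  \<open>length is\<close> means that every letter was a descent.\<close>

lemma del_word_S:
  assumes u: "u \<in> weyl X" and "set is \<subseteq> nodes X"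
  shows "del_word X is (S u) =
    (if len X (u \<circ> wprod (rev is)) + length is = len X u then S (u \<circ> wprod (rev is)) else 0)"
  using assms(2)
proof (induction "is")
  case Nil
  then show ?case by (simp add: del_word_Nil)
next
  case (Cons n "is")
  let ?v = "u \<circ> wprod (rev is)"
  have n: "n \<in> nodes X" and sub: "set (rev is) \<subseteq> nodes X"
    using Cons.prems by auto
  note v = len_le_comp_word[OF u sub]
  have eq: "u \<circ> wprod (rev (n # is)) = ?v \<circ> gen_s n"
    by (simp only: rev.simps wprod_snoc comp_assoc)
  note le = len_le_comp_gen_s[OF conjunct1[OF v] n]
  have ih: "del_word X is (S u) = (if len X ?v + length is = len X u then S ?v else 0)"
    using Cons.prems by (intro Cons.IH) simp
  show ?case
  proof (cases "len X ?v + length is = len X u")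
    case True
    have "del_word X (n # is) (S u) = (if len X (?v \<circ> gen_s n) < len X ?v then S (?v \<circ> gen_s n) else 0)"
      by (simp only: del_word_Cons ih True simp_thms if_True del_z_S[OF conjunct1[OF v] n])
    moreover have "len X (?v \<circ> gen_s n) < len X ?v \<longleftrightarrow> len X (?v \<circ> gen_s n) + length (n # is) = len X u"
      using le True by auto
    ultimately show ?thesis
      unfolding eq by (simp only:)
  next
    case False
    then have "del_word X (n # is) (S u) = 0"
      by (simp only: del_word_Cons ih False if_False del_z_0)
    moreover have "len X (?v \<circ> gen_s n) + length (n # is) \<noteq> len X u"
      using le False conjunct2[OF v] by simp
    ultimately show ?thesis
      unfolding eq by (simp only: if_False)
  qed
qed

text \<open>
  The matrix \<open>(s\<^sub>v\<^sup>z S\<^sub>u)\<close> over a finite parabolic subgroup has a nonzero determinant because a linear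
  change of rows makes it unitriangular. Hence every \<open>f\<close> behaves under divided differences like
  a combination of the \<open>S\<^sub>u\<close> with invariant coefficients, and the braid relations for divided
  differences follow from their validity on the \<open>S\<^sub>u\<close>.
\<close>

lemma del_word_eq_sum_S:
  assumes n: "n \<ge> 2" and f: "f \<in> ring_R X"
  shows "\<exists>e g. cancellable e \<and> (\<forall>is. set is \<subseteq> nodes_below X n \<longrightarrow>
    e * del_word X is f = (\<Sum>u\<in>weyl_below X n. g u * del_word X is (S u)))"
proof -
  let ?V = "weyl_below X n"
  let ?s = "\<lambda>w. s_word (red_word X n w)"
  have SR: "S u \<in> ring_R X" if "u \<in> ?V" for u
    using that S_in by (simp add: weyl_below_def)
  have "\<forall>v\<in>?V. \<exists>h r. cancellable h \<and>
    (\<forall>f\<in>ring_R X. h * del_word X (red_word X n v) f = (\<Sum>w\<in>?V. r w * ?s w f))"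
  proof
    fix v assume v: "v \<in> ?V"
    show "\<exists>h r. cancellable h \<and>
      (\<forall>f\<in>ring_R X. h * del_word X (red_word X n v) f = (\<Sum>w\<in>?V. r w * ?s w f))"
      by (rule del_word_eq_sum_s_word[OF n red_word(1)[OF v n]])
  qed
  from bchoice[OF this] obtain h where "\<forall>v\<in>?V. \<exists>r. cancellable (h v) \<and>
    (\<forall>f\<in>ring_R X. h v * del_word X (red_word X n v) f = (\<Sum>w\<in>?V. r w * ?s w f))" ..
  from bchoice[OF this] obtain r where r: "\<forall>v\<in>?V. cancellable (h v) \<and>
    (\<forall>f\<in>ring_R X. h v * del_word X (red_word X n v) f = (\<Sum>w\<in>?V. r v w * ?s w f))" ..
  have hr1: "cancellable (h v)" if "v \<in> ?V" for v
    by (rule conjunct1[OF bspec[OF r that]])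
  have hr2: "h v * del_word X (red_word X n v) f = (\<Sum>w\<in>?V. r v w * ?s w f)" if "v \<in> ?V" "f \<in> ring_R X" for v f
    by (rule bspec[OF conjunct2[OF bspec[OF r that(1)]] that(2)])
  have P: "del_word X (red_word X n v) (S u)
     = (if len X (u \<circ> inv v) + len X v = len X u then S (u \<circ> inv v) else 0)" if "v \<in> ?V" "u \<in> ?V" for u v
  proof -
    have "set (red_word X n v) \<subseteq> nodes X"
      using red_word(1)[OF that(1) n] nodes_below_subset by blast
    moreover have "u \<in> weyl X"
      using that by (simp add: weyl_below_def)
    ultimately show ?thesis
      using del_word_S[of u "red_word X n v"] wprod_rev[of "red_word X n v" X] red_word[OF that(1) n] by simp
  qed
  have bij: "bij v" if "v \<in> ?V" for v
    using that W_infD(1)[OF weyl_subset_W_inf] by (auto simp: weyl_below_def)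
  \<comment> \<open>Here T = (s_v S_u), P = (\<partial>_v S_u) and F = (s_v f), ordered by length.
    If u is not longer than v, then \<partial>_v S_u can be nonzero only when u v^{-1} has length 0,
    that is for u = v.\<close>
  have "\<exists>e q g. e * q = (\<Prod>v\<in>?V. h v) \<and> (\<forall>v\<in>?V. e * ?s v f = (\<Sum>u\<in>?V. ?s v (S u) * g u))"
  proof (rule triangular_factor_solvable[OF finite_weyl_below])
    fix v u assume vu: "v \<in> ?V" "u \<in> ?V"
    show "h v * del_word X (red_word X n v) (S u) = (\<Sum>w\<in>?V. r v w * ?s w (S u))"
      by (rule hr2[OF vu(1) SR[OF vu(2)]])
  next
    fix v assume v: "v \<in> ?V"
    have "v \<circ> inv v = id"
      by (simp only: surj_iff[symmetric] bij_is_surj[OF bij[OF v]])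
    then show "del_word X (red_word X n v) (S v) = 1"
      by (simp only: P[OF v v] len_id add_0 if_True simp_thms S_id)
  next
    fix v u assume vu: "v \<in> ?V" "u \<in> ?V" "u \<noteq> v" "len X u \<le> len X v"
    have vn: "set (rev (red_word X n v)) \<subseteq> nodes X"
      using red_word(1)[OF vu(1) n] nodes_below_subset by auto
    have iv: "wprod (rev (red_word X n v)) = inv v"
      using wprod_rev[of "red_word X n v" X] red_word[OF vu(1) n] vn by simp
    have W: "u \<circ> inv v \<in> weyl X"
      using len_le_comp_word[OF _ vn, of u] vu(2) unfolding iv weyl_below_def by blast
    have "len X (u \<circ> inv v) + len X v \<noteq> len X u"
    proof
      assume "len X (u \<circ> inv v) + len X v = len X u"
      then have "u \<circ> inv v = id"
        using vu(4) len_eq_0[OF W] by simp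
      moreover have "u = (u \<circ> inv v) \<circ> v"
        by (simp only: comp_assoc inv_o_cancel[OF bij_is_inj[OF bij[OF vu(1)]]] comp_id)
      ultimately have "u = v"
        by (simp only: id_comp)
      then show False using vu(3) by simp
    qed
    then show "del_word X (red_word X n v) (S u) = 0"
      using P[OF vu(1,2)] by simp
  qed
  then obtain e q g where e: "e * q = (\<Prod>v\<in>?V. h v)"
    and g: "\<And>v. v \<in> ?V \<Longrightarrow> e * ?s v f = (\<Sum>u\<in>?V. ?s v (S u) * g u)"
    by blast
  have "cancellable (\<Prod>v\<in>?V. h v)"
    by (rule cancellable_prod) (rule hr1)
  then have ce: "cancellable e"
    unfolding e[symmetric] by (rule cancellable_factor)
  have "e * del_word X is f = (\<Sum>u\<in>?V. g u * del_word X is (S u))" if "is": "set is \<subseteq> nodes_below X n" for "is"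
  proof -
    obtain k p where k: "cancellable k" and p: "\<And>f. f \<in> ring_R X \<Longrightarrow> k * del_word X is f = (\<Sum>w\<in>?V. p w * ?s w f)"
      using del_word_eq_sum_s_word[OF n "is"] by blast
    \<comment> \<open>The coefficients \<open>p\<close> of the word in terms of the s_w are the same
      for f and for every S_u, so the relation between the s_w f and the s_w S_u passes to the
      word.\<close>
    have "k * (e * del_word X is f) = e * (\<Sum>w\<in>?V. p w * ?s w f)"
      by (simp only: p[OF f, symmetric] ac_simps)
    also have "\<dots> = (\<Sum>w\<in>?V. p w * (e * ?s w f))"
      by (simp only: sum_distrib_left mult.left_commute)
    also have "\<dots> = (\<Sum>w\<in>?V. \<Sum>u\<in>?V. g u * (p w * ?s w (S u)))"
      by (intro sum.cong refl) (simp only: g sum_distrib_left ac_simps)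
    also have "\<dots> = (\<Sum>u\<in>?V. g u * (\<Sum>w\<in>?V. p w * ?s w (S u)))"
      by (subst sum.swap) (simp only: sum_distrib_left)
    also have "\<dots> = (\<Sum>u\<in>?V. g u * (k * del_word X is (S u)))"
      by (intro sum.cong refl) (simp only: p[OF SR])
    also have "\<dots> = k * (\<Sum>u\<in>?V. g u * del_word X is (S u))"
      by (simp only: sum_distrib_left mult.left_commute)
    finally show ?thesis
      by (rule cancellableD[OF k])
  qed
  then show ?thesis using ce by blast
qed

text \<open>On the S_u a word acts through its product and its number of letters alone, and
  \<open>del_word_eq_sum_S\<close> transfers this to all of R. Reduced words of one element are the
  main case.\<close>

lemma del_word_cong:
  assumes "set is \<subseteq> nodes X" "set js \<subseteq> nodes X" "wprod is = wprod js" "length is = length js" "f \<in> ring_R X"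
  shows "del_word X is f = del_word X js f"
proof -
  obtain n where n: "n \<ge> 2" "set (is @ js) \<subseteq> nodes_below X n"
    using ex_nodes_below[of "is @ js" X] assms by auto
  obtain e g where e: "cancellable e" and
    g: "\<And>is. set is \<subseteq> nodes_below X n \<Longrightarrow> e * del_word X is f = (\<Sum>u\<in>weyl_below X n. g u * del_word X is (S u))"
    using del_word_eq_sum_S[OF n(1) assms(5)] by blast
  have "wprod (rev is) = wprod (rev js)"
    using wprod_rev[OF assms(1)] wprod_rev[OF assms(2)] assms(3) by simp
  then have "del_word X is (S u) = del_word X js (S u)" if "u \<in> weyl_below X n" for u
    using that assms(1,2,4) by (simp add: del_word_S weyl_below_def)
  then have "e * del_word X is f = e * del_word X js f"
    using n(2) by (simp add: g)
  then show ?thesis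
    by (rule cancellableD[OF e])
qed

text \<open>A nonzero value on S_u would require the length to drop by \<open>length is\<close>,
  which multiplication by an element of smaller length cannot achieve.\<close>

lemma del_word_nonreduced:
  assumes "set is \<subseteq> nodes X" "len X (wprod is) < length is" "f \<in> ring_R X"
  shows "del_word X is f = 0"
proof -
  obtain n where n: "n \<ge> 2" "set is \<subseteq> nodes_below X n"
    using ex_nodes_below[OF assms(1)] by auto
  obtain e g where e: "cancellable e" and
    g: "\<And>is. set is \<subseteq> nodes_below X n \<Longrightarrow> e * del_word X is f = (\<Sum>u\<in>weyl_below X n. g u * del_word X is (S u))"
    using del_word_eq_sum_S[OF n(1) assms(3)] by blast
  obtain js where js: "set js \<subseteq> nodes X" "wprod js = wprod is" "length js = len X (wprod is)"
    using ex_reduced_word_weyl[OF wprod_in_weyl[OF assms(1)]] by blast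
  have "del_word X is (S u) = 0" if "u \<in> weyl_below X n" for u
  proof -
    have u: "u \<in> weyl X" using that by (simp add: weyl_below_def)
    have "wprod (rev js) = wprod (rev is)"
      using wprod_rev[OF assms(1)] wprod_rev[OF js(1)] js(2) by simp
    then have "len X u \<le> len X (u \<circ> wprod (rev is)) + length js"
      using len_le_comp_word[OF u, of "rev js"] js(1) by simp
    then have "len X (u \<circ> wprod (rev is)) + length is \<noteq> len X u"
      using assms(2) js(3) by linarith
    then show ?thesis
      using del_word_S[OF u assms(1)] by simp
  qed
  then have "e * del_word X is f = 0"
    using g[OF n(2)] by simp
  then show ?thesis
    using e by (simp add: cancellable_def)
qed

section \<open>Expansion in double Schubert polynomials\<close>

text \<open>The coefficients form a total function that vanishes off a finite subset of the group,
  so uniqueness of expansions becomes an equality of functions.\<close>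

definition expands :: "indet series \<Rightarrow> ((int \<Rightarrow> int) \<Rightarrow> indet series) \<Rightarrow> bool" where
  "expands f c \<longleftrightarrow> finite {w. c w \<noteq> 0} \<and> {w. c w \<noteq> 0} \<subseteq> weyl X \<and> range c \<subseteq> Zt \<and>
     f = (\<Sum>w | c w \<noteq> 0. c w * S w)"

lemma expandsI:
  assumes "finite F" "F \<subseteq> weyl X" "\<And>w. c w \<in> Zt" "\<And>w. w \<notin> F \<Longrightarrow> c w = 0" "f = (\<Sum>w\<in>F. c w * S w)"
  shows "expands f c"
proof -
  have sub: "{w. c w \<noteq> 0} \<subseteq> F" using assms(4) by blast
  have "(\<Sum>w\<in>F. c w * S w) = (\<Sum>w | c w \<noteq> 0. c w * S w)"
    by (rule sum.mono_neutral_right) (use assms(1) sub in auto)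
  then show ?thesis
    using sub assms finite_subset unfolding expands_def by blast
qed

lemma expandsD:
  assumes "expands f c" "finite F" "{w. c w \<noteq> 0} \<subseteq> F"
  shows "f = (\<Sum>w\<in>F. c w * S w)"
proof -
  have "(\<Sum>w | c w \<noteq> 0. c w * S w) = (\<Sum>w\<in>F. c w * S w)"
    by (rule sum.mono_neutral_left) (use assms in auto)
  then show ?thesis using assms(1) by (simp add: expands_def)
qed

lemma expands_basics:
  assumes "expands f c"
  shows "finite {w. c w \<noteq> 0}" "{w. c w \<noteq> 0} \<subseteq> weyl X" "c w \<in> Zt"
  using assms unfolding expands_def by blast+

lemma expands_in_ring_R:
  assumes "expands f c"
  shows "f \<in> ring_R X"
proof -
  note c = expands_basics[OF assms]
  have "(\<Sum>w | c w \<noteq> 0. c w * S w) \<in> ring_R X"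
    using c(2) by (intro ring_R_sum ring_R_mult S_in Zt_in_ring_R[OF c(3)]) blast
  then show ?thesis
    using assms by (simp add: expands_def)
qed

lemma Zt_0: "0 \<in> Zt" and Zt_diff: "a \<in> Zt \<Longrightarrow> b \<in> Zt \<Longrightarrow> a - b \<in> Zt"
  and Zt_add: "a \<in> Zt \<Longrightarrow> b \<in> Zt \<Longrightarrow> a + b \<in> Zt"
  unfolding Zt_def by (auto intro: subring_gen_0 subring_gen.diff subring_gen_add)

lemma expands_diff:
  assumes "expands f c" "expands g d"
  shows "expands (f - g) (\<lambda>w. c w - d w)"
proof (rule expandsI)
  let ?F = "{w. c w \<noteq> 0} \<union> {w. d w \<noteq> 0}"
  show F: "finite ?F" "?F \<subseteq> weyl X" "\<And>w. c w - d w \<in> Zt"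
    using expands_basics[OF assms(1)] expands_basics[OF assms(2)] by (blast intro: Zt_diff)+
  show "\<And>w. w \<notin> ?F \<Longrightarrow> c w - d w = 0" by auto
  show "f - g = (\<Sum>w\<in>?F. (c w - d w) * S w)"
    using expandsD[OF assms(1) F(1)] expandsD[OF assms(2) F(1)]
    by (simp add: left_diff_distrib sum_subtractf)
qed

lemma expands_add:
  assumes "expands f c" "expands g d"
  shows "expands (f + g) (\<lambda>w. c w + d w)"
proof (rule expandsI)
  let ?F = "{w. c w \<noteq> 0} \<union> {w. d w \<noteq> 0}"
  show F: "finite ?F" "?F \<subseteq> weyl X" "\<And>w. c w + d w \<in> Zt"
    using expands_basics[OF assms(1)] expands_basics[OF assms(2)] by (blast intro: Zt_add)+
  show "\<And>w. w \<notin> ?F \<Longrightarrow> c w + d w = 0" by auto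
  show "f + g = (\<Sum>w\<in>?F. (c w + d w) * S w)"
    using expandsD[OF assms(1) F(1)] expandsD[OF assms(2) F(1)]
    by (simp add: distrib_right sum.distrib)
qed

lemma expands_const: "k \<in> Zt \<Longrightarrow> expands k (\<lambda>w. if w = id then k else 0)"
  by (rule expandsI[of "{id}"]) (auto simp: id_in_weyl Zt_0 S_id)

text \<open>The coefficients after a word of divided differences: S_y can only arise from S at y
  times the word, when lengths add. For a reduced word the value at \<open>id\<close> is the
  coefficient at its product, which is how single coefficients are extracted.\<close>

definition shift_coeffs :: "node list \<Rightarrow> ((int \<Rightarrow> int) \<Rightarrow> indet series) \<Rightarrow> (int \<Rightarrow> int) \<Rightarrow> indet series" where
  "shift_coeffs is c y = (if y \<in> weyl X \<and> len X (y \<circ> wprod is) = len X y + length is then c (y \<circ> wprod is) else 0)"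

lemma expands_del_word:
  assumes c: "expands f c" and "is": "set is \<subseteq> nodes X"
  shows "expands (del_word X is f) (shift_coeffs is c)"
proof (rule expandsI)
  let ?p = "wprod is" and ?p' = "wprod (rev is)"
  let ?F = "{w. c w \<noteq> 0}"
  define F' where "F' = {w \<in> ?F. len X (w \<circ> ?p') + length is = len X w}"
  have F: "finite ?F" "?F \<subseteq> weyl X" "\<And>w. c w \<in> Zt" "f = (\<Sum>w\<in>?F. c w * S w)"
    using c by (auto simp: expands_def)
  have rev: "set (rev is) \<subseteq> nodes X" using "is" by simp
  have p: "?p' = inv ?p" "bij ?p"
    using wprod_rev[OF "is"] W_infD(1)[OF weyl_subset_W_inf[OF wprod_in_weyl[OF "is"]]] by auto
  have pp: "?p \<circ> ?p' = id" "?p' \<circ> ?p = id"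
    unfolding p(1) by (simp_all only: surj_iff[symmetric] bij_is_surj[OF p(2)] inv_o_cancel[OF bij_is_inj[OF p(2)]])
  have pp': "w \<circ> ?p \<circ> ?p' = w" "w \<circ> ?p' \<circ> ?p = w" for w :: "int \<Rightarrow> int"
    by (simp_all only: comp_assoc pp comp_id)
  have FW: "w \<circ> ?p' \<in> weyl X" if "w \<in> ?F" for w
    using len_le_comp_word[OF subsetD[OF F(2) that] rev] by blast
  show "finite ((\<lambda>w. w \<circ> ?p') ` F')" "(\<lambda>w. w \<circ> ?p') ` F' \<subseteq> weyl X"
    using F(1) FW by (auto simp: F'_def)
  show "shift_coeffs is c w \<in> Zt" for w
    using F(3) by (simp add: shift_coeffs_def Zt_0)
  show "shift_coeffs is c y = 0" if y: "y \<notin> (\<lambda>w. w \<circ> ?p') ` F'" for y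
  proof (rule ccontr)
    assume "shift_coeffs is c y \<noteq> 0"
    then have "len X (y \<circ> ?p) = len X y + length is" "c (y \<circ> ?p) \<noteq> 0"
      by (auto simp: shift_coeffs_def split: if_splits)
    then have "y \<circ> ?p \<in> F'"
      by (simp add: F'_def pp')
    then have "y \<circ> ?p \<circ> ?p' \<in> (\<lambda>w. w \<circ> ?p') ` F'"
      by (rule imageI)
    then show False
      using y by (simp only: pp')
  qed
  have inj: "inj_on (\<lambda>w. w \<circ> ?p') F'"
    by (rule inj_on_inverseI[of _ "\<lambda>w. w \<circ> ?p"]) (rule pp'(2))
  have "del_word X is f = (\<Sum>w\<in>?F. c w * del_word X is (S w))"
    unfolding F(4) using F(2,3) S_in by (intro del_word_lincomb "is") auto
  also have "\<dots> = (\<Sum>w\<in>?F. if len X (w \<circ> ?p') + length is = len X w then c w * S (w \<circ> ?p') else 0)"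
  proof (intro sum.cong refl)
    fix w assume "w \<in> ?F"
    then have "w \<in> weyl X" using F(2) by blast
    then show "c w * del_word X is (S w)
        = (if len X (w \<circ> ?p') + length is = len X w then c w * S (w \<circ> ?p') else 0)"
      unfolding del_word_S[OF \<open>w \<in> weyl X\<close> "is"] by simp
  qed
  also have "\<dots> = (\<Sum>w\<in>F'. c w * S (w \<circ> ?p'))"
    unfolding F'_def by (rule sum.inter_filter[OF F(1), symmetric])
  also have "\<dots> = (\<Sum>w\<in>F'. shift_coeffs is c (w \<circ> ?p') * S (w \<circ> ?p'))"
  proof (intro sum.cong refl)
    fix w assume w: "w \<in> F'"
    then have "shift_coeffs is c (w \<circ> ?p') = c w"
      using FW[of w] unfolding shift_coeffs_def pp' by (auto simp: F'_def)
    then show "c w * S (w \<circ> ?p') = shift_coeffs is c (w \<circ> ?p') * S (w \<circ> ?p')"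
      by (simp only:)
  qed
  also have "\<dots> = (\<Sum>y\<in>(\<lambda>w. w \<circ> ?p') ` F'. shift_coeffs is c y * S y)"
    unfolding sum.reindex[OF inj] by (simp only: comp_def)
  finally show "del_word X is f = (\<Sum>y\<in>(\<lambda>w. w \<circ> ?p') ` F'. shift_coeffs is c y * S y)" .
qed

lemma del_word_0: "del_word X is 0 = 0"
  by (induction "is") (simp_all add: del_word_Nil del_word_Cons del_z_0)

lemma expands_0:
  assumes "expands 0 c"
  shows "c w = 0"
proof (rule ccontr)
  assume w: "c w \<noteq> 0"
  let ?F = "{w. c w \<noteq> 0}"
  have F: "finite ?F" "?F \<subseteq> weyl X"
    using assms by (auto simp: expands_def)
  have "Max (len X ` ?F) \<in> len X ` ?F"
    using F(1) w by (intro Max_in) auto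
  then obtain v where "v \<in> ?F" "Max (len X ` ?F) = len X v" by (rule imageE)
  then have v: "v \<in> ?F" "\<And>u. u \<in> ?F \<Longrightarrow> len X u \<le> len X v"
    using F(1) Max_ge[of "len X ` ?F"] by auto
  then obtain "is" where "is": "set is \<subseteq> nodes X" "wprod is = v" "length is = len X v"
    using ex_reduced_word_weyl[of v X] F(2) by blast
  have "expands 0 (shift_coeffs is c)"
    using expands_del_word[OF assms "is"(1)] by (simp only: del_word_0)
  \<comment> \<open>A contributing y v lies in the support and has length len y + len v; maximality
    of len v forces y = id.\<close>
  moreover have "{y. shift_coeffs is c y \<noteq> 0} \<subseteq> {id}"
  proof clarify
    fix y assume y: "shift_coeffs is c y \<noteq> 0"
    then have "y \<in> weyl X" "len X (y \<circ> v) = len X y + len X v" "y \<circ> v \<in> ?F"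
      using "is" by (auto simp: shift_coeffs_def split: if_splits)
    then show "y = id"
      using v(2)[of "y \<circ> v"] len_eq_0[of y X] by simp
  qed
  ultimately have "0 = (\<Sum>y\<in>{id}. shift_coeffs is c y * S y)"
    by (intro expandsD) auto
  then have "shift_coeffs is c id = 0"
    by (simp add: S_id)
  then show False
    using "is" v(1) by (simp add: shift_coeffs_def id_in_weyl)
qed

lemma expands_unique: "expands f c \<Longrightarrow> expands f d \<Longrightarrow> c = d"
  using expands_0[of "\<lambda>w. c w - d w"] expands_diff[of f c f d] by (simp add: fun_eq_iff)

lemma shift_coeffs_id:
  assumes "length is = len X (wprod is)"
  shows "shift_coeffs is c id = c (wprod is)"
  using assms by (simp add: shift_coeffs_def id_in_weyl)

lemma invariant_if_del_z_0:
  assumes "f \<in> ring_R X" "\<And>n. n \<in> nodes X \<Longrightarrow> del_z X n f = 0"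
  shows "f \<in> Zt"
proof (rule invariant_in_Zt[OF assms(1)])
  fix n assume n: "n \<in> nodes X"
  show "s_z n f = f"
    using root_mult_del_z[OF n assms(1)] assms(2)[OF n] by simp
qed

text \<open>
  The coefficient of \<open>S\<^sub>w\<close> in \<open>f\<close> is that of \<open>S\<close> at \<open>w s\<^sub>i\<close> in \<open>\<partial>\<^sub>i f\<close>, for any descent \<open>i\<close> of \<open>w\<close>; the braid relations
  make this independent of \<open>i\<close>.
\<close>

lemma ex_expansion:
  assumes "f \<in> ring_R X" "\<And>m. coeff f m \<noteq> 0 \<Longrightarrow> mdeg m < d"
  shows "\<exists>c. expands f c"
  using assms
proof (induction d arbitrary: f)
  case (0 f)
  then have "f = 0"
    by (intro series_eqI) auto
  then show ?case
    using expands_const[OF Zt_0] by auto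
next
  case (Suc d f)
  note f = Suc.prems(1)
  have deg: "degle d f"
    using Suc.prems(2) by (auto simp: degle_def less_Suc_eq_le)
  have "\<exists>c. expands (del_z X n f) c" if n: "n \<in> nodes X" for n
  proof (rule Suc.IH)
    show "del_z X n f \<in> ring_R X"
      by (rule del_z_in_ring_R[OF n f])
    fix m assume m: "coeff (del_z X n f) m \<noteq> 0"
    have "degle d (s_z n f)"
    proof -
      have r: "degle d (refl_z i g)" if "degle d g" for i g
        using that degle_subst by (cases "i = 0") (auto simp: refl_z_0 refl_z_pos)
      then show ?thesis
        using deg by (cases n) auto
    qed
    then have "degle d (omega (simple_root X n) * del_z X n f)"
      unfolding root_mult_del_z[OF n f] by (intro degle_diff deg)
    moreover have "mdeg m' = 1" if "coeff (omega (simple_root X n)) m' \<noteq> 0" for m'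
      using that unfolding omega_simple_root by (rule coeff_signed_z_mdeg)
    ultimately have "Suc (mdeg m) \<le> d"
      using m by (intro degle_linear_quotient[OF cancellable_root])
    then show "mdeg m < d" by simp
  qed
  then obtain C where C: "\<And>n. n \<in> nodes X \<Longrightarrow> expands (del_z X n f) (C n)"
    by metis
  have word: "expands (del_word X (is @ [n]) f) (shift_coeffs is (C n))" if "set is \<subseteq> nodes X" "n \<in> nodes X" for "is" n
    unfolding del_word_snoc by (rule expands_del_word[OF C[OF that(2)] that(1)])
  \<comment> \<open>Reduced words of w s_n and w s_m, extended by n and m, are words of equal length
    for w, so they act equally on f. Comparing the coefficients of S_id in the unique expansions
    gives the claim.\<close>
  have indep: "C n (w \<circ> gen_s n) = C m (w \<circ> gen_s m)"
    if w: "w \<in> weyl X" and nm: "n \<in> nodes X" "m \<in> nodes X"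
      and desc: "len X (w \<circ> gen_s n) < len X w" "len X (w \<circ> gen_s m) < len X w" for w n m
  proof -
    have len: "len X (w \<circ> gen_s k) = len X w - 1" if "k \<in> nodes X" "len X (w \<circ> gen_s k) < len X w" for k
      using len_le_comp_gen_s[OF w that(1)] that(2) by simp
    obtain a where a: "set a \<subseteq> nodes X" "wprod a = w \<circ> gen_s n" "length a = len X (w \<circ> gen_s n)"
      using ex_reduced_word_weyl[OF weyl_comp_gen_s[OF w nm(1)]] by blast
    obtain b where b: "set b \<subseteq> nodes X" "wprod b = w \<circ> gen_s m" "length b = len X (w \<circ> gen_s m)"
      using ex_reduced_word_weyl[OF weyl_comp_gen_s[OF w nm(2)]] by blast
    have "wprod (a @ [n]) = wprod (b @ [m])"
      by (simp only: wprod_snoc a b comp_gen_s_gen_s)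
    moreover have "length (a @ [n]) = length (b @ [m])"
      by (simp add: a(3) b(3) len[OF nm(1) desc(1)] len[OF nm(2) desc(2)])
    ultimately have "del_word X (a @ [n]) f = del_word X (b @ [m]) f"
      using a(1) b(1) nm f by (intro del_word_cong) auto
    then have "shift_coeffs a (C n) = shift_coeffs b (C m)"
      using word[OF a(1) nm(1)] word[OF b(1) nm(2)] expands_unique by metis
    then have "shift_coeffs a (C n) id = shift_coeffs b (C m) id"
      by simp
    then show ?thesis
      using a b by (simp add: shift_coeffs_id)
  qed
  \<comment> \<open>Otherwise a reduced word of u followed by n would not be reduced and would
    annihilate f, while the coefficient of S_id in the result is \<open>C n u\<close>.\<close>
  have ascent: "len X (u \<circ> gen_s n) = len X u + 1" if n: "n \<in> nodes X" and u: "C n u \<noteq> 0" for n u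
  proof -
    have uW: "u \<in> weyl X"
      using C[OF n] u by (auto simp: expands_def)
    obtain a where a: "set a \<subseteq> nodes X" "wprod a = u" "length a = len X u"
      using ex_reduced_word_weyl[OF uW] by blast
    have "\<not> len X (wprod (a @ [n])) < length (a @ [n])"
    proof
      assume "len X (wprod (a @ [n])) < length (a @ [n])"
      then have "del_word X (a @ [n]) f = 0"
        using a(1) n f by (intro del_word_nonreduced) auto
      then have "shift_coeffs a (C n) id = 0"
        using word[OF a(1) n] expands_0 by simp
      then show False
        using a u by (simp add: shift_coeffs_id)
    qed
    then show ?thesis
      using len_comp_gen_s_le[OF uW n] a by (simp add: wprod_snoc)
  qed
  define desc where "desc w n \<longleftrightarrow> n \<in> nodes X \<and> w \<in> weyl X \<and> len X (w \<circ> gen_s n) < len X w" for w n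
  \<comment> \<open>The choice of the descent is immaterial by \<open>indep\<close>. At
    \<open>id\<close>, which has no descent, the value is 0: divided differences do not see the
    coefficient of S_id, which is added at the end.\<close>
  define c where "c w = (if \<exists>n. desc w n then let n = SOME n. desc w n in C n (w \<circ> gen_s n) else 0)" for w
  have c: "c w = C n (w \<circ> gen_s n)" if d: "desc w n" for w n
  proof -
    have s: "desc w (SOME n. desc w n)"
      using d by (rule someI)
    have "c w = C (SOME n. desc w n) (w \<circ> gen_s (SOME n. desc w n))"
      using d by (auto simp: c_def Let_def)
    also have "\<dots> = C n (w \<circ> gen_s n)"
      using s d unfolding desc_def by (intro indep) auto
    finally show ?thesis .
  qed
  have c0: "c w = 0" if "\<And>n. \<not> desc w n" for w
    using that by (simp add: c_def)
  define M where "M = {n \<in> nodes X. s_z n f \<noteq> f}"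
  have Mfin: "finite M"
    unfolding M_def by (rule finite_moved_nodes[OF f])
  have CM: "n \<in> M" if "n \<in> nodes X" "C n u \<noteq> 0" for n u
  proof (rule ccontr)
    assume "n \<notin> M"
    then have "s_z n f = f" using that(1) by (simp add: M_def)
    then have "omega (simple_root X n) * 0 = f - s_z n f" by simp
    then have "del_z X n f = 0" by (rule del_z_eqI)
    then show False
      using C[OF that(1)] expands_0 that(2) by simp
  qed
  define F where "F = (\<Union>n\<in>M. (\<lambda>u. u \<circ> gen_s n) ` {u. C n u \<noteq> 0})"
  define g where "g = (\<Sum>w\<in>F. c w * S w)"
  have "expands g c"
  proof (rule expandsI[OF _ _ _ _ g_def])
    show "finite F"
      unfolding F_def using Mfin C by (auto simp: M_def expands_def)
    show "F \<subseteq> weyl X"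
    proof
      fix w assume "w \<in> F"
      then obtain n u where nu: "n \<in> nodes X" "C n u \<noteq> 0" "w = u \<circ> gen_s n"
        by (auto simp: F_def M_def)
      then have "u \<in> weyl X"
        using C[OF nu(1)] by (auto simp: expands_def)
      then show "w \<in> weyl X"
        unfolding nu(3) by (rule weyl_comp_gen_s[OF _ nu(1)])
    qed
    fix w
    show "c w \<in> Zt"
    proof (cases "\<exists>n. desc w n")
      case True
      then obtain n where n: "desc w n" by blast
      then have "range (C n) \<subseteq> Zt"
        using C[of n] by (auto simp: desc_def expands_def)
      then show ?thesis
        unfolding c[OF n] by blast
    next
      case False
      then show ?thesis using c0 Zt_0 by simp
    qed
    assume w: "w \<notin> F"
    show "c w = 0"
    proof (rule ccontr)
      assume nz: "c w \<noteq> 0"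
      then obtain n where n: "desc w n" using c0 by blast
      then have nX: "n \<in> nodes X" and Cn: "C n (w \<circ> gen_s n) \<noteq> 0"
        using nz c[OF n] by (auto simp: desc_def)
      have "w \<circ> gen_s n \<circ> gen_s n \<in> (\<lambda>u. u \<circ> gen_s n) ` {u. C n u \<noteq> 0}"
        using Cn by (intro imageI CollectI)
      then have "w \<in> F"
        using CM[OF nX Cn] unfolding F_def comp_gen_s_gen_s by blast
      then show False using w by simp
    qed
  qed
  have "del_z X n g = del_z X n f" if n: "n \<in> nodes X" for n
  proof -
    have "shift_coeffs [n] c y = C n y" for y
    proof (cases "y \<in> weyl X \<and> len X (y \<circ> gen_s n) = len X y + 1")
      case True
      then have "desc (y \<circ> gen_s n) n"
        unfolding desc_def comp_gen_s_gen_s using n weyl_comp_gen_s[of y X n] by auto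
      then have "c (y \<circ> gen_s n) = C n y"
        by (simp only: c comp_gen_s_gen_s)
      then show ?thesis
        using True by (simp add: shift_coeffs_def)
    next
      case False
      have "C n y = 0"
      proof (rule ccontr)
        assume nz: "C n y \<noteq> 0"
        then have "y \<in> weyl X"
          using C[OF n] by (auto simp: expands_def)
        then show False
          using ascent[OF n nz] False by simp
      qed
      moreover have "shift_coeffs [n] c y = 0"
        using False by (auto simp: shift_coeffs_def)
      ultimately show ?thesis by simp
    qed
    then have "shift_coeffs [n] c = C n" by (simp add: fun_eq_iff)
    then have "expands (del_z X n g) (C n)"
      using expands_del_word[OF \<open>expands g c\<close>, of "[n]"] n by (simp add: del_word_Cons del_word_Nil)
    then show ?thesis
      using C[OF n] by (simp add: expands_def)
  qed
  then have "del_z X n (f - g) = 0" if "n \<in> nodes X" for n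
    using del_z_diff[OF that f expands_in_ring_R[OF \<open>expands g c\<close>]] that by simp
  then have "f - g \<in> Zt"
    using ring_R_diff[OF f expands_in_ring_R[OF \<open>expands g c\<close>]] by (intro invariant_if_del_z_0)
  \<comment> \<open>Since f and g have the same divided differences, f - g lies in \<int>[t]; it is
    the missing coefficient of S_id = 1.\<close>
  then have "expands (g + (f - g)) (\<lambda>w. c w + (if w = id then f - g else 0))"
    by (intro expands_add \<open>expands g c\<close> expands_const)
  then show ?case by auto
qed

lemma basis: "is_basis Zt (ring_R X) S (weyl X)"
  unfolding is_basis_def
proof (intro conjI allI impI ballI)
  show "S ` weyl X \<subseteq> ring_R X"
    using S_in by blast
next
  fix F :: "(int \<Rightarrow> int) set" and c j
  assume F: "finite F" "F \<subseteq> weyl X" "c ` F \<subseteq> Zt" "(\<Sum>j\<in>F. c j * S j) = 0" and j: "j \<in> F"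
  have "expands 0 (\<lambda>w. if w \<in> F then c w else 0)"
  proof (rule expandsI[OF F(1,2)])
    show "0 = (\<Sum>w\<in>F. (if w \<in> F then c w else 0) * S w)"
      using F(4) by simp
  qed (use F(3) Zt_0 in auto)
  then show "c j = 0"
    using expands_0[of "\<lambda>w. if w \<in> F then c w else 0" j] j by simp
next
  fix f assume f: "f \<in> ring_R X"
  then obtain d where "degle d f"
    using ring_R_degle by blast
  then obtain c where c: "expands f c"
    using ex_expansion[OF f, of "Suc d"] by (auto simp: degle_def less_Suc_eq_le)
  show "\<exists>F c. finite F \<and> F \<subseteq> weyl X \<and> c ` F \<subseteq> Zt \<and> f = (\<Sum>j\<in>F. c j * S j)"
    using c unfolding expands_def by (intro exI[of _ "{w. c w \<noteq> 0}"] exI[of _ c]) auto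
qed

end

section \<open>Uniqueness and symmetry\<close>

text \<open>By induction on the length, all \<partial>_n and \<delta>_n agree on the two
  polynomials. The former put the difference into \<int>[t], the latter make it constant, and the
  constant terms cancel.\<close>

lemma double_schubert_unique:
  assumes S: "double_schubert X S" and T: "double_schubert X T" and "w \<in> weyl X"
  shows "S w = T w"
  using assms(3)
proof (induction "len X w" arbitrary: w rule: less_induct)
  case (less w)
  interpret S: schubert_family X S by standard (rule S)
  interpret T: schubert_family X T by standard (rule T)
  show ?case
  proof (cases "w = id")
    case True
    then show ?thesis by (simp add: S.S_id T.S_id)
  next
    case False
    let ?f = "S w - T w"
    have f: "?f \<in> ring_R X"
      by (intro ring_R_diff S.S_in T.S_in less.prems)
    have "del_z X n ?f = 0" if n: "n \<in> nodes X" for n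
      using less.hyps[OF _ weyl_comp_gen_s[OF less.prems n]]
      by (simp add: del_z_diff[OF n S.S_in[OF less.prems] T.S_in[OF less.prems]] S.del_z_S T.del_z_S less.prems n)
    then have Zt: "?f \<in> Zt"
      by (intro S.invariant_if_del_z_0[OF f])
    have "s_t n ?f = ?f" if n: "n \<in> nodes X" for n
    proof -
      have "del_t X n (S w) = del_t X n (T w)"
        using S T less.prems n less.hyps[OF _ gen_s_comp_weyl(1)[OF less.prems n]]
        unfolding double_schubert_def by auto
      then have "S w - s_t n (S w) = T w - s_t n (T w)"
        using simple_root_mult_del_t[OF n S.S_in[OF less.prems]] simple_root_mult_del_t[OF n T.S_in[OF less.prems]]
        by simp
      then show ?thesis
        by (simp add: s_t.hom_minus algebra_simps)
    qed
    moreover have "coeff ?f 0 = 0"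
      using S T less.prems False by (simp add: double_schubert_def)
    ultimately have "?f = 0"
      using Zt by (intro Zt_invariant_eq_0[of _ X]) auto
    then show ?thesis by simp
  qed
qed

lemma push_eq_0D: "push h m = 0 \<Longrightarrow> m = 0"
  using keys_push[of h m] by (auto simp: keys_eq_empty)

lemma coeff_subst_0: "coeff (subst c h f) 0 = coeff f 0"
proof -
  have "{m'. push h m' = 0} = {0}"
    using push_eq_0D[of h] by auto
  then show ?thesis
    by (simp add: coeff_subst)
qed

text \<open>Inversion exchanges left and right multiplication and preserves the length, while
  \<omega> exchanges \<partial>_n and \<delta>_n. The symmetry thus becomes an instance of
  uniqueness.\<close>

lemma double_schubert_dual:
  assumes "double_schubert X S"
  shows "double_schubert X (\<lambda>w. omega (S (inv w)))"
proof -
  interpret schubert_family X S by standard (rule assms)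
  have z: "del_z X n (omega (S (inv w))) = (if len X (w \<circ> gen_s n) < len X w then omega (S (inv (w \<circ> gen_s n))) else 0)"
    if w: "w \<in> weyl X" and n: "n \<in> nodes X" for w n
  proof -
    note iw = inv_in_weyl[OF w]
    have "omega (del_z X n (omega (S (inv w)))) = del_t X n (S (inv w))"
      using omega_del_z[OF n omega_in_ring_R[OF S_in[OF iw]]] by simp
    also have "\<dots> = (if len X (gen_s n \<circ> inv w) < len X (inv w) then S (gen_s n \<circ> inv w) else 0)"
      using assms iw n by (simp add: double_schubert_def)
    also have "gen_s n \<circ> inv w = inv (w \<circ> gen_s n)"
      by (rule gen_s_comp_weyl(3)[OF w n, symmetric])
    finally have "omega (omega (del_z X n (omega (S (inv w))))) =
        omega (if len X (inv (w \<circ> gen_s n)) < len X (inv w) then S (inv (w \<circ> gen_s n)) else 0)"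
      by (rule arg_cong)
    then show ?thesis
      by (simp add: len_inv[OF w] len_inv[OF weyl_comp_gen_s[OF w n]] omega.hom_zero)
  qed
  have t: "del_t X n (omega (S (inv w))) = (if len X (gen_s n \<circ> w) < len X w then omega (S (inv (gen_s n \<circ> w))) else 0)"
    if w: "w \<in> weyl X" and n: "n \<in> nodes X" for w n
  proof -
    note iw = inv_in_weyl[OF w]
    have "del_t X n (omega (S (inv w))) = omega (del_z X n (S (inv w)))"
      by (rule omega_del_z[OF n S_in[OF iw], symmetric])
    also have "\<dots> = omega (if len X (inv (gen_s n \<circ> w)) < len X (inv w) then S (inv (gen_s n \<circ> w)) else 0)"
      by (simp only: del_z_S[OF iw n] gen_s_comp_weyl(2)[OF w n])
    finally show ?thesis
      by (simp add: len_inv[OF w] len_inv[OF gen_s_comp_weyl(1)[OF w n]] omega.hom_zero)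
  qed
  have c: "coeff (omega (S (inv w))) 0 = 0" if w: "w \<in> weyl X" "w \<noteq> id" for w
  proof -
    have "inv w \<noteq> id"
      using w W_infD(1)[OF weyl_subset_W_inf[OF w(1)]] by (metis inv_id inv_inv_eq)
    then have "coeff (S (inv w)) 0 = 0"
      using assms inv_in_weyl[OF w(1)] by (simp add: double_schubert_def)
    then show ?thesis
      by (simp add: omega_altdef coeff_subst_0)
  qed
  show ?thesis
    unfolding double_schubert_def
    using z t c S_id omega_in_ring_R[OF S_in[OF inv_in_weyl]] by (simp add: omega.hom_one)
qed

section \<open>The specialisation t = 0\<close>

lemma set_t_zero_signed_z: "set_t_zero (signed_z j) = signed_z j"
  by (auto simp: signed_z_def set_t_zero_zvar set_t_zero.hom_uminus)

lemma set_t_zero_del_z: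
  assumes "n \<in> nodes X" "f \<in> ring_R X"
  shows "set_t_zero (del_z X n f) = del_z X n (set_t_zero f)"
proof (rule del_z_eqI[symmetric])
  have "set_t_zero (omega (simple_root X n)) = omega (simple_root X n)"
    by (simp add: omega_simple_root set_t_zero.hom_add set_t_zero_signed_z)
  then show "omega (simple_root X n) * set_t_zero (del_z X n f) = set_t_zero f - s_z n (set_t_zero f)"
    using arg_cong[OF root_mult_del_z[OF assms], of set_t_zero]
    by (simp add: set_t_zero.hom_mult set_t_zero.hom_minus set_t_zero_s_z)
qed

lemma set_t_zero_Zt:
  assumes "f \<in> Zt"
  shows "set_t_zero f \<in> range of_int"
  using assms unfolding Zt_def
proof (induction rule: subring_gen.induct)
  case (gen g)
  then show ?case
    by (auto simp: set_t_zero_tvar intro!: image_eqI[of _ _ 0])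
next
  case one
  then show ?case
    by (auto simp: set_t_zero.hom_one intro!: image_eqI[of _ _ 1])
next
  case (diff f g)
  then show ?case
    by (auto simp: set_t_zero.hom_minus simp flip: of_int_diff)
next
  case (mult f g)
  then show ?case
    by (auto simp: set_t_zero.hom_mult simp flip: of_int_mult)
qed

lemma set_t_zero_ring_BH: 
  assumes "f \<in> ring_BH X"
  shows "set_t_zero f = f"
proof -
  have "set_t_zero f = id f"
    using assms unfolding ring_BH_def
    by (rule subring_gen_hom_eq[OF _ comm_ring_hom_set_t_zero comm_ring_hom_id])
      (auto simp: set_t_zero_zvar Gamma_gens_fixed)
  then show ?thesis by simp
qed

lemma set_t_zero_eq_billey_haiman:
  assumes S: "double_schubert X S" and B: "billey_haiman X B" and "w \<in> weyl X"
  shows "set_t_zero (S w) = B w"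
  using assms(3)
proof (induction "len X w" arbitrary: w rule: less_induct)
  case (less w)
  interpret schubert_family X S by standard (rule S)
  note w = less.prems
  show ?case
  proof (cases "w = id")
    case True
    then show ?thesis
      using B by (simp add: S_id set_t_zero.hom_one billey_haiman_def)
  next
    case False
    let ?f = "set_t_zero (S w) - B w"
    have BH: "set_t_zero (S w) \<in> ring_BH X" "B w \<in> ring_BH X"
      using set_t_zero_in_ring_BH[OF S_in[OF w]] B w by (auto simp: billey_haiman_def)
    then have R: "set_t_zero (S w) \<in> ring_R X" "B w \<in> ring_R X"
      using ring_BH_subset_ring_R by auto
    have "del_z X n ?f = 0" if n: "n \<in> nodes X" for n
    proof -
      have "del_z X n (set_t_zero (S w)) = set_t_zero (if len X (w \<circ> gen_s n) < len X w then S (w \<circ> gen_s n) else 0)"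
        by (simp only: set_t_zero_del_z[OF n S_in[OF w], symmetric] del_z_S[OF w n])
      also have "\<dots> = (if len X (w \<circ> gen_s n) < len X w then B (w \<circ> gen_s n) else 0)"
        using less.hyps[OF _ weyl_comp_gen_s[OF w n]] by (simp add: set_t_zero.hom_zero)
      also have "\<dots> = del_z X n (B w)"
        using B w n by (simp add: billey_haiman_def)
      finally show ?thesis
        using del_z_diff[OF n R] by simp
    qed
    then have "?f \<in> Zt"
      by (intro invariant_if_del_z_0 ring_R_diff R)
    \<comment> \<open>The difference lies both in \<int>[t] and in the t-free ring
      \<open>ring_BH X\<close>: setting t = 0 fixes it and makes it an integer, which is 0 by the
      constant terms.\<close>
    then have "set_t_zero ?f \<in> range of_int"
      by (rule set_t_zero_Zt)
    moreover have "set_t_zero ?f = ?f"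
      by (simp only: set_t_zero.hom_minus set_t_zero_ring_BH[OF BH(1)] set_t_zero_ring_BH[OF BH(2)])
    ultimately obtain k where k: "?f = of_int k"
      by auto
    have "coeff ?f 0 = 0"
      using S B w False by (simp add: double_schubert_def billey_haiman_def set_t_zero_def coeff_subst_0)
    moreover have "coeff (of_int k) 0 = k" for k
      using coeff_of_int_mult[of k 1 0] by (simp add: coeff_1)
    ultimately have "k = 0"
      unfolding k by metis
    then show ?thesis
      using k by simp
  qed
qed

theorem theorem8p1:
  fixes X :: lie_type and S :: "(int \<Rightarrow> int) \<Rightarrow> indet series"
  assumes "double_schubert X S"
  shows "is_basis Zt (ring_R X) S (weyl X) \<and>
    (\<forall>B. billey_haiman X B \<longrightarrow> (\<forall>w\<in>weyl X. set_t_zero (S w) = B w)) \<and>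
    (\<forall>w\<in>weyl X. omega (S w) = S (inv w))"
proof (intro conjI allI impI ballI)
  interpret schubert_family X S by standard (rule assms)
  show "is_basis Zt (ring_R X) S (weyl X)"
    by (rule basis)
next
  fix B w assume "billey_haiman X B" "w \<in> weyl X"
  then show "set_t_zero (S w) = B w"
    by (rule set_t_zero_eq_billey_haiman[OF assms])
next
  fix w assume w: "w \<in> weyl X"
  have "inv (inv w) = w"
    using W_infD(1)[OF weyl_subset_W_inf[OF w]] by (rule inv_inv_eq)
  \<comment> \<open>Uniqueness is applied at the inverse of \<open>w\<close>, where the dual family
    takes the value \<omega>(S_w).\<close>
  then show "omega (S w) = S (inv w)"
    using double_schubert_unique[OF assms double_schubert_dual[OF assms] inv_in_weyl[OF w]] by simp
qed

end
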